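(* Let $T>0$, $a>0$, $b>0$, $p>1$ and $\alpha\in(1/p,1]$ be constants, and let $f\in C^1([0,T]\times\mathbb{R},\mathbb{R})$ with $F(t,x)=\int_0^x f(t,s)\,ds$. Assume: (i) for every $t\in[0,T]$, the map $x\mapsto f(t,x)/|x|^{p^2-1}$ is strictly increasing on $\mathbb{R}\setminus\{0\}$; (ii) $f(t,x)=o(|x|^{p-1})$ as $|x|\to 0$, uniformly in $t\in[0,T]$; (iii) there exist constants $\mu>p^2$ and $R>0$ such that $0<\mu F(t,x)\le x f(t,x)$ for all $t\in[0,T]$ and all $x\in\mathbb{R}$ with $|x|\ge R$. Then the Dirichlet problem $$\Big(a+b\int_0^T|{}_0D_t^\alpha u(t)|^p\,dt\Big)^{p-1}\,{}_tD_T^\alpha\,\phi_p\big({}_0D_t^\alpha u(t)\big)=f(t,u(t)),\quad t\in(0,T),\qquad u(0)=u(T)=0,$$ possesses at least one nontrivial ground state solution.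
   Context: For $\gamma\in(0,1)$ and $u:[0,T]\to\mathbb{R}$, the left and right Riemann–Liouville fractional derivatives are ${}_0D_t^\gamma u(t)=\frac{d}{dt}\frac{1}{\Gamma(1-\gamma)}\int_0^t (t-s)^{-\gamma}u(s)\,ds$ and ${}_tD_T^\gamma u(t)=-\frac{d}{dt}\frac{1}{\Gamma(1-\gamma)}\int_t^T (s-t)^{-\gamma}u(s)\,ds$; for $\gamma=1$, ${}_0D_t^1u=u'$ and ${}_tD_T^1u=-u'$. $\phi_p(s)=|s|^{p-2}s$ for $s\neq 0$, $\phi_p(0)=0$. The space $E_0^{\alpha,p}$ is the closure of $C_0^\infty([0,T],\mathbb{R})$ with respect to the norm $(\|u\|_{L^p}^p+\|{}_0D_t^\alpha u\|_{L^p}^p)^{1/p}$; it is equipped with the equivalent norm $\|u\|:=\|{}_0D_t^\alpha u\|_{L^p}$. The energy functional $I:E_0^{\alpha,p}\to\mathbb{R}$ is $I(u)=\frac{1}{bp^2}(a+b\|u\|^p)^p-\int_0^T F(t,u(t))\,dt-\frac{a^p}{bp^2}$, which is $C^2$ with $\langle I'(u),v\rangle=(a+b\|u\|^p)^{p-1}\int_0^T\phi_p({}_0D_t^\alpha u)\,{}_0D_t^\alpha v\,dt-\int_0^T f(t,u)v\,dt$. Weak solutions of the problem are the critical points of $I$. The Nehari manifold is $\mathcal{N}=\{u\in E_0^{\alpha,p}\setminus\{0\}:\langle I'(u),u\rangle=0\}$. A nontrivial ground state solution is a critical point $u\neq 0$ of $I$ with $I(u)=\inf_{\mathcal{N}}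 I$. *)

theory Defs
  imports "HOL-Analysis.Analysis"
begin

definition phi_p :: "real \<Rightarrow> real \<Rightarrow> real" where
  "phi_p p s = (if s = 0 then 0 else \<bar>s\<bar> powr (p - 2) * s)"

definition frac_left_deriv :: "real \<Rightarrow> (real \<Rightarrow> real) \<Rightarrow> real \<Rightarrow> real" where
  "frac_left_deriv \<gamma> u t =
     (if \<gamma> = 1 then deriv u t
      else deriv (\<lambda>s. (1 / Gamma (1 - \<gamma>)) *
                     (LINT r:{0..s}|lborel. (s - r) powr (- \<gamma>) * u r)) t)"

text \<open>Right Riemann--Liouville derivative (only for documentation of the
  strong form of the problem; the weak formulation does not use it).\<close>
definition frac_right_deriv :: "real \<Rightarrow> real \<Rightarrow> (real \<Rightarrow> real) \<Rightarrow> real \<Rightarrow> real" where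
  "frac_right_deriv T \<gamma> u t =
     (if \<gamma> = 1 then - deriv u t
      else - deriv (\<lambda>s. (1 / Gamma (1 - \<gamma>)) *
                     (LINT r:{s..T}|lborel. (r - s) powr (- \<gamma>) * u r)) t)"

definition test_fun :: "real \<Rightarrow> (real \<Rightarrow> real) \<Rightarrow> bool" where
  "test_fun T \<phi> \<longleftrightarrow>
     (\<forall>k. \<forall>x. ((deriv ^^ k) \<phi> has_real_derivative (deriv ^^ Suc k) \<phi> x) (at x)) \<and>
     (\<exists>\<epsilon>>0. \<forall>x. x \<notin> {\<epsilon>..T - \<epsilon>} \<longrightarrow> \<phi> x = 0)"

text \<open>Membership in E_0^{alpha,p}, the closure of C_0^infinity([0,T]) w.r.t.
  the norm (|u|_p^p + |D^alpha u|_p^p)^(1/p). An element is represented by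
  the pair (u, w) where w is the (extended) left fractional derivative of u,
  i.e. the L^p-limit of D^alpha phi_n for an approximating sequence phi_n.\<close>
definition in_E :: "real \<Rightarrow> real \<Rightarrow> real \<Rightarrow> (real \<Rightarrow> real) \<Rightarrow> (real \<Rightarrow> real) \<Rightarrow> bool" where
  "in_E T \<alpha> p u w \<longleftrightarrow>
     u \<in> borel_measurable lborel \<and> w \<in> borel_measurable lborel \<and>
     set_integrable lborel {0..T} (\<lambda>t. \<bar>u t\<bar> powr p) \<and>
     set_integrable lborel {0..T} (\<lambda>t. \<bar>w t\<bar> powr p) \<and>
     (\<exists>\<phi>. (\<forall>n. test_fun T (\<phi> n)) \<and>
        (\<lambda>n. LINT t:{0..T}|lborel. \<bar>\<phi> n t - u t\<bar> powr p) \<longlonglongrightarrow> 0 \<and>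
        (\<lambda>n. LINT t:{0..T}|lborel. \<bar>frac_left_deriv \<alpha> (\<phi> n) t - w t\<bar> powr p) \<longlonglongrightarrow> 0)"

definition nontrivial_on :: "real \<Rightarrow> (real \<Rightarrow> real) \<Rightarrow> bool" where
  "nontrivial_on T u \<longleftrightarrow> \<not> (AE t in lborel. t \<in> {0..T} \<longrightarrow> u t = 0)"

definition Fprim :: "(real \<Rightarrow> real \<Rightarrow> real) \<Rightarrow> real \<Rightarrow> real \<Rightarrow> real" where
  "Fprim f t x = (LBINT s=0..x. f t s)"

text \<open>Energy functional I; note \<parallel>u\<parallel>^p = integral of |D^alpha u|^p.\<close>
definition energy :: "real \<Rightarrow> real \<Rightarrow> real \<Rightarrow> real \<Rightarrow> (real \<Rightarrow> real \<Rightarrow> real)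
    \<Rightarrow> (real \<Rightarrow> real) \<Rightarrow> (real \<Rightarrow> real) \<Rightarrow> real" where
  "energy T a b p f u w =
     (a + b * (LINT t:{0..T}|lborel. \<bar>w t\<bar> powr p)) powr p / (b * p^2)
     - (LINT t:{0..T}|lborel. Fprim f t (u t))
     - a powr p / (b * p^2)"

definition dI :: "real \<Rightarrow> real \<Rightarrow> real \<Rightarrow> real \<Rightarrow> (real \<Rightarrow> real \<Rightarrow> real)
    \<Rightarrow> (real \<Rightarrow> real) \<Rightarrow> (real \<Rightarrow> real) \<Rightarrow> (real \<Rightarrow> real) \<Rightarrow> (real \<Rightarrow> real) \<Rightarrow> real" where
  "dI T a b p f u w v w' =
     (a + b * (LINT t:{0..T}|lborel. \<bar>w t\<bar> powr p)) powr (p - 1)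
       * (LINT t:{0..T}|lborel. phi_p p (w t) * w' t)
     - (LINT t:{0..T}|lborel. f t (u t) * v t)"

text \<open>Critical point of I on E (= weak solution of the Dirichlet problem).\<close>
definition critical_point where
  "critical_point T \<alpha> a b p f u w \<longleftrightarrow>
     in_E T \<alpha> p u w \<and> (\<forall>v w'. in_E T \<alpha> p v w' \<longrightarrow> dI T a b p f u w v w' = 0)"

definition nehari where
  "nehari T \<alpha> a b p f u w \<longleftrightarrow>
     in_E T \<alpha> p u w \<and> nontrivial_on T u \<and> dI T a b p f u w u w = 0"

text \<open>Nontrivial ground state: nonzero critical point u with I(u) = inf over
  the Nehari manifold (u itself lies in N, so the infimum is attained at u).\<close>
definition ground_state where
  "ground_state T \<alpha> a b p f u w \<longleftrightarrow>
     critical_point T \<alpha> a b p f u w \<and> nontrivial_on T u \<and>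
     (\<forall>v w'. nehari T \<alpha> a b p f v w' \<longrightarrow> energy T a b p f u w \<le> energy T a b p f v w')"

end

theory Submission
  imports Defs "HOL-Complex_Analysis.Great_Picard" "HOL-Computational_Algebra.Polynomial"
begin

text \<open>Since \<open>\<alpha> > 1/p\<close>, a test function is recovered from its fractional derivative \<open>w\<close> by the
  fractional integral, and Hoelder's inequality bounds it in a Hoelder norm by the \<open>L\<^sup>p\<close> norm
  of \<open>w\<close>. So an element of the space is determined by \<open>w\<close>, has a continuous representative, and
  bounded sequences have uniformly convergent subsequences.

  By (i), the energy along a ray has exactly one critical point, its maximum, so the infimum over the
  Nehari manifold is a minimax over rays. A minimising sequence is bounded by (iii) and, by (ii), stays
  away from 0. If it were not Cauchy in \<open>L\<^sup>p\<close>, uniform convexity would give midpoints of smaller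
  norm with the same uniform limit, and projecting them onto the manifold would push the energy below
  the infimum. The limit is thus a minimiser, and comparing it with the projections of its
  perturbations shows that it is a critical point.\<close>

section \<open>Elementary inequalities for powers\<close>

text \<open>The number p^2 is the degree of the Kirchhoff term along rays:
  \<open>(a + b * (r powr p * B)) powr p\<close> grows like r^(p^2). In the variable r^(p^2) this
  term is concave because a > 0, while (i) makes the integral of F convex. For small r the Kirchhoff
  term wins by (ii), for large r the potential wins by (iii), since \<mu> > p^2.

  The obstacle is that the uniform limit u of a minimising sequence comes with a limit A of the
  masses, but at first with no fractional derivative whose mass is A: weak limits could lose mass.
  The pair (A, u) is therefore handled as if it were an element of the space. Energy and fibering
  map become functions of a number and a continuous function, the minimality of (A, u) is
  established on that level, and strong convergence is deduced from it.

  Perturbations are compared at equal dilation factors r. The difference of energies then contains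
  only the perturbation parameter to first order, and r has to be controlled only through r ->
  1.\<close>

lemma abs_add_powr_le:
  fixes x y p :: real
  assumes "p \<ge> 0"
  shows "\<bar>x + y\<bar> powr p \<le> 2 powr p * (\<bar>x\<bar> powr p + \<bar>y\<bar> powr p)"
proof -
  have "\<bar>x + y\<bar> powr p \<le> (2 * max \<bar>x\<bar> \<bar>y\<bar>) powr p"
    using assms by (intro powr_mono2) auto
  also have "\<dots> = 2 powr p * (max \<bar>x\<bar> \<bar>y\<bar>) powr p"
    by (simp add: powr_mult)
  also have "(max \<bar>x\<bar> \<bar>y\<bar>) powr p \<le> \<bar>x\<bar> powr p + \<bar>y\<bar> powr p"
    by (auto simp: max_def)
  finally show ?thesis by simp
qed

lemma abs_diff_powr_le:
  fixes x y p :: real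
  assumes "p \<ge> 0"
  shows "\<bar>x - y\<bar> powr p \<le> 2 powr p * (\<bar>x\<bar> powr p + \<bar>y\<bar> powr p)"
  using abs_add_powr_le[OF assms, of x "- y"] by simp

text \<open>This form has no case distinction and, for p > 1, a positive exponent, so monotonicity
  and measurability can be read off from it.\<close>

lemma phi_p_eq_sgn: "phi_p p s = sgn s * \<bar>s\<bar> powr (p - 1)"
proof (cases "s = 0")
  case False
  then have "\<bar>s\<bar> powr (p - 1) = \<bar>s\<bar> powr (p - 2) * \<bar>s\<bar>"
    using powr_add[of "\<bar>s\<bar>" "p - 2" 1] by simp
  then show ?thesis using False by (simp add: phi_p_def sgn_if abs_if)
qed (simp add: phi_p_def)

lemma phi_p_mult_self: "phi_p p s * s = \<bar>s\<bar> powr p"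
proof (cases "s = 0")
  case False
  then have "\<bar>s\<bar> powr p = \<bar>s\<bar> powr (p - 1) * \<bar>s\<bar>"
    using powr_add[of "\<bar>s\<bar>" "p - 1" 1] by simp
  then show ?thesis using False by (simp add: phi_p_eq_sgn sgn_if abs_if)
qed (simp add: phi_p_def)

lemma abs_phi_p: "\<bar>phi_p p s\<bar> = \<bar>s\<bar> powr (p - 1)"
  by (simp add: phi_p_eq_sgn abs_mult sgn_if)

lemma phi_p_less:
  assumes "p > 1" "x < y"
  shows "phi_p p x < phi_p p y"
proof -
  consider "0 \<le> x" | "y \<le> 0" | "x < 0" "0 < y" by linarith
  then show ?thesis
  proof cases
    case 1
    then have "x powr (p - 1) < y powr (p - 1)"
      using assms by (intro powr_less_mono2) auto
    then show ?thesis using assms 1 by (auto simp: phi_p_eq_sgn sgn_if)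
  next
    case 2
    then have "(- y) powr (p - 1) < (- x) powr (p - 1)"
      using assms by (intro powr_less_mono2) auto
    then show ?thesis using assms 2 by (auto simp: phi_p_eq_sgn sgn_if)
  next
    case 3
    have "phi_p p x < 0" "phi_p p y > 0" using 3 by (auto simp: phi_p_eq_sgn sgn_if)
    then show ?thesis by linarith
  qed
qed

text \<open>Only 0 needs care, where the exponent p - 2 may be negative: there the absolute value is
  \<open>\<bar>s\<bar> powr (p - 1)\<close>, which tends to 0.\<close>

lemma isCont_phi_p:
  assumes "p > 1"
  shows "isCont (phi_p p) x"
proof (cases "x = 0")
  case True
  have "((\<lambda>s. \<bar>s\<bar> powr (p - 1)) \<longlongrightarrow> \<bar>0\<bar> powr (p - 1)) (at (0::real))"
    using assms by (intro tendsto_powr' tendsto_intros) auto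
  then have "((\<lambda>s. \<bar>phi_p p s\<bar>) \<longlongrightarrow> 0) (at (0::real))"
    by (simp add: abs_phi_p)
  then show ?thesis
    using True phi_p_def[of p 0] by (simp add: isCont_def tendsto_rabs_zero_iff)
next
  case False
  have "isCont (\<lambda>s. \<bar>s\<bar> powr (p - 2) * s) x"
    using False by (intro continuous_intros) auto
  moreover have "\<forall>\<^sub>F s in nhds x. phi_p p s = \<bar>s\<bar> powr (p - 2) * s"
    using False by (intro eventually_mono[OF t1_space_nhds[of x 0]]) (auto simp: phi_p_def)
  ultimately show ?thesis by (simp add: isCont_cong)
qed

lemma has_real_derivative_abs_powr:
  assumes "p > 1"
  shows "((\<lambda>x. \<bar>x\<bar> powr p) has_real_derivative p * phi_p p x) (at x)"
proof -
  consider "x > 0" | "x < 0" | "x = 0" by linarith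
  then show ?thesis
  proof cases
    case 1
    have "((\<lambda>x. x powr p) has_real_derivative p * phi_p p x) (at x)"
      using 1 by (auto intro!: derivative_eq_intros simp: phi_p_eq_sgn)
    then show ?thesis
      by (rule has_field_derivative_transform_within_open[of _ _ _ "{0<..}"]) (use 1 in auto)
  next
    case 2
    have "((\<lambda>x. (- x) powr p) has_real_derivative p * phi_p p x) (at x)"
      using 2 by (auto intro!: derivative_eq_intros simp: phi_p_eq_sgn)
    then show ?thesis
      by (rule has_field_derivative_transform_within_open[of _ _ _ "{..<0}"]) (use 2 in auto)
  next
    case 3
    \<comment> \<open>At 0 the difference quotient is \<open>phi_p\<close> itself, so its continuity
      supplies the derivative.\<close>
    have "\<bar>h\<bar> powr p / h = phi_p p h" if "h \<noteq> 0" for h :: real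
      using that by (simp add: phi_p_mult_self[symmetric])
    then have "((\<lambda>h. \<bar>h\<bar> powr p / h) \<longlongrightarrow> 0) (at 0) \<longleftrightarrow> (phi_p p \<longlongrightarrow> 0) (at 0)"
      by (intro Lim_cong_within) auto
    moreover have "(phi_p p \<longlongrightarrow> 0) (at 0)"
      using isCont_phi_p[OF assms, of 0] by (simp add: isCont_def phi_p_def)
    ultimately show ?thesis using 3 assms by (simp add: DERIV_def phi_p_def)
  qed
qed

text \<open>Strict convexity in tangent form: the mean value theorem gives the slope at a point
  strictly between x and y, and \<open>phi_p\<close> is strictly increasing. The positive minimum in
  the uniform convexity estimate rests on this strictness.\<close>

lemma abs_powr_tangent_strict:
  assumes "p > 1" "x \<noteq> y"
  shows "\<bar>x\<bar> powr p + p * phi_p p x * (y - x) < \<bar>y\<bar> powr p"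
proof (cases "x < y")
  case True
  obtain z where "x < z" "z < y" "\<bar>y\<bar> powr p - \<bar>x\<bar> powr p = (y - x) * (p * phi_p p z)"
    using MVT2[OF True, of "\<lambda>x. \<bar>x\<bar> powr p" "\<lambda>x. p * phi_p p x"]
      has_real_derivative_abs_powr[OF assms(1)] by blast
  moreover have "(y - x) * (p * phi_p p x) < (y - x) * (p * phi_p p z)"
    using phi_p_less[OF assms(1) \<open>x < z\<close>] assms True by simp
  ultimately show ?thesis by (simp add: algebra_simps)
next
  case False
  then have "y < x" using assms by simp
  obtain z where "y < z" "z < x" "\<bar>x\<bar> powr p - \<bar>y\<bar> powr p = (x - y) * (p * phi_p p z)"
    using MVT2[OF \<open>y < x\<close>, of "\<lambda>x. \<bar>x\<bar> powr p" "\<lambda>x. p * phi_p p x"]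
      has_real_derivative_abs_powr[OF assms(1)] by blast
  moreover have "(x - y) * (p * phi_p p z) < (x - y) * (p * phi_p p x)"
    using phi_p_less[OF assms(1) \<open>z < x\<close>] assms \<open>y < x\<close> by simp
  ultimately show ?thesis by (simp add: algebra_simps)
qed

lemma abs_powr_tangent:
  assumes "p > 1"
  shows "\<bar>x\<bar> powr p - \<bar>y\<bar> powr p \<le> p * phi_p p x * (x - y)"
  using abs_powr_tangent_strict[OF assms, of x y] by (cases "x = y") (auto simp: algebra_simps)

text \<open>The tangent at the midpoint changes by opposite amounts towards x and towards y, so
  these terms cancel when the two strict inequalities are averaged.\<close>

lemma abs_powr_midpoint_strict:
  fixes x y p :: real
  assumes "p > 1" "x \<noteq> y"
  shows "\<bar>(x + y) / 2\<bar> powr p < (\<bar>x\<bar> powr p + \<bar>y\<bar> powr p) / 2"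
proof -
  define m where "m = (x + y) / 2"
  have "m \<noteq> x" "m \<noteq> y" using assms(2) by (auto simp: m_def)
  define k where "k = p * phi_p p m * (y - m)"
  have "x - m = - (y - m)" by (simp add: m_def field_simps)
  then have "p * phi_p p m * (x - m) = - k"
    unfolding k_def by (metis mult_minus_right)
  then have "\<bar>m\<bar> powr p - k < \<bar>x\<bar> powr p" "\<bar>m\<bar> powr p + k < \<bar>y\<bar> powr p"
    using abs_powr_tangent_strict[OF assms(1) \<open>m \<noteq> x\<close>] abs_powr_tangent_strict[OF assms(1) \<open>m \<noteq> y\<close>]
    by (simp_all add: k_def)
  moreover have "a - k < b \<Longrightarrow> a + k < c \<Longrightarrow> a < (b + c) / 2" for a b c
    by (simp add: field_simps)
  ultimately show ?thesis unfolding m_def[symmetric] by blast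
qed

lemma abs_powr_midpoint:
  fixes x y p :: real
  assumes "p > 1"
  shows "\<bar>(x + y) / 2\<bar> powr p \<le> (\<bar>x\<bar> powr p + \<bar>y\<bar> powr p) / 2"
  using abs_powr_midpoint_strict[OF assms, of x y] by (cases "x = y") auto

lemma continuous_on_abs_powr [continuous_intros]:
  assumes "p > 0" "continuous_on S g"
  shows "continuous_on S (\<lambda>x. \<bar>g x :: real\<bar> powr p)"
  using assms by (intro continuous_on_powr' continuous_intros) auto

text \<open>A pointwise form of uniform convexity: by homogeneity it suffices to compare both sides on
  the compact set where the right-hand weight is 1, and there strict convexity gives a positive
  minimum away from the diagonal.\<close>

lemma abs_powr_uniform_convexity:
  fixes p :: real
  assumes p: "p > 1" and "e > 0"
  shows "\<exists>C\<ge>0. \<forall>x y. \<bar>x - y\<bar> powr p \<le> e * (\<bar>x\<bar> powr p + \<bar>y\<bar> powr p)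
           + C * ((\<bar>x\<bar> powr p + \<bar>y\<bar> powr p) / 2 - \<bar>(x + y) / 2\<bar> powr p)"
proof -
  define D where "D x y = (\<bar>x\<bar> powr p + \<bar>y\<bar> powr p) / 2 - \<bar>(x + y) / 2\<bar> powr p" for x y :: real
  define K where "K = {z :: real \<times> real. \<bar>fst z\<bar> powr p + \<bar>snd z\<bar> powr p = 1 \<and>
    \<bar>fst z - snd z\<bar> powr p \<ge> e}"
  have D_nonneg: "D x y \<ge> 0" for x y
    using abs_powr_midpoint[OF p, of x y] by (simp add: D_def)
  have le1: "\<bar>s\<bar> \<le> 1" if "\<bar>s\<bar> powr p \<le> 1" for s :: real
  proof (rule ccontr)
    assume "\<not> \<bar>s\<bar> \<le> 1"
    then have "1 powr p < \<bar>s\<bar> powr p" using p by (intro powr_less_mono2) auto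
    then show False using that by simp
  qed
  have "closed K" unfolding K_def
    using p by (intro closed_Collect_conj closed_Collect_eq closed_Collect_le continuous_intros) auto
  moreover have "K \<subseteq> {-1..1} \<times> {-1..1}"
  proof
    fix z assume "z \<in> K"
    then have "\<bar>fst z\<bar> powr p \<le> 1" "\<bar>snd z\<bar> powr p \<le> 1"
      unfolding K_def using powr_ge_zero[of "\<bar>fst z\<bar>" p] powr_ge_zero[of "\<bar>snd z\<bar>" p]
      by (smt (verit) mem_Collect_eq)+
    then have "\<bar>fst z\<bar> \<le> 1" "\<bar>snd z\<bar> \<le> 1" by (auto intro: le1)
    then show "z \<in> {-1..1} \<times> {-1..1}" by (cases z) auto
  qed
  moreover have "compact ({-1..1::real} \<times> {-1..1::real})" by (intro compact_Times) auto
  ultimately have "compact K" by (metis compact_Int_closed inf.absorb_iff2)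
  have "\<exists>m>0. \<forall>z\<in>K. m \<le> D (fst z) (snd z)"
  proof (cases "K = {}")
    case False
    have "continuous_on K (\<lambda>z. D (fst z) (snd z))"
      unfolding D_def using p by (intro continuous_intros) auto
    from continuous_attains_inf[OF \<open>compact K\<close> False this]
    obtain z where z: "z \<in> K" "\<forall>z'\<in>K. D (fst z) (snd z) \<le> D (fst z') (snd z')" by auto
    have "fst z \<noteq> snd z" using z(1) assms by (auto simp: K_def)
    then have "D (fst z) (snd z) > 0"
      using abs_powr_midpoint_strict[OF p] by (simp add: D_def)
    then show ?thesis using z by blast
  qed (auto intro: exI[of _ 1])
  then obtain m where m: "m > 0" "\<And>z. z \<in> K \<Longrightarrow> m \<le> D (fst z) (snd z)" by auto
  \<comment> \<open>On \<open>K\<close> the left side is at most 2^p and the gap \<open>D\<close> at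
    least \<open>m\<close>, so \<open>C * D\<close> absorbs it; off \<open>K\<close> the summand e
    is enough.\<close>
  define C where "C = 2 powr p / m"
  have C: "C \<ge> 0" using m by (simp add: C_def)
  have unit: "\<bar>x - y\<bar> powr p \<le> e + C * D x y" if "\<bar>x\<bar> powr p + \<bar>y\<bar> powr p = 1" for x y
  proof (cases "\<bar>x - y\<bar> powr p \<ge> e")
    case True
    then have "m \<le> D x y" using m(2)[of "(x, y)"] that by (simp add: K_def)
    then have "2 powr p \<le> C * D x y" using m(1) by (simp add: C_def field_simps)
    then show ?thesis using abs_diff_powr_le[of p x y] p that assms(2) by simp
  next
    case False
    then show ?thesis using mult_nonneg_nonneg[OF C D_nonneg, of x y] by linarith
  qed
  have "\<bar>x - y\<bar> powr p \<le> e * (\<bar>x\<bar> powr p + \<bar>y\<bar> powr p) + C * D x y" for x y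
  proof (cases "x = 0 \<and> y = 0")
    case False
    define r where "r = \<bar>x\<bar> powr p + \<bar>y\<bar> powr p"
    define s where "s = r powr (1 / p)"
    have "r > 0" unfolding r_def using False
      by (metis add_nonneg_pos add_pos_nonneg powr_ge_zero powr_gt_zero abs_eq_0)
    then have s: "s > 0" "s powr p = r" using p by (auto simp: s_def powr_powr)
    have sc: "\<bar>z / s\<bar> powr p = \<bar>z\<bar> powr p / r" for z
      using s by (simp add: powr_divide)
    have "\<bar>x / s\<bar> powr p + \<bar>y / s\<bar> powr p = 1"
      using \<open>r > 0\<close> by (simp only: sc) (simp add: r_def add_divide_distrib[symmetric])
    from unit[OF this]
    have "\<bar>(x - y) / s\<bar> powr p \<le> e + C * D (x / s) (y / s)" by (simp add: diff_divide_distrib)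
    moreover have "D (x / s) (y / s) = D x y / r"
    proof -
      have "(x / s + y / s) / 2 = ((x + y) / 2) / s" by (simp add: add_divide_distrib)
      moreover have "(u / r + v / r) / 2 - z / r = ((u + v) / 2 - z) / r" for u v z
        by (simp add: add_divide_distrib diff_divide_distrib)
      ultimately show ?thesis unfolding D_def by (simp only: sc)
    qed
    ultimately have "\<bar>x - y\<bar> powr p / r \<le> e + C * D x y / r" by (simp only: sc) simp
    then have "\<bar>x - y\<bar> powr p \<le> e * r + C * D x y"
      using \<open>r > 0\<close> by (simp add: field_simps)
    then show ?thesis by (simp add: r_def)
  qed (simp add: D_def)
  then show ?thesis using C unfolding D_def by blast
qed

text \<open>Makes the mass continuous under convergence of differences: the fixed function receives
  an arbitrarily small weight, the difference a possibly large one. By homogeneity y = 1 may be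
  assumed; near 1 continuity suffices, and away from 1 everything is dominated by a multiple of the
  power of s - 1.\<close>

lemma abs_powr_diff_bound:
  fixes p :: real
  assumes p: "p > 0" and "e > 0"
  shows "\<exists>C\<ge>0. \<forall>x y. \<bar>\<bar>x\<bar> powr p - \<bar>y\<bar> powr p\<bar> \<le> e * \<bar>y\<bar> powr p + C * \<bar>x - y\<bar> powr p"
proof -
  have "isCont (\<lambda>s. \<bar>s\<bar> powr p) (1::real)"
    using p by (intro continuous_intros) auto
  then obtain d where d: "d > 0" "\<And>s. \<bar>s - 1\<bar> < d \<Longrightarrow> \<bar>\<bar>s\<bar> powr p - 1\<bar> < e"
    using assms(2) unfolding continuous_at_eps_delta by (metis abs_one dist_real_def powr_one_eq_one)
  \<comment> \<open>2^p comes from splitting s into (s - 1) + 1, the quotient by d^p turns the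
    leftover constant 2^p + 1 into a multiple of the power of s - 1, and C \<ge> 1 settles y =
    0.\<close>
  define C where "C = 2 powr p + 1 + (2 powr p + 1) / d powr p"
  have C: "C \<ge> 1" unfolding C_def by simp
  have norm: "\<bar>\<bar>s\<bar> powr p - 1\<bar> \<le> e + C * \<bar>s - 1\<bar> powr p" for s
  proof (cases "\<bar>s - 1\<bar> < d")
    case True
    moreover have "C * \<bar>s - 1\<bar> powr p \<ge> 0" using C by simp
    ultimately show ?thesis using d(2)[OF True] by linarith
  next
    case False
    have "d powr p \<le> \<bar>s - 1\<bar> powr p" using False d p by (intro powr_mono2) auto
    then have *: "1 \<le> \<bar>s - 1\<bar> powr p / d powr p" using d(1) by simp
    have "\<bar>\<bar>s\<bar> powr p - 1\<bar> \<le> \<bar>(s - 1) + 1\<bar> powr p + 1"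
      using powr_ge_zero[of "\<bar>s\<bar>" p] by (simp add: abs_le_iff)
    also have "\<dots> \<le> 2 powr p * (\<bar>s - 1\<bar> powr p + 1) + 1"
      using abs_add_powr_le[of p "s - 1" 1] p by simp
    also have "\<dots> = 2 powr p * \<bar>s - 1\<bar> powr p + (2 powr p + 1) * 1" by (simp add: algebra_simps)
    also have "\<dots> \<le> 2 powr p * \<bar>s - 1\<bar> powr p + (2 powr p + 1) * (\<bar>s - 1\<bar> powr p / d powr p)"
      by (intro add_mono mult_left_mono *) auto
    also have "\<dots> \<le> C * \<bar>s - 1\<bar> powr p"
      by (simp add: C_def algebra_simps add_divide_distrib)
    finally show ?thesis using assms(2) by linarith
  qed
  have "\<bar>\<bar>x\<bar> powr p - \<bar>y\<bar> powr p\<bar> \<le> e * \<bar>y\<bar> powr p + C * \<bar>x - y\<bar> powr p" for x y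
  proof (cases "y = 0")
    case True
    have "1 * \<bar>x\<bar> powr p \<le> C * \<bar>x\<bar> powr p" using C by (intro mult_right_mono) auto
    then show ?thesis using True p by simp
  next
    case False
    define q where "q = \<bar>y\<bar> powr p"
    have q: "q > 0" using False by (simp add: q_def)
    have 1: "\<bar>x / y\<bar> powr p = \<bar>x\<bar> powr p / q"
      unfolding q_def abs_divide by (simp add: powr_divide)
    have "\<bar>x / y - 1\<bar> = \<bar>x - y\<bar> / \<bar>y\<bar>" using False by (simp add: abs_divide[symmetric] diff_divide_distrib)
    then have 2: "\<bar>x / y - 1\<bar> powr p = \<bar>x - y\<bar> powr p / q"
      unfolding q_def by (simp add: powr_divide)
    have "\<bar>\<bar>x\<bar> powr p / q - 1\<bar> \<le> e + C * (\<bar>x - y\<bar> powr p / q)"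
      using norm[of "x / y"] unfolding 1 2 .
    then have "q * \<bar>\<bar>x\<bar> powr p / q - 1\<bar> \<le> q * (e + C * (\<bar>x - y\<bar> powr p / q))"
      using q by (intro mult_left_mono) auto
    moreover have "q * \<bar>\<bar>x\<bar> powr p / q - 1\<bar> = \<bar>\<bar>x\<bar> powr p - q\<bar>"
      using q by (simp add: abs_if field_simps)
    ultimately show ?thesis using q by (simp add: q_def[symmetric] algebra_simps)
  qed
  then show ?thesis using C by (intro exI[of _ C]) auto
qed

text \<open>Every z in [0, x] satisfies z^q \<le> z * x^(q-1); this is added up for z = x - y and z
  = y.\<close>

lemma powr_superadditive:
  fixes x y q :: real
  assumes "q \<ge> 1" "0 \<le> y" "y \<le> x"
  shows "(x - y) powr q \<le> x powr q - y powr q"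
proof (cases "x = 0")
  case False
  then have "x > 0" using assms by simp
  have *: "z powr q \<le> z * x powr (q - 1)" if "0 \<le> z" "z \<le> x" for z
  proof (cases "z = 0")
    case False
    have "z powr q = z * z powr (q - 1)" using False that powr_add[of z 1 "q - 1"] by simp
    also have "\<dots> \<le> z * x powr (q - 1)" using that assms by (intro mult_left_mono powr_mono2) auto
    finally show ?thesis .
  qed simp
  have "(x - y) powr q + y powr q \<le> (x - y) * x powr (q - 1) + y * x powr (q - 1)"
    using assms by (intro add_mono *) auto
  also have "\<dots> = x * x powr (q - 1)" by (simp add: algebra_simps)
  also have "\<dots> = x powr q" using \<open>x > 0\<close> powr_add[of x 1 "q - 1"] by simp
  finally show ?thesis by simp
qed (use assms in auto)

section \<open>Functions with integrable \<open>p\<close>-th power\<close>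

definition Lp_fun :: "real \<Rightarrow> 'a measure \<Rightarrow> ('a \<Rightarrow> real) \<Rightarrow> bool" where
  "Lp_fun p M w \<longleftrightarrow> w \<in> borel_measurable M \<and> integrable M (\<lambda>x. \<bar>w x\<bar> powr p)"

text \<open>The p-th power of the norm. This is the quantity that enters the energy, and a triangle
  inequality with the factor 2^p (\<open>Lp_mass_triangle\<close>) is enough for every limit
  argument below.\<close>

definition Lp_mass :: "real \<Rightarrow> 'a measure \<Rightarrow> ('a \<Rightarrow> real) \<Rightarrow> real" where
  "Lp_mass p M w = (\<integral>x. \<bar>w x\<bar> powr p \<partial>M)"

lemma Lp_fun_measurable [measurable_dest]: "Lp_fun p M w \<Longrightarrow> w \<in> borel_measurable M"
  by (simp add: Lp_fun_def)

lemma Lp_fun_integrable: "Lp_fun p M w \<Longrightarrow> integrable M (\<lambda>x. \<bar>w x\<bar> powr p)"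
  by (simp add: Lp_fun_def)

lemma Lp_mass_nonneg [simp]: "Lp_mass p M w \<ge> 0"
  unfolding Lp_mass_def by (intro integral_nonneg_AE) auto

lemma Lp_fun_add:
  assumes "p \<ge> 0" "Lp_fun p M v" "Lp_fun p M w"
  shows "Lp_fun p M (\<lambda>x. v x + w x)"
proof -
  note [measurable] = Lp_fun_measurable[OF assms(2)] Lp_fun_measurable[OF assms(3)]
  have "integrable M (\<lambda>x. 2 powr p * (\<bar>v x\<bar> powr p + \<bar>w x\<bar> powr p))"
    using assms by (auto simp: Lp_fun_def)
  then have "integrable M (\<lambda>x. \<bar>v x + w x\<bar> powr p)"
    by (rule Bochner_Integration.integrable_bound) (auto intro!: order_trans[OF abs_add_powr_le] assms)
  then show ?thesis by (simp add: Lp_fun_def)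
qed

lemma Lp_fun_scale:
  assumes "Lp_fun p M w"
  shows "Lp_fun p M (\<lambda>x. c * w x)"
  using assms by (auto simp: Lp_fun_def abs_mult powr_mult)

lemma Lp_mass_scale: "Lp_mass p M (\<lambda>x. c * w x) = \<bar>c\<bar> powr p * Lp_mass p M w"
  by (simp add: Lp_mass_def abs_mult powr_mult)

lemma Lp_fun_diff:
  assumes "p \<ge> 0" "Lp_fun p M v" "Lp_fun p M w"
  shows "Lp_fun p M (\<lambda>x. v x - w x)"
  using Lp_fun_add[OF assms(1,2) Lp_fun_scale[OF assms(3), of "-1"]] by simp

lemma Lp_mass_diff_commute: "Lp_mass p M (\<lambda>x. v x - w x) = Lp_mass p M (\<lambda>x. w x - v x)"
  by (simp add: Lp_mass_def abs_minus_commute)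

lemma Lp_mass_triangle:
  assumes "p \<ge> 0" "Lp_fun p M u" "Lp_fun p M v" "Lp_fun p M w"
  shows "Lp_mass p M (\<lambda>x. u x - w x)
    \<le> 2 powr p * (Lp_mass p M (\<lambda>x. u x - v x) + Lp_mass p M (\<lambda>x. v x - w x))"
proof -
  note I = Lp_fun_integrable[OF Lp_fun_diff[OF assms(1,2,3)]]
    Lp_fun_integrable[OF Lp_fun_diff[OF assms(1,3,4)]] Lp_fun_integrable[OF Lp_fun_diff[OF assms(1,2,4)]]
  have "Lp_mass p M (\<lambda>x. u x - w x)
    \<le> (\<integral>x. 2 powr p * (\<bar>u x - v x\<bar> powr p + \<bar>v x - w x\<bar> powr p) \<partial>M)"
    unfolding Lp_mass_def
  proof (rule integral_mono)
    show "\<bar>u x - w x\<bar> powr p \<le> 2 powr p * (\<bar>u x - v x\<bar> powr p + \<bar>v x - w x\<bar> powr p)" for x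
      using abs_add_powr_le[OF assms(1), of "u x - v x" "v x - w x"] by simp
  qed (use assms in \<open>auto simp: I\<close>)
  also have "\<dots> = 2 powr p * (Lp_mass p M (\<lambda>x. u x - v x) + Lp_mass p M (\<lambda>x. v x - w x))"
    unfolding Lp_mass_def using I assms by simp
  finally show ?thesis .
qed

lemma Lp_mass_add_le:
  assumes "p \<ge> 0" "Lp_fun p M v" "Lp_fun p M w"
  shows "Lp_mass p M (\<lambda>x. v x + w x) \<le> 2 powr p * (Lp_mass p M v + Lp_mass p M w)"
  using Lp_mass_triangle[OF assms(1,2), of "\<lambda>_. 0" "\<lambda>x. - w x"] Lp_fun_scale[OF assms(3), of "-1"]
    Lp_fun_scale[OF assms(3), of "0"]
  by (simp add: Lp_mass_def)

lemma Lp_mass_tendsto: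
  assumes p: "p > 0" and w: "Lp_fun p M w" and wn: "\<And>n. Lp_fun p M (wn n)"
    and lim: "(\<lambda>n. Lp_mass p M (\<lambda>x. wn n x - w x)) \<longlonglongrightarrow> 0"
  shows "(\<lambda>n. Lp_mass p M (wn n)) \<longlonglongrightarrow> Lp_mass p M w"
proof (rule LIMSEQ_I)
  fix r :: real assume "r > 0"
  \<comment> \<open>The added 1 keeps the quotient defined for mass 0; the choice gives
    \<open>e * Lp_mass p M w \<le> r / 2\<close>.\<close>
  define e where "e = r / (2 * (Lp_mass p M w + 1))"
  have "e > 0" using \<open>r > 0\<close> by (simp add: e_def add_nonneg_pos)
  from abs_powr_diff_bound[OF p this] obtain C where C: "C \<ge> 0"
    "\<And>x y. \<bar>\<bar>x\<bar> powr p - \<bar>y\<bar> powr p\<bar> \<le> e * \<bar>y\<bar> powr p + C * \<bar>x - y\<bar> powr p" by auto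
  have eN: "e * Lp_mass p M w \<le> r / 2"
  proof -
    have "Lp_mass p M w / (Lp_mass p M w + 1) \<le> 1" by (simp add: divide_le_eq_1 add_nonneg_pos)
    then have "(r / 2) * (Lp_mass p M w / (Lp_mass p M w + 1)) \<le> (r / 2) * 1"
      using \<open>r > 0\<close> by (intro mult_left_mono) auto
    then show ?thesis by (simp add: e_def)
  qed
  have "r / (2 * (C + 1)) > 0" using \<open>r > 0\<close> C by simp
  from LIMSEQ_D[OF lim this] obtain n0 where
    n0: "\<And>n. n \<ge> n0 \<Longrightarrow> Lp_mass p M (\<lambda>x. wn n x - w x) < r / (2 * (C + 1))" by auto
  have "norm (Lp_mass p M (wn n) - Lp_mass p M w) < r" if "n \<ge> n0" for n
  proof -
    have D: "Lp_fun p M (\<lambda>x. wn n x - w x)" using p by (intro Lp_fun_diff wn w) auto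
    have "\<bar>Lp_mass p M (wn n) - Lp_mass p M w\<bar> = \<bar>\<integral>x. \<bar>wn n x\<bar> powr p - \<bar>w x\<bar> powr p \<partial>M\<bar>"
      unfolding Lp_mass_def using w wn[of n] by (simp add: Lp_fun_def)
    also have "\<dots> \<le> (\<integral>x. \<bar>\<bar>wn n x\<bar> powr p - \<bar>w x\<bar> powr p\<bar> \<partial>M)"
      by (rule integral_abs_bound)
    also have "\<dots> \<le> (\<integral>x. e * \<bar>w x\<bar> powr p + C * \<bar>wn n x - w x\<bar> powr p \<partial>M)"
      using w wn[of n] D by (intro integral_mono C) (auto simp: Lp_fun_def)
    also have "\<dots> = e * Lp_mass p M w + C * Lp_mass p M (\<lambda>x. wn n x - w x)"
      unfolding Lp_mass_def using w wn[of n] D by (simp add: Lp_fun_def)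
    also have "C * Lp_mass p M (\<lambda>x. wn n x - w x) \<le> (C + 1) * Lp_mass p M (\<lambda>x. wn n x - w x)"
      by (intro mult_right_mono) auto
    also have "(C + 1) * Lp_mass p M (\<lambda>x. wn n x - w x) < (C + 1) * (r / (2 * (C + 1)))"
      using n0[OF that] C by (intro mult_strict_left_mono) auto
    also have "(C + 1) * (r / (2 * (C + 1))) = r / 2" using C by (simp add: field_simps)
    finally show ?thesis using eN by simp
  qed
  then show "\<exists>n0. \<forall>n\<ge>n0. norm (Lp_mass p M (wn n) - Lp_mass p M w) < r" by blast
qed

lemma Lp_mass_eq_0_AE:
  assumes "Lp_fun p M w" "Lp_mass p M w = 0"
  shows "AE x in M. w x = 0"
proof -
  have "AE x in M. \<bar>w x\<bar> powr p = 0"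
    using assms by (subst integral_nonneg_eq_0_iff_AE[symmetric]) (auto simp: Lp_fun_def Lp_mass_def)
  then show ?thesis by eventually_elim auto
qed

text \<open>Young's inequality for the two functions scaled to norm 1. If one of the norms vanishes,
  scaling is impossible, but then the product is 0 almost everywhere.\<close>

lemma
  assumes pq: "p > 1" "q > 1" "1 / p + 1 / q = 1"
    and g: "Lp_fun q M g" and w: "Lp_fun p M w"
  shows Hoelder_integrable: "integrable M (\<lambda>x. g x * w x)"
    and Hoelder_inequality:
      "\<bar>\<integral>x. g x * w x \<partial>M\<bar> \<le> Lp_mass q M g powr (1 / q) * Lp_mass p M w powr (1 / p)"
proof -
  note [measurable] = Lp_fun_measurable[OF g] Lp_fun_measurable[OF w]
  have ig: "integrable M (\<lambda>x. \<bar>g x\<bar> powr q)" and iw: "integrable M (\<lambda>x. \<bar>w x\<bar> powr p)"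
    using g w by (auto simp: Lp_fun_def)
  have young: "\<bar>g x * w x\<bar> \<le> \<bar>w x\<bar> powr p / p + \<bar>g x\<bar> powr q / q" for x
    using Youngs_inequality[OF pq, of "\<bar>w x\<bar>" "\<bar>g x\<bar>"] by (simp add: abs_mult mult.commute)
  have "integrable M (\<lambda>x. \<bar>w x\<bar> powr p / p + \<bar>g x\<bar> powr q / q)"
    using ig iw by auto
  then show int: "integrable M (\<lambda>x. g x * w x)"
    by (rule Bochner_Integration.integrable_bound) (use young in \<open>auto intro!: always_eventually intro: order_trans[OF _ abs_ge_self]\<close>)
  define A where "A = Lp_mass q M g"
  define B where "B = Lp_mass p M w"
  show "\<bar>\<integral>x. g x * w x \<partial>M\<bar> \<le> A powr (1 / q) * B powr (1 / p)"
  proof (cases "A = 0 \<or> B = 0")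
    case True
    then have "(AE x in M. g x = 0) \<or> (AE x in M. w x = 0)"
      using Lp_mass_eq_0_AE[OF g] Lp_mass_eq_0_AE[OF w] by (auto simp: A_def B_def)
    then have "AE x in M. g x * w x = 0" by auto
    then have "(\<integral>x. g x * w x \<partial>M) = (\<integral>x. 0 \<partial>M)" by (intro integral_cong_AE) auto
    then show ?thesis by simp
  next
    case False
    then have pos: "A > 0" "B > 0" by (auto simp: A_def B_def less_le)
    define \<alpha> where "\<alpha> = A powr (1 / q)"
    define \<beta> where "\<beta> = B powr (1 / p)"
    have \<alpha>\<beta>: "\<alpha> > 0" "\<beta> > 0" "\<alpha> powr q = A" "\<beta> powr p = B"
      using pos pq by (auto simp: \<alpha>_def \<beta>_def powr_powr)
    have young': "\<bar>g x * w x\<bar> / (\<alpha> * \<beta>) \<le> \<bar>w x\<bar> powr p / (p * B) + \<bar>g x\<bar> powr q / (q * A)" for x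
      using Youngs_inequality[OF pq, of "\<bar>w x\<bar> / \<beta>" "\<bar>g x\<bar> / \<alpha>"] \<alpha>\<beta>
      by (simp add: abs_mult powr_divide mult_ac)
    have "\<bar>\<integral>x. g x * w x \<partial>M\<bar> / (\<alpha> * \<beta>) \<le> (\<integral>x. \<bar>g x * w x\<bar> \<partial>M) / (\<alpha> * \<beta>)"
      using \<alpha>\<beta> by (intro divide_right_mono integral_abs_bound) auto
    also have "\<dots> = (\<integral>x. \<bar>g x * w x\<bar> / (\<alpha> * \<beta>) \<partial>M)" by simp
    also have "\<dots> \<le> (\<integral>x. \<bar>w x\<bar> powr p / (p * B) + \<bar>g x\<bar> powr q / (q * A) \<partial>M)"
      using int ig iw by (intro integral_mono young') auto
    also have "\<dots> = B / (p * B) + A / (q * A)"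
      using ig iw by (simp add: A_def B_def Lp_mass_def)
    also have "\<dots> = 1" using pos pq by simp
    finally have "\<bar>\<integral>x. g x * w x \<partial>M\<bar> \<le> \<alpha> * \<beta>" using \<alpha>\<beta> by (simp add: field_simps)
    then show ?thesis by (simp add: \<alpha>_def \<beta>_def)
  qed
qed

text \<open>The Riesz-Fischer argument with masses in place of norms. Along a subsequence with
  consecutive masses below 4^(-k), the increments weighted by 2^k still have a finite sum almost
  everywhere, so they decay geometrically and the subsequence converges pointwise. Fatou's lemma
  then carries the Cauchy estimate over to the limit.\<close>

lemma Lp_complete:
  assumes p: "p > 0" and wn: "\<And>n. Lp_fun p M (w n)"
    and cauchy: "\<And>e. e > 0 \<Longrightarrow> \<exists>K. \<forall>m\<ge>K. \<forall>n\<ge>K. Lp_mass p M (\<lambda>x. w m x - w n x) < e"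
  shows "\<exists>v. Lp_fun p M v \<and> (\<lambda>n. Lp_mass p M (\<lambda>x. w n x - v x)) \<longlonglongrightarrow> 0"
proof -
  note [measurable] = Lp_fun_measurable[OF wn]
  have diff: "Lp_fun p M (\<lambda>x. w m x - w n x)" for m n
    using p by (intro Lp_fun_diff wn) auto
  have nn: "(\<integral>\<^sup>+x. ennreal (\<bar>w m x - w n x\<bar> powr p) \<partial>M) = ennreal (Lp_mass p M (\<lambda>x. w m x - w n x))" for m n
    unfolding Lp_mass_def by (intro nn_integral_eq_integral Lp_fun_integrable[OF diff]) auto
  have "\<exists>r. \<forall>k. \<forall>m\<ge>r k. \<forall>n\<ge>r k. Lp_mass p M (\<lambda>x. w m x - w n x) < (1/4) ^ k"
    by (intro choice allI cauchy) simp
  then obtain r0 where r0: "\<And>k m n. m \<ge> r0 k \<Longrightarrow> n \<ge> r0 k \<Longrightarrow> Lp_mass p M (\<lambda>x. w m x - w n x) < (1/4) ^ k"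
    by metis
  \<comment> \<open>Summing the thresholds puts both \<open>r k\<close> and \<open>r (Suc k)\<close>
    above \<open>r0 k\<close>; the summand k forces \<open>r k \<ge> k\<close>.\<close>
  define r where "r k = k + (\<Sum>i\<le>k. r0 i)" for k :: nat
  have r_ge: "r k \<ge> r0 k" "r (Suc k) \<ge> r0 k" "r k \<ge> k" for k
    using member_le_sum[of k "{..k}" r0] by (auto simp: r_def)
  have small: "Lp_mass p M (\<lambda>x. w (r (Suc k)) x - w (r k) x) < (1/4) ^ k" for k
    by (intro r0 r_ge)
  define d where "d k x = \<bar>w (r (Suc k)) x - w (r k) x\<bar> powr p" for k x
  have [measurable]: "d k \<in> borel_measurable M" for k unfolding d_def by measurable
  have "(\<integral>\<^sup>+x. (\<Sum>k. ennreal (2 ^ k * d k x)) \<partial>M) = (\<Sum>k. \<integral>\<^sup>+x. ennreal (2 ^ k * d k x) \<partial>M)"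
    by (intro nn_integral_suminf) auto
  also have "\<dots> = (\<Sum>k. ennreal (2 ^ k * Lp_mass p M (\<lambda>x. w (r (Suc k)) x - w (r k) x)))"
    by (simp add: ennreal_mult nn_integral_cmult d_def nn)
  also have "\<dots> \<le> (\<Sum>k. ennreal ((1/2) ^ k))"
  proof (intro suminf_le ennreal_leI)
    fix k
    have "2 ^ k * Lp_mass p M (\<lambda>x. w (r (Suc k)) x - w (r k) x) \<le> 2 ^ k * (1/4) ^ k"
      using small[of k] by (intro mult_left_mono) auto
    also have "\<dots> = (1/2 :: real) ^ k" by (simp add: power_mult_distrib[symmetric])
    finally show "2 ^ k * Lp_mass p M (\<lambda>x. w (r (Suc k)) x - w (r k) x) \<le> (1/2 :: real) ^ k" .
  qed auto
  also have "\<dots> < \<infinity>"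
    by (subst suminf_ennreal2) (auto intro: summable_geometric)
  finally have "AE x in M. (\<Sum>k. ennreal (2 ^ k * d k x)) \<noteq> \<infinity>"
    by (intro nn_integral_PInf_AE) (auto simp: less_top)
  then have conv: "AE x in M. convergent (\<lambda>k. w (r k) x)"
  proof eventually_elim
    case (elim x)
    then have "(\<Sum>k. ennreal (2 ^ k * d k x)) \<noteq> top" by simp
    then have "summable (\<lambda>k. 2 ^ k * d k x)"
      by (intro summable_suminf_not_top) (auto simp: d_def)
    then have "(\<lambda>k. 2 ^ k * d k x) \<longlonglongrightarrow> 0" by (rule summable_LIMSEQ_zero)
    then have "Bseq (\<lambda>k. 2 ^ k * d k x)" by (meson convergentI convergent_imp_Bseq)
    then obtain S where S: "S > 0" "\<And>k. \<bar>2 ^ k * d k x\<bar> \<le> S" unfolding Bseq_def by auto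
    \<comment> \<open>The p-th root of the ratio 1/2, since the bound
      \<open>d k x \<le> S * (1/2) ^ k\<close> is on p-th powers of increments.\<close>
    define c where "c = (1/2 :: real) powr (1 / p)"
    have "(1/2 :: real) powr (1 / p) < 1 powr (1 / p)" using p by (intro powr_less_mono2) auto
    then have c: "0 < c" "c < 1" by (simp_all add: c_def)
    have bound: "\<bar>w (r (Suc k)) x - w (r k) x\<bar> \<le> S powr (1 / p) * c ^ k" for k
    proof -
      have "d k x \<le> S * (1/2) ^ k"
      proof -
        have "2 ^ k * d k x \<le> S" using S(2)[of k] by linarith
        then have "(1/2) ^ k * (2 ^ k * d k x) \<le> (1/2) ^ k * S" by (intro mult_left_mono) auto
        then show ?thesis by (simp add: power_one_over mult.commute)
      qed
      then have "d k x powr (1 / p) \<le> (S * (1/2) ^ k) powr (1 / p)"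
        using p by (intro powr_mono2) (auto simp: d_def)
      moreover have "d k x powr (1 / p) = \<bar>w (r (Suc k)) x - w (r k) x\<bar>"
        using p by (simp add: d_def powr_powr)
      moreover have "((1/2 :: real) ^ k) powr (1 / p) = c ^ k"
      proof -
        have "((1/2 :: real) ^ k) powr (1 / p) = ((1/2) powr real k) powr (1 / p)"
          by (subst powr_realpow) auto
        also have "\<dots> = ((1/2) powr (1 / p)) powr real k" by (simp only: powr_powr mult.commute)
        also have "\<dots> = c ^ k" unfolding c_def by (subst powr_realpow) auto
        finally show ?thesis .
      qed
      ultimately show ?thesis using S(1) by (simp add: powr_mult)
    qed
    have "summable (\<lambda>k. w (r (Suc k)) x - w (r k) x)"
    proof (rule summable_comparison_test'[of "\<lambda>k. S powr (1 / p) * c ^ k" 0])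
      show "summable (\<lambda>k. S powr (1 / p) * c ^ k)"
        using c by (intro summable_mult summable_geometric) simp
    qed (simp add: bound)
    then have "convergent (\<lambda>n. \<Sum>k<n. w (r (Suc k)) x - w (r k) x)"
      by (simp add: summable_iff_convergent)
    then have "convergent (\<lambda>n. w (r n) x - w (r 0) x)" by (simp only: sum_lessThan_telescope[of "\<lambda>n. w (r n) x"])
    then show ?case using convergent_diff_const_right_iff[of "\<lambda>n. w (r n) x" "w (r 0) x"] by simp
  qed
  define v where "v x = lim (\<lambda>k. w (r k) x)" for x
  have [measurable]: "v \<in> borel_measurable M" unfolding v_def by measurable
  have limv: "AE x in M. (\<lambda>k. w (r k) x) \<longlonglongrightarrow> v x"
    using conv by eventually_elim (simp add: v_def convergent_LIMSEQ_iff)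
  have fatou: "(\<integral>\<^sup>+x. ennreal (\<bar>w n x - v x\<bar> powr p) \<partial>M) \<le> ennreal e"
    if e: "e > 0" and K: "\<And>m. m \<ge> K \<Longrightarrow> Lp_mass p M (\<lambda>x. w n x - w m x) < e" for n e K
  proof -
    have "(\<integral>\<^sup>+x. ennreal (\<bar>w n x - v x\<bar> powr p) \<partial>M)
      = (\<integral>\<^sup>+x. liminf (\<lambda>k. ennreal (\<bar>w n x - w (r k) x\<bar> powr p)) \<partial>M)"
    proof (intro nn_integral_cong_AE)
      show "AE x in M. ennreal (\<bar>w n x - v x\<bar> powr p) = liminf (\<lambda>k. ennreal (\<bar>w n x - w (r k) x\<bar> powr p))"
        using limv
      proof eventually_elim
        case (elim x)
        then have "(\<lambda>k. ennreal (\<bar>w n x - w (r k) x\<bar> powr p)) \<longlonglongrightarrow> ennreal (\<bar>w n x - v x\<bar> powr p)"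
          using p by (intro tendsto_ennrealI tendsto_powr' tendsto_intros) auto
        then show ?case by (rule lim_imp_Liminf[OF sequentially_bot, symmetric])
      qed
    qed
    also have "\<dots> \<le> liminf (\<lambda>k. \<integral>\<^sup>+x. ennreal (\<bar>w n x - w (r k) x\<bar> powr p) \<partial>M)"
      by (intro nn_integral_liminf) measurable
    also have "\<dots> \<le> ennreal e"
    proof (rule order_trans[OF Liminf_le_Limsup])
      show "limsup (\<lambda>k. \<integral>\<^sup>+x. ennreal (\<bar>w n x - w (r k) x\<bar> powr p) \<partial>M) \<le> ennreal e"
      proof (rule Limsup_bounded)
        show "\<forall>\<^sub>F k in sequentially. (\<integral>\<^sup>+x. ennreal (\<bar>w n x - w (r k) x\<bar> powr p) \<partial>M) \<le> ennreal e"
          using eventually_ge_at_top[of K]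
        proof eventually_elim
          case (elim k)
          then have "Lp_mass p M (\<lambda>x. w n x - w (r k) x) < e" using K r_ge(3)[of k] by simp
          then show ?case by (simp add: nn ennreal_leI)
        qed
      qed
    qed simp
    finally show ?thesis .
  qed
  obtain K1 where K1: "\<And>m n. m \<ge> K1 \<Longrightarrow> n \<ge> K1 \<Longrightarrow> Lp_mass p M (\<lambda>x. w m x - w n x) < 1"
    using cauchy[of 1] by auto
  have "Lp_fun p M (\<lambda>x. w K1 x - v x)"
  proof -
    have "(\<integral>\<^sup>+x. ennreal (\<bar>w K1 x - v x\<bar> powr p) \<partial>M) \<le> ennreal 1"
      by (intro fatou[of _ K1] K1) auto
    then have "(\<integral>\<^sup>+x. ennreal (\<bar>w K1 x - v x\<bar> powr p) \<partial>M) < \<infinity>" by (auto intro: order.strict_trans1)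
    then show ?thesis unfolding Lp_fun_def by (auto intro!: integrableI_nonneg)
  qed
  from Lp_fun_diff[OF _ wn[of K1] this] p have v: "Lp_fun p M v" by simp
  moreover have "(\<lambda>n. Lp_mass p M (\<lambda>x. w n x - v x)) \<longlonglongrightarrow> 0"
  proof (rule LIMSEQ_I)
    fix e :: real assume "e > 0"
    then obtain K where K: "\<And>m n. m \<ge> K \<Longrightarrow> n \<ge> K \<Longrightarrow> Lp_mass p M (\<lambda>x. w m x - w n x) < e / 2"
      using cauchy[of "e / 2"] by auto
    have half: "Lp_mass p M (\<lambda>x. w n x - v x) \<le> e / 2" if "n \<ge> K" for n
    proof -
      have "integrable M (\<lambda>x. \<bar>w n x - v x\<bar> powr p)"
        using p by (intro Lp_fun_integrable[OF Lp_fun_diff[OF _ wn[of n] v]]) simp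
      then have "ennreal (Lp_mass p M (\<lambda>x. w n x - v x)) = (\<integral>\<^sup>+x. ennreal (\<bar>w n x - v x\<bar> powr p) \<partial>M)"
        unfolding Lp_mass_def by (intro nn_integral_eq_integral[symmetric]) auto
      also have "\<dots> \<le> ennreal (e / 2)"
        by (rule fatou[of _ K]) (use K that \<open>e > 0\<close> in simp_all)
      finally have "ennreal (Lp_mass p M (\<lambda>x. w n x - v x)) \<le> ennreal (e / 2)" .
      then show ?thesis using \<open>e > 0\<close> by (simp add: ennreal_le_iff)
    qed
    have "norm (Lp_mass p M (\<lambda>x. w n x - v x) - 0) < e" if "n \<ge> K" for n
      using half[OF that] \<open>e > 0\<close> by simp
    then show "\<exists>K. \<forall>n\<ge>K. norm (Lp_mass p M (\<lambda>x. w n x - v x) - 0) < e" by blast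
  qed
  ultimately show ?thesis by blast
qed

section \<open>Fractional integrals\<close>

text \<open>The Riemann-Liouville kernel extended by zero: integrals run over the whole line and the
  moving endpoint t becomes a parameter of the integrand. The singular point s = t is
  excluded.\<close>

definition powker :: "real \<Rightarrow> real \<Rightarrow> real \<Rightarrow> real \<Rightarrow> real" where
  "powker \<gamma> a t s = (if a \<le> s \<and> s < t then (t - s) powr \<gamma> else 0)"

lemma powker_measurable [measurable]:
  assumes [measurable]: "f \<in> borel_measurable M" "g \<in> borel_measurable M"
  shows "(\<lambda>x. powker \<gamma> a (f x) (g x)) \<in> borel_measurable M"
  unfolding powker_def by measurable

lemma powker_nonneg: "powker \<gamma> a t s \<ge> 0"
  by (simp add: powker_def)

lemma has_bochner_integral_nonneg_has_integral:
  fixes f :: "real \<Rightarrow> real"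
  assumes "(f has_integral I) A" "\<And>x. x \<in> A \<Longrightarrow> 0 \<le> f x"
    and [measurable]: "f \<in> borel_measurable borel" "A \<in> sets borel"
  shows "has_bochner_integral lborel (\<lambda>x. if x \<in> A then f x else 0) I"
proof -
  have m: "(\<lambda>x. if x \<in> A then f x else 0) \<in> borel_measurable borel" by measurable
  have I: "((\<lambda>x. if x \<in> A then f x else 0) has_integral I) UNIV"
    using assms(1) by (simp add: has_integral_restrict_UNIV)
  then have "I \<ge> 0" by (rule has_integral_nonneg) (use assms(2) in auto)
  then show ?thesis
    using nn_integral_has_integral_lborel[OF m _ I] m assms(2)
    by (intro has_bochner_integral_nn_integral) auto
qed

lemma has_bochner_integral_powr_Icc:
  fixes c \<gamma> :: real
  assumes "\<gamma> > -1" "c \<ge> 0"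
  shows "has_bochner_integral lborel (\<lambda>x. if x \<in> {0..c} then x powr \<gamma> else 0)
    (c powr (\<gamma> + 1) / (\<gamma> + 1))"
  by (rule has_bochner_integral_nonneg_has_integral[OF has_integral_powr_from_0[OF assms]]) auto

lemma has_bochner_integral_powker:
  assumes "\<gamma> > -1" "a \<le> t"
  shows "has_bochner_integral lborel (powker \<gamma> a t) ((t - a) powr (\<gamma> + 1) / (\<gamma> + 1))"
proof -
  have eq: "powker \<gamma> a t = (\<lambda>s. if t + (-1) * s \<in> {0..t - a} then (t + (-1) * s) powr \<gamma> else 0)"
    by (auto simp: powker_def fun_eq_iff)
  show ?thesis
    unfolding eq
    using lborel_has_bochner_integral_real_affine_iff[of "-1"
      "\<lambda>x. if x \<in> {0..t - a} then x powr \<gamma> else 0" "(t - a) powr (\<gamma> + 1) / (\<gamma> + 1)" t]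
      has_bochner_integral_powr_Icc[of \<gamma> "t - a"] assms by simp
qed

text \<open>The substitution u = (s - x) / (t - x) produces a Beta integral. As the exponents
  \<alpha> - 1 and -\<alpha> add up to -1, the powers of t - x cancel against the differential, and
  the value depends on neither x nor t.\<close>

lemma has_bochner_integral_powker_Beta:
  assumes "0 < \<alpha>" "\<alpha> < 1" "0 \<le> x" "x < t"
  shows "has_bochner_integral lborel (\<lambda>s. powker (\<alpha> - 1) 0 t s * powker (- \<alpha>) 0 s x)
    (Gamma \<alpha> * Gamma (1 - \<alpha>))"
proof -
  define f where "f u = (if u \<in> {0..1} then u powr ((1 - \<alpha>) - 1) * (1 - u) powr (\<alpha> - 1) else 0)" for u :: real
  have "has_bochner_integral lborel f (Beta (1 - \<alpha>) \<alpha>)"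
    unfolding f_def
    by (intro has_bochner_integral_nonneg_has_integral has_integral_Beta_real) (use assms in auto)
  then have "has_bochner_integral lborel (\<lambda>s. f (- x / (t - x) + (1 / (t - x)) * s))
      (Beta (1 - \<alpha>) \<alpha> /\<^sub>R \<bar>1 / (t - x)\<bar>)"
    using assms by (subst lborel_has_bochner_integral_real_affine_iff[symmetric]) auto
  then have "has_bochner_integral lborel (\<lambda>s. (1 / (t - x)) * f (- x / (t - x) + (1 / (t - x)) * s))
      ((1 / (t - x)) * (Beta (1 - \<alpha>) \<alpha> /\<^sub>R \<bar>1 / (t - x)\<bar>))"
    by (intro has_bochner_integral_mult_right) auto
  moreover have "(1 / (t - x)) * (Beta (1 - \<alpha>) \<alpha> /\<^sub>R \<bar>1 / (t - x)\<bar>) = Gamma \<alpha> * Gamma (1 - \<alpha>)"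
    using assms by (simp add: Beta_def)
  moreover have "(1 / (t - x)) * f (- x / (t - x) + (1 / (t - x)) * s)
      = powker (\<alpha> - 1) 0 t s * powker (- \<alpha>) 0 s x" for s
  proof -
    define L where "L = t - x"
    have L: "L > 0" using assms by (simp add: L_def)
    have u: "- x / L + (1 / L) * s = (s - x) / L" using L by (simp add: field_simps)
    show ?thesis
    proof (cases "x < s \<and> s < t")
      case True
      have "1 - (s - x) / L = (t - s) / L" using L by (simp add: L_def field_simps)
      moreover have "(s - x) / L \<in> {0..1}" using True L by (simp add: L_def field_simps)
      ultimately have "f ((s - x) / L) = ((s - x) / L) powr (- \<alpha>) * ((t - s) / L) powr (\<alpha> - 1)"
        by (simp add: f_def)
      also have "\<dots> = (s - x) powr (- \<alpha>) * (t - s) powr (\<alpha> - 1) / (L powr (- \<alpha>) * L powr (\<alpha> - 1))"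
        using True L by (simp add: powr_divide)
      also have "L powr (- \<alpha>) * L powr (\<alpha> - 1) = 1 / L"
      proof -
        have "L powr (- \<alpha>) * L powr (\<alpha> - 1) = L powr (- \<alpha> + (\<alpha> - 1))" by (rule powr_add[symmetric])
        then show ?thesis using L powr_minus_divide[of L 1] by simp
      qed
      finally show ?thesis using True assms L unfolding L_def[symmetric] u
        by (simp add: powker_def mult_ac)
    next
      case False
      then have "(s - x) / L \<le> 0 \<or> (s - x) / L \<ge> 1" using L by (auto simp: field_simps L_def)
      moreover have "f 0 = 0" "f 1 = 0" by (simp_all add: f_def)
      ultimately have "f ((s - x) / L) = 0"
        unfolding f_def by (cases "(s - x) / L = 0 \<or> (s - x) / L = 1") (auto simp del: divide_eq_0_iff)
      then show ?thesis using False unfolding L_def[symmetric] u by (auto simp: powker_def)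
    qed
  qed
  ultimately show ?thesis by simp
qed

text \<open>The left Riemann-Liouville integral of order \<alpha>; for \<alpha> = 1 it is the
  primitive vanishing at 0.\<close>

definition Ifrac :: "real \<Rightarrow> (real \<Rightarrow> real) \<Rightarrow> real \<Rightarrow> real" where
  "Ifrac \<alpha> w t = (1 / Gamma \<alpha>) * (\<integral>s. powker (\<alpha> - 1) 0 t s * w s \<partial>lborel)"

abbreviation MT :: "real \<Rightarrow> real measure" where
  "MT T \<equiv> restrict_space lborel {0..T}"

lemma set_integral_eq_MT: "(LINT t:{0..T}|lborel. (f t :: real)) = (\<integral>t. f t \<partial>MT T)"
  by (simp add: integral_restrict_space set_lebesgue_integral_def)

lemma set_integrable_eq_MT: "set_integrable lborel {0..T} (f :: real \<Rightarrow> real) \<longleftrightarrow> integrable (MT T) f"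
  by (simp add: integrable_restrict_space set_integrable_def)

lemma AE_MT_iff: "(AE t in MT T. P t) \<longleftrightarrow> (AE t in lborel. t \<in> {0..T} \<longrightarrow> P t)"
  by (rule AE_restrict_space_iff) simp

lemma space_MT [simp]: "space (MT T) = {0..T}"
  by (simp add: space_restrict_space)

lemma borel_measurable_MT: "f \<in> borel_measurable borel \<Longrightarrow> f \<in> borel_measurable (MT T)"
  by (auto intro: measurable_restrict_space1)

lemma continuous_on_borel_measurable_MT:
  "continuous_on {0..T} (f :: real \<Rightarrow> real) \<Longrightarrow> f \<in> borel_measurable (MT T)"
  using borel_measurable_continuous_on_restrict[of "{0..T}" f]
  by (simp add: measurable_def sets_restrict_space space_restrict_space)

lemma finite_measure_MT: "finite_measure (MT T)"
  by (intro finite_measureI) (auto simp: emeasure_restrict_space emeasure_lborel_Icc_eq)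

lemma integral_powker_MT:
  assumes "t \<le> T"
  shows "(\<integral>s. powker \<gamma> 0 t s * w s \<partial>lborel) = (\<integral>s. powker \<gamma> 0 t s * w s \<partial>MT T)"
proof -
  have "indicator {0..T} s *\<^sub>R (powker \<gamma> 0 t s * w s) = powker \<gamma> 0 t s * w s" for s
    using assms by (auto simp: powker_def indicator_def)
  moreover have "(\<integral>s. powker \<gamma> 0 t s * w s \<partial>MT T)
      = (\<integral>s. indicator {0..T} s *\<^sub>R (powker \<gamma> 0 t s * w s) \<partial>lborel)"
    by (rule integral_restrict_space) simp
  ultimately show ?thesis by (simp only:)
qed

lemma abs_powker_powr:
  "\<bar>powker \<gamma> a t s\<bar> powr q = powker (\<gamma> * q) a t s"
  by (simp add: powker_def powr_powr)

section \<open>Hoelder continuity of fractional integrals\<close>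

locale frac_exponents =
  fixes T p \<alpha> :: real
  assumes T: "T > 0" and p: "p > 1" and \<alpha>: "1 / p < \<alpha>" "\<alpha> \<le> 1"
begin

text \<open>The conjugate exponent. \<beta> is the power of the length that remains after
  integrating the q-th power of the kernel, \<sigma> the resulting Hoelder exponent and
  \<open>KH\<close> the Hoelder constant. The condition \<alpha> > 1/p reads \<sigma> > 0,
  equivalently \<beta> > 0.\<close>

definition "q = p / (p - 1)"
definition "\<beta> = (\<alpha> - 1) * q + 1"
definition "\<sigma> = \<alpha> - 1 / p"
definition "KH = (1 / Gamma \<alpha>) * (2 / \<beta>) powr (1 / q)"

lemma q: "q > 1" "1 / p + 1 / q = 1"
  using p by (auto simp: q_def field_simps)

lemma \<alpha>_pos: "\<alpha> > 0"
  using \<alpha> p by (smt (verit) zero_less_divide_1_iff)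

lemma \<sigma>_pos: "\<sigma> > 0"
  using \<alpha> by (simp add: \<sigma>_def)

lemma \<beta>_eq: "\<beta> = \<sigma> * q"
proof -
  have "\<alpha> - 1 / p = (\<alpha> - 1) + 1 / q" using q by linarith
  then show ?thesis using q by (simp add: \<beta>_def \<sigma>_def field_simps)
qed

lemma \<beta>_pos: "\<beta> > 0"
  using \<sigma>_pos q by (simp add: \<beta>_eq)

lemma KH_nonneg: "KH \<ge> 0"
  using \<alpha>_pos by (auto simp: KH_def intro!: mult_nonneg_nonneg Gamma_real_nonneg less_imp_le[OF Gamma_real_pos])

lemma powker_MT_integrable:
  assumes "\<gamma> > -1"
  shows "integrable (MT T) (powker \<gamma> a t)"
proof -
  have "integrable lborel (powker \<gamma> a t)"
  proof (cases "a \<le> t")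
    case True
    then show ?thesis using has_bochner_integral_powker[OF assms] by (auto simp: has_bochner_integral_iff)
  next
    case False
    then have "powker \<gamma> a t = (\<lambda>_. 0)" by (auto simp: powker_def)
    then show ?thesis by simp
  qed
  then show ?thesis
    using integrable_mult_indicator[of "{0..T}" lborel "powker \<gamma> a t"]
    by (subst integrable_restrict_space) simp_all
qed

lemma Lp_fun_powker:
  assumes "0 \<le> t"
  shows "Lp_fun q (MT T) (powker (\<alpha> - 1) 0 t)"
  unfolding Lp_fun_def abs_powker_powr
  using \<beta>_pos assms
  by (auto intro!: powker_MT_integrable borel_measurable_MT simp: \<beta>_def)

text \<open>On [0, t) superadditivity bounds the q-th power of the difference by a difference of
  q-th powers, which can be integrated exactly. On [t, t') only the kernel for t' is present; the
  coefficient 2 makes up for its being subtracted there. What remains besides the (t' - t) term is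
  t^\<beta> - t'^\<beta>, which is not positive.\<close>

lemma Lp_mass_powker_diff:
  assumes "0 \<le> t" "t \<le> t'" "t' \<le> T"
  shows "Lp_mass q (MT T) (\<lambda>s. powker (\<alpha> - 1) 0 t' s - powker (\<alpha> - 1) 0 t s)
    \<le> 2 * (t' - t) powr \<beta> / \<beta>"
proof -
  define \<gamma> where "\<gamma> = (\<alpha> - 1) * q"
  have \<gamma>: "\<gamma> > -1" "\<gamma> + 1 = \<beta>" using \<beta>_pos by (auto simp: \<gamma>_def \<beta>_def)
  have pointwise: "\<bar>powker (\<alpha> - 1) 0 t' s - powker (\<alpha> - 1) 0 t s\<bar> powr q
      \<le> powker \<gamma> 0 t s - powker \<gamma> 0 t' s + 2 * powker \<gamma> t t' s" for s
  proof (cases "0 \<le> s \<and> s < t")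
    case True
    define x where "x = (t - s) powr (\<alpha> - 1)"
    define y where "y = (t' - s) powr (\<alpha> - 1)"
    have "y \<le> x" unfolding x_def y_def using True assms \<alpha> by (intro powr_mono2') auto
    moreover have "y \<ge> 0" by (simp add: y_def)
    ultimately have "(x - y) powr q \<le> x powr q - y powr q" using q by (intro powr_superadditive) auto
    then have "\<bar>y - x\<bar> powr q \<le> x powr q - y powr q" using \<open>y \<le> x\<close> by simp
    then show ?thesis using True assms by (simp add: powker_def x_def y_def powr_powr \<gamma>_def)
  next
    case False
    then show ?thesis using assms by (auto simp: powker_def powr_powr \<gamma>_def)
  qed
  have i: "integrable lborel (powker \<gamma> a u)" "(\<integral>s. powker \<gamma> a u s \<partial>lborel) = (u - a) powr \<beta> / \<beta>"
    if "a \<le> u" for a u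
    using has_bochner_integral_powker[OF \<gamma>(1) that] \<gamma>(2) by (auto simp: has_bochner_integral_iff)
  have "Lp_mass q (MT T) (\<lambda>s. powker (\<alpha> - 1) 0 t' s - powker (\<alpha> - 1) 0 t s)
    = (\<integral>s. \<bar>powker (\<alpha> - 1) 0 t' s - powker (\<alpha> - 1) 0 t s\<bar> powr q \<partial>lborel)"
    unfolding Lp_mass_def integral_restrict_space
    using assms q by (subst integral_restrict_space) (auto intro!: Bochner_Integration.integral_cong simp: powker_def indicator_def)
  also have "\<dots> \<le> (\<integral>s. powker \<gamma> 0 t s - powker \<gamma> 0 t' s + 2 * powker \<gamma> t t' s \<partial>lborel)"
  proof (rule integral_mono')
    show "0 \<le> powker \<gamma> 0 t s - powker \<gamma> 0 t' s + 2 * powker \<gamma> t t' s" for s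
      using pointwise[of s] powr_ge_zero by (rule order_trans[rotated])
  qed (use assms i pointwise in auto)
  also have "\<dots> = (t powr \<beta> - t' powr \<beta> + 2 * (t' - t) powr \<beta>) / \<beta>"
    using i assms by (simp add: add_divide_distrib diff_divide_distrib)
  also have "\<dots> \<le> 2 * (t' - t) powr \<beta> / \<beta>"
    using \<beta>_pos assms powr_mono2[of \<beta> t t'] by (intro divide_right_mono) auto
  finally show ?thesis .
qed

lemma Ifrac_diff_le:
  assumes w: "Lp_fun p (MT T) w" and t: "0 \<le> t" "t \<le> t'" "t' \<le> T"
  shows "\<bar>Ifrac \<alpha> w t' - Ifrac \<alpha> w t\<bar> \<le> KH * Lp_mass p (MT T) w powr (1 / p) * (t' - t) powr \<sigma>"
proof -
  define g where "g s = powker (\<alpha> - 1) 0 t' s - powker (\<alpha> - 1) 0 t s" for s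
  have G: "Gamma \<alpha> > 0" using \<alpha>_pos by (rule Gamma_real_pos)
  have Lp: "Lp_fun q (MT T) (powker (\<alpha> - 1) 0 u)" if "0 \<le> u" for u by (rule Lp_fun_powker[OF that])
  have g: "Lp_fun q (MT T) g"
    unfolding g_def using q t by (intro Lp_fun_diff Lp) auto
  have "Ifrac \<alpha> w t' - Ifrac \<alpha> w t = (1 / Gamma \<alpha>) *
      ((\<integral>s. powker (\<alpha> - 1) 0 t' s * w s \<partial>MT T) - (\<integral>s. powker (\<alpha> - 1) 0 t s * w s \<partial>MT T))"
    using t by (simp add: Ifrac_def integral_powker_MT[of _ T] right_diff_distrib)
  also have "(\<integral>s. powker (\<alpha> - 1) 0 t' s * w s \<partial>MT T) - (\<integral>s. powker (\<alpha> - 1) 0 t s * w s \<partial>MT T)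
    = (\<integral>s. g s * w s \<partial>MT T)"
    unfolding g_def left_diff_distrib
    using t by (intro Bochner_Integration.integral_diff[symmetric] Hoelder_integrable[OF p q(1) q(2) Lp w]) auto
  finally have "\<bar>Ifrac \<alpha> w t' - Ifrac \<alpha> w t\<bar> = (1 / Gamma \<alpha>) * \<bar>\<integral>s. g s * w s \<partial>MT T\<bar>"
    using G by (simp add: abs_mult)
  also have "\<dots> \<le> (1 / Gamma \<alpha>) * (Lp_mass q (MT T) g powr (1 / q) * Lp_mass p (MT T) w powr (1 / p))"
    using G by (intro mult_left_mono Hoelder_inequality[OF p q g w]) auto
  finally have 1: "\<bar>Ifrac \<alpha> w t' - Ifrac \<alpha> w t\<bar>
      \<le> (1 / Gamma \<alpha>) * (Lp_mass q (MT T) g powr (1 / q) * Lp_mass p (MT T) w powr (1 / p))" .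
  have "Lp_mass q (MT T) g powr (1 / q) \<le> (2 * (t' - t) powr \<beta> / \<beta>) powr (1 / q)"
    unfolding g_def using q t by (intro powr_mono2 Lp_mass_powker_diff) auto
  also have "\<dots> = (2 / \<beta>) powr (1 / q) * (t' - t) powr \<sigma>"
  proof -
    have "2 * (t' - t) powr \<beta> / \<beta> = (2 / \<beta>) * (t' - t) powr \<beta>" by simp
    then show ?thesis using q \<beta>_pos by (simp only: powr_mult powr_powr) (simp add: \<beta>_eq)
  qed
  finally have "(1 / Gamma \<alpha>) * (Lp_mass q (MT T) g powr (1 / q) * Lp_mass p (MT T) w powr (1 / p))
    \<le> (1 / Gamma \<alpha>) * ((2 / \<beta>) powr (1 / q) * (t' - t) powr \<sigma> * Lp_mass p (MT T) w powr (1 / p))"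
    using G by (intro mult_left_mono mult_right_mono) auto
  with 1 show ?thesis by (simp add: KH_def mult_ac)
qed

lemma Ifrac_Hoelder:
  assumes w: "Lp_fun p (MT T) w" and t: "t \<in> {0..T}" "t' \<in> {0..T}"
  shows "\<bar>Ifrac \<alpha> w t' - Ifrac \<alpha> w t\<bar> \<le> KH * Lp_mass p (MT T) w powr (1 / p) * \<bar>t' - t\<bar> powr \<sigma>"
proof (cases "t \<le> t'")
  case True
  then show ?thesis using Ifrac_diff_le[OF w, of t t'] t by simp
next
  case False
  then have "\<bar>Ifrac \<alpha> w t - Ifrac \<alpha> w t'\<bar> \<le> KH * Lp_mass p (MT T) w powr (1 / p) * (t - t') powr \<sigma>"
    using Ifrac_diff_le[OF w, of t' t] t by simp
  then show ?thesis using False by (simp add: abs_minus_commute[of "Ifrac \<alpha> w t'"])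
qed

lemma Ifrac_0 [simp]: "Ifrac \<alpha> w 0 = 0"
proof -
  have "powker (\<alpha> - 1) 0 0 = (\<lambda>_. 0)" by (auto simp: powker_def)
  then show ?thesis by (simp add: Ifrac_def)
qed

definition "KS = KH * T powr \<sigma>"

lemma KS_nonneg: "KS \<ge> 0"
  using KH_nonneg by (simp add: KS_def)

text \<open>The Hoelder estimate against the point 0, where fractional integrals vanish.\<close>

lemma Ifrac_sup:
  assumes w: "Lp_fun p (MT T) w" and t: "t \<in> {0..T}"
  shows "\<bar>Ifrac \<alpha> w t\<bar> \<le> KS * Lp_mass p (MT T) w powr (1 / p)"
proof -
  have "\<bar>Ifrac \<alpha> w t\<bar> \<le> KH * Lp_mass p (MT T) w powr (1 / p) * t powr \<sigma>"
    using Ifrac_Hoelder[OF w, of 0 t] t by simp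
  also have "\<dots> \<le> KH * Lp_mass p (MT T) w powr (1 / p) * T powr \<sigma>"
    using t \<sigma>_pos KH_nonneg by (intro mult_left_mono powr_mono2) auto
  finally show ?thesis by (simp add: KS_def mult_ac)
qed

lemma Ifrac_continuous_on:
  assumes w: "Lp_fun p (MT T) w"
  shows "continuous_on {0..T} (Ifrac \<alpha> w)"
proof -
  define A where "A = KH * Lp_mass p (MT T) w powr (1 / p)"
  have "(Ifrac \<alpha> w \<longlongrightarrow> Ifrac \<alpha> w t) (at t within {0..T})" if t: "t \<in> {0..T}" for t
  proof -
    have "((\<lambda>s. \<bar>s - t\<bar>) \<longlongrightarrow> 0) (at t within {0..T})"
      by (intro tendsto_rabs_zero LIM_zero tendsto_ident_at)
    then have "((\<lambda>s. \<bar>s - t\<bar> powr \<sigma>) \<longlongrightarrow> 0 powr \<sigma>) (at t within {0..T})"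
      using \<sigma>_pos by (rule_tac tendsto_powr') simp_all
    then have lim: "((\<lambda>s. A * \<bar>s - t\<bar> powr \<sigma>) \<longlongrightarrow> 0) (at t within {0..T})"
      by (simp add: tendsto_mult_right_zero)
    have "\<forall>\<^sub>F s in at t within {0..T}. norm (Ifrac \<alpha> w s - Ifrac \<alpha> w t) \<le> A * \<bar>s - t\<bar> powr \<sigma>"
    proof -
      have "norm (Ifrac \<alpha> w s - Ifrac \<alpha> w t) \<le> A * \<bar>s - t\<bar> powr \<sigma>" if "s \<in> {0..T}" for s
        using Ifrac_Hoelder[OF w t that] by (simp add: A_def)
      then show ?thesis
        unfolding eventually_at_filter by (intro always_eventually allI impI)
    qed
    then show ?thesis by (rule LIM_zero_cancel[OF Lim_null_comparison[OF _ lim]])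
  qed
  then show ?thesis by (simp add: continuous_on_def)
qed

lemma Ifrac_lincomb:
  assumes w: "Lp_fun p (MT T) w" and v: "Lp_fun p (MT T) v" and t: "t \<in> {0..T}"
  shows "Ifrac \<alpha> (\<lambda>s. c * w s + d * v s) t = c * Ifrac \<alpha> w t + d * Ifrac \<alpha> v t"
proof -
  have i: "integrable (MT T) (\<lambda>s. powker (\<alpha> - 1) 0 t s * u s)" if "Lp_fun p (MT T) u" for u
    by (intro Hoelder_integrable[OF p q(1) q(2) Lp_fun_powker that]) (use t in auto)
  have "powker (\<alpha> - 1) 0 t s * (c * w s + d * v s)
      = c * (powker (\<alpha> - 1) 0 t s * w s) + d * (powker (\<alpha> - 1) 0 t s * v s)" for s
    by (simp add: algebra_simps)
  then have "(\<integral>s. powker (\<alpha> - 1) 0 t s * (c * w s + d * v s) \<partial>MT T)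
      = c * (\<integral>s. powker (\<alpha> - 1) 0 t s * w s \<partial>MT T) + d * (\<integral>s. powker (\<alpha> - 1) 0 t s * v s \<partial>MT T)"
    using i[OF w] i[OF v] by simp
  moreover have "t \<le> T" using t by simp
  ultimately show ?thesis by (simp only: Ifrac_def integral_powker_MT[of _ T]) (simp add: add_divide_distrib)
qed

end

section \<open>Test functions\<close>

lemma test_fun_deriv:
  assumes "test_fun T \<phi>"
  shows "test_fun T (deriv \<phi>)"
proof -
  have *: "(deriv ^^ k) (deriv \<phi>) = (deriv ^^ Suc k) \<phi>" for k
    by (simp only: funpow_Suc_right o_def)
  obtain \<epsilon> where \<epsilon>: "\<epsilon> > 0" "\<And>x. x \<notin> {\<epsilon>..T - \<epsilon>} \<Longrightarrow> \<phi> x = 0"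
    using assms by (auto simp: test_fun_def)
  have "deriv \<phi> x = 0" if "x \<notin> {\<epsilon>..T - \<epsilon>}" for x
  proof -
    have "((\<lambda>_. 0) has_real_derivative 0) (at x)" by simp
    then have "(\<phi> has_real_derivative 0) (at x)"
      by (rule has_field_derivative_transform_within_open[of _ _ _ "- {\<epsilon>..T - \<epsilon>}"])
        (use that \<epsilon>(2) in auto)
    then show ?thesis by (rule DERIV_imp_deriv)
  qed
  moreover have "((deriv ^^ k) (deriv \<phi>) has_real_derivative (deriv ^^ Suc k) (deriv \<phi>) x) (at x)" for k x
    using assms unfolding * test_fun_def by blast
  ultimately show ?thesis using \<epsilon>(1) unfolding test_fun_def by blast
qed

lemma test_fun_has_deriv:
  assumes "test_fun T \<phi>"
  shows "(\<phi> has_real_derivative deriv \<phi> x) (at x)"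
proof -
  have "((deriv ^^ 0) \<phi> has_real_derivative (deriv ^^ Suc 0) \<phi> x) (at x)"
    using assms unfolding test_fun_def by blast
  then show ?thesis by simp
qed

lemma test_fun_continuous_on: "test_fun T \<phi> \<Longrightarrow> continuous_on S \<phi>"
  by (meson DERIV_continuous continuous_at_imp_continuous_on test_fun_has_deriv)

lemma test_fun_borel_measurable [measurable_dest]: "test_fun T \<phi> \<Longrightarrow> \<phi> \<in> borel_measurable borel"
  by (intro borel_measurable_continuous_onI test_fun_continuous_on)

lemma test_fun_eq_0:
  assumes "test_fun T \<phi>" "x \<le> 0 \<or> x \<ge> T"
  shows "\<phi> x = 0"
proof -
  obtain \<epsilon> where "\<epsilon> > 0" "\<And>x. x \<notin> {\<epsilon>..T - \<epsilon>} \<Longrightarrow> \<phi> x = 0"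
    using assms by (auto simp: test_fun_def)
  then show ?thesis using assms(2) by force
qed

lemma test_fun_bounded:
  assumes "test_fun T \<phi>"
  obtains B where "B > 0" "\<And>x. \<bar>\<phi> x\<bar> \<le> B"
proof -
  have "compact (\<phi> ` {0..T})"
    by (intro compact_continuous_image test_fun_continuous_on[OF assms]) auto
  then obtain B where B: "B > 0" "\<And>y. y \<in> \<phi> ` {0..T} \<Longrightarrow> norm y \<le> B"
    using compact_imp_bounded bounded_pos by metis
  have "\<bar>\<phi> x\<bar> \<le> B" for x
  proof (cases "x \<in> {0..T}")
    case True
    then show ?thesis using B(2)[of "\<phi> x"] by auto
  next
    case False
    then show ?thesis using test_fun_eq_0[OF assms, of x] B(1) by auto
  qed
  with B(1) show ?thesis using that by blast
qed

lemma test_fun_lincomb_funpow: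
  assumes "test_fun T \<phi>" "test_fun T \<psi>"
  shows "(deriv ^^ k) (\<lambda>x. c * \<phi> x + d * \<psi> x)
    = (\<lambda>x. c * (deriv ^^ k) \<phi> x + d * (deriv ^^ k) \<psi> x)"
proof (induction k)
  case (Suc k)
  have D: "((deriv ^^ k) \<phi> has_real_derivative (deriv ^^ Suc k) \<phi> x) (at x)"
    "((deriv ^^ k) \<psi> has_real_derivative (deriv ^^ Suc k) \<psi> x) (at x)" for x
    using assms unfolding test_fun_def by blast+
  have "(deriv ^^ Suc k) (\<lambda>x. c * \<phi> x + d * \<psi> x)
    = deriv (\<lambda>x. c * (deriv ^^ k) \<phi> x + d * (deriv ^^ k) \<psi> x)"
    by (simp add: Suc.IH)
  also have "\<dots> = (\<lambda>x. c * (deriv ^^ Suc k) \<phi> x + d * (deriv ^^ Suc k) \<psi> x)"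
    by (intro ext DERIV_imp_deriv DERIV_add DERIV_cmult D)
  finally show ?case .
qed simp

lemma test_fun_lincomb:
  assumes "test_fun T \<phi>" "test_fun T \<psi>"
  shows "test_fun T (\<lambda>x. c * \<phi> x + d * \<psi> x)"
proof -
  have D: "((deriv ^^ k) \<phi> has_real_derivative (deriv ^^ Suc k) \<phi> x) (at x)"
    "((deriv ^^ k) \<psi> has_real_derivative (deriv ^^ Suc k) \<psi> x) (at x)" for k x
    using assms unfolding test_fun_def by blast+
  obtain \<epsilon> where \<epsilon>: "\<epsilon> > 0" "\<And>x. x \<notin> {\<epsilon>..T - \<epsilon>} \<Longrightarrow> \<phi> x = 0"
    using assms by (auto simp: test_fun_def)
  obtain \<delta> where \<delta>: "\<delta> > 0" "\<And>x. x \<notin> {\<delta>..T - \<delta>} \<Longrightarrow> \<psi> x = 0"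
    using assms by (auto simp: test_fun_def)
  have "c * \<phi> x + d * \<psi> x = 0" if "x \<notin> {min \<epsilon> \<delta>..T - min \<epsilon> \<delta>}" for x
  proof -
    have "x \<notin> {\<epsilon>..T - \<epsilon>}" "x \<notin> {\<delta>..T - \<delta>}" using that by auto
    then show ?thesis by (simp add: \<epsilon> \<delta>)
  qed
  moreover have "((deriv ^^ k) (\<lambda>x. c * \<phi> x + d * \<psi> x) has_real_derivative
      (deriv ^^ Suc k) (\<lambda>x. c * \<phi> x + d * \<psi> x) x) (at x)" for k x
    unfolding test_fun_lincomb_funpow[OF assms]
    by (intro DERIV_add DERIV_cmult D)
  ultimately show ?thesis
    using \<epsilon>(1) \<delta>(1) unfolding test_fun_def by (intro conjI allI exI[of _ "min \<epsilon> \<delta>"]) auto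
qed

section \<open>Smooth bump functions\<close>

definition bump_fun :: "real poly \<Rightarrow> real \<Rightarrow> real" where
  "bump_fun P x = (if x > 0 then poly P (1 / x) * exp (- (1 / x)) else 0)"

lemma poly_times_exp_minus_tendsto_0: "((\<lambda>y::real. poly P y * exp (- y)) \<longlongrightarrow> 0) at_top"
proof (induction P)
  case (pCons c P)
  have "((\<lambda>y::real. y * (poly P y * exp (- y))) \<longlongrightarrow> 0) at_top"
  proof -
    have e: "((\<lambda>y::real. poly P y * y / exp y) \<longlongrightarrow> 0) at_top"
    proof -
      have "poly P y * y / exp y = (\<Sum>i\<le>degree P. coeff P i * (y ^ Suc i / exp y))" for y :: real
        by (simp add: poly_altdef sum_distrib_left sum_divide_distrib mult_ac)
      moreover have "((\<lambda>y::real. \<Sum>i\<le>degree P. coeff P i * (y ^ Suc i / exp y)) \<longlongrightarrow> (\<Sum>i\<le>degree P. coeff P i * 0)) at_top"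
        by (intro tendsto_sum tendsto_mult tendsto_const tendsto_power_div_exp_0)
      ultimately show ?thesis by simp
    qed
    then show ?thesis by (simp add: exp_minus field_simps)
  qed
  moreover have "((\<lambda>y::real. c * exp (- y)) \<longlongrightarrow> c * 0) at_top"
    by (intro tendsto_mult tendsto_const)
      (use tendsto_power_div_exp_0[of 0] in \<open>simp add: exp_minus field_simps\<close>)
  ultimately show ?case
    using tendsto_add[of _ 0 at_top _ 0] by (simp add: algebra_simps)
qed simp

text \<open>With y = 1/x the chain rule contributes -y^2, and P(y) exp(-y) has derivative (P' -
  P)(y) exp(-y); this explains the polynomial. At 0 the exponential decay beats the polynomial,
  including the extra factor 1/h of the difference quotient.\<close>

lemma bump_fun_has_derivative:
  "(bump_fun P has_real_derivative bump_fun ([:0, 0, 1:] * (P - pderiv P)) x) (at x)"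
proof -
  consider "x > 0" | "x < 0" | "x = 0" by linarith
  then show ?thesis
  proof cases
    case 1
    have "((\<lambda>x. poly P (1 / x) * exp (- (1 / x))) has_real_derivative
        bump_fun ([:0, 0, 1:] * (P - pderiv P)) x) (at x)"
      using 1 by (auto intro!: derivative_eq_intros simp: bump_fun_def field_simps power2_eq_square)
    then show ?thesis
      by (rule has_field_derivative_transform_within_open[of _ _ _ "{0<..}"]) (use 1 in \<open>auto simp: bump_fun_def\<close>)
  next
    case 2
    have "((\<lambda>x. 0) has_real_derivative bump_fun ([:0, 0, 1:] * (P - pderiv P)) x) (at x)"
      using 2 by (simp add: bump_fun_def)
    then show ?thesis
      by (rule has_field_derivative_transform_within_open[of _ _ _ "{..<0}"]) (use 2 in \<open>auto simp: bump_fun_def\<close>)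
  next
    case 3
    have "((\<lambda>h. bump_fun P h / h) \<longlongrightarrow> 0) (at 0)"
    proof (rule filterlim_split_at)
      have "((\<lambda>h::real. poly ([:0, 1:] * P) (1 / h) * exp (- (1 / h))) \<longlongrightarrow> 0) (at_right 0)"
        by (rule filterlim_compose[OF poly_times_exp_minus_tendsto_0])
          (use filterlim_inverse_at_top_right in \<open>simp add: inverse_eq_divide\<close>)
      then show "((\<lambda>h. bump_fun P h / h) \<longlongrightarrow> 0) (at_right 0)"
        by (rule Lim_transform_eventually)
          (auto simp: eventually_at_filter bump_fun_def intro!: always_eventually)
      show "((\<lambda>h. bump_fun P h / h) \<longlongrightarrow> 0) (at_left 0)"
        by (rule Lim_transform_eventually[OF tendsto_const])
          (auto simp: eventually_at_filter bump_fun_def intro!: always_eventually)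
    qed
    then show ?thesis using 3 by (simp add: DERIV_def bump_fun_def)
  qed
qed

text \<open>Sums of products of two one-sided bumps: a class closed under differentiation, which is all
  that the iterated derivatives need.\<close>

inductive_set bump_span :: "real \<Rightarrow> real \<Rightarrow> (real \<Rightarrow> real) set" for a b where
  prod: "(\<lambda>x. bump_fun P (x - a) * bump_fun Q (b - x)) \<in> bump_span a b"
| add: "f \<in> bump_span a b \<Longrightarrow> g \<in> bump_span a b \<Longrightarrow> (\<lambda>x. f x + g x) \<in> bump_span a b"

lemma bump_span_deriv:
  assumes "f \<in> bump_span a b"
  shows "\<exists>g \<in> bump_span a b. \<forall>x. (f has_real_derivative g x) (at x)"
  using assms
proof induction
  case (prod P Q)
  define P' where "P' = [:0, 0, 1:] * (P - pderiv P)"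
  define Q' where "Q' = [:0, 0, 1:] * (Q - pderiv Q)"
  have 1: "((\<lambda>x. bump_fun P (x - a)) has_real_derivative bump_fun P' (x - a)) (at x)" for x
  proof -
    have "((\<lambda>x. x - a) has_real_derivative 1) (at x)" by (auto intro!: derivative_eq_intros)
    from DERIV_chain2[where f = "bump_fun P", OF bump_fun_has_derivative this]
    show ?thesis by (simp add: P'_def)
  qed
  have 2: "((\<lambda>x. bump_fun Q (b - x)) has_real_derivative - bump_fun Q' (b - x)) (at x)" for x
  proof -
    have "((\<lambda>x. b - x) has_real_derivative -1) (at x)" by (auto intro!: derivative_eq_intros)
    from DERIV_chain2[where f = "bump_fun Q", OF bump_fun_has_derivative this]
    show ?thesis by (simp add: Q'_def)
  qed
  \<comment> \<open>The minus sign from reflecting x into b - x is absorbed into the polynomial, so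
    that \<open>g\<close> is again a sum of products of bumps.\<close>
  define g where "g x = bump_fun P' (x - a) * bump_fun Q (b - x) + bump_fun P (x - a) * bump_fun (- Q') (b - x)" for x
  have "g \<in> bump_span a b" unfolding g_def by (intro bump_span.intros)
  moreover have "((\<lambda>x. bump_fun P (x - a) * bump_fun Q (b - x)) has_real_derivative g x) (at x)" for x
  proof -
    have "bump_fun (- Q') y = - bump_fun Q' y" for y by (simp add: bump_fun_def)
    then show ?thesis using DERIV_mult[OF 1 2, of x] by (simp add: g_def mult.commute)
  qed
  ultimately show ?case by blast
next
  case (add f g)
  then obtain f' g' where "f' \<in> bump_span a b" "g' \<in> bump_span a b"
    "\<And>x. (f has_real_derivative f' x) (at x)" "\<And>x. (g has_real_derivative g' x) (at x)" by blast
  then show ?case by (intro bexI[of _ "\<lambda>x. f' x + g' x"] allI DERIV_add bump_span.add)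
qed

text \<open>Guarantees that the space is not trivial, hence that the Nehari set is nonempty. Support
  in the middle half leaves the margin T/4 that \<open>test_fun\<close> asks for.\<close>

lemma test_fun_exists:
  assumes "T > 0"
  obtains \<phi> where "test_fun T \<phi>" "\<phi> (T / 2) > 0"
proof -
  define \<phi> where "\<phi> = (\<lambda>x. bump_fun 1 (x - T / 4) * bump_fun 1 (3 * T / 4 - x))"
  have in_span: "(deriv ^^ k) \<phi> \<in> bump_span (T / 4) (3 * T / 4)" for k
  proof (induction k)
    case 0
    show ?case by (simp add: \<phi>_def bump_span.prod)
  next
    case (Suc k)
    obtain g where g: "g \<in> bump_span (T / 4) (3 * T / 4)" "\<And>x. ((deriv ^^ k) \<phi> has_real_derivative g x) (at x)"
      using bump_span_deriv[OF Suc] by blast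
    then have "(deriv ^^ Suc k) \<phi> = g" by (auto intro!: DERIV_imp_deriv)
    with g show ?case by simp
  qed
  have "((deriv ^^ k) \<phi> has_real_derivative (deriv ^^ Suc k) \<phi> x) (at x)" for k x
  proof -
    obtain g where g: "((deriv ^^ k) \<phi> has_real_derivative g x) (at x)"
      using bump_span_deriv[OF in_span[of k]] by blast
    from DERIV_imp_deriv[OF this] g show ?thesis by simp
  qed
  moreover have "\<phi> x = 0" if "x \<notin> {T / 4..T - T / 4}" for x
    using that by (auto simp: \<phi>_def bump_fun_def)
  ultimately have "test_fun T \<phi>"
    using assms unfolding test_fun_def by (intro conjI allI exI[of _ "T / 4"]) auto
  moreover have "\<phi> (T / 2) > 0" using assms by (simp add: \<phi>_def bump_fun_def)
  ultimately show ?thesis using that by blast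
qed

section \<open>Fractional derivatives of test functions\<close>

lemma powker_bounded_integrable:
  assumes "\<gamma> > -1" "a \<le> t" "\<psi> \<in> borel_measurable borel" "\<And>x. \<bar>\<psi> x\<bar> \<le> B"
  shows "integrable lborel (\<lambda>s. powker \<gamma> a t s * \<psi> s)"
proof -
  have "integrable lborel (\<lambda>s. powker \<gamma> a t s * B)"
    using has_bochner_integral_powker[OF assms(1,2)] by (auto simp: has_bochner_integral_iff)
  then show ?thesis
  proof (rule Bochner_Integration.integrable_bound)
    show "(\<lambda>s. powker \<gamma> a t s * \<psi> s) \<in> borel_measurable lborel"
      using assms(3) by measurable
    have "B \<ge> 0" using assms(4)[of 0] by linarith
    then show "AE s in lborel. norm (powker \<gamma> a t s * \<psi> s) \<le> norm (powker \<gamma> a t s * B)"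
      using assms(4) powker_nonneg by (auto simp: abs_mult intro!: mult_left_mono)
  qed
qed

text \<open>Differentiation under the integral becomes possible once the singular kernel is moved onto a
  fixed domain by a convolution substitution.\<close>

lemma powker_convolution:
  assumes "\<And>x. x \<le> 0 \<Longrightarrow> \<psi> x = 0" "s \<le> B"
  shows "(\<integral>r. powker \<gamma> 0 s r * \<psi> r \<partial>lborel) = (\<integral>r. powker \<gamma> 0 B (B - r) * \<psi> (s - r) \<partial>lborel)"
proof -
  have "(\<integral>r. powker \<gamma> 0 s r * \<psi> r \<partial>lborel) = (\<integral>r. powker \<gamma> 0 s (s + (-1) * r) * \<psi> (s + (-1) * r) \<partial>lborel)"
    using lborel_integral_real_affine[of "-1" "\<lambda>r. powker \<gamma> 0 s r * \<psi> r" s] by simp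
  also have "\<dots> = (\<integral>r. powker \<gamma> 0 B (B - r) * \<psi> (s - r) \<partial>lborel)"
  proof (intro Bochner_Integration.integral_cong refl)
    fix r
    show "powker \<gamma> 0 s (s + (-1) * r) * \<psi> (s + (-1) * r) = powker \<gamma> 0 B (B - r) * \<psi> (s - r)"
      using assms by (cases "r < s") (auto simp: powker_def)
  qed
  finally show ?thesis .
qed

lemma DERIV_mean_value:
  fixes \<psi> \<psi>' :: "real \<Rightarrow> real"
  assumes D: "\<And>x. (\<psi> has_real_derivative \<psi>' x) (at x)"
  obtains z where "\<bar>z - y\<bar> \<le> \<bar>h\<bar>" "\<psi> (y + h) - \<psi> y = h * \<psi>' z"
proof -
  consider "h = 0" | "h > 0" | "h < 0" by linarith
  then show ?thesis
  proof cases
    case 1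
    then show ?thesis using that[of y] by simp
  next
    case 2
    then have "y < y + h" by simp
    from MVT2[OF this D] obtain z where "z > y" "z < y + h" "\<psi> (y + h) - \<psi> y = (y + h - y) * \<psi>' z" by blast
    then show ?thesis using that[of z] by simp
  next
    case 3
    then have "y + h < y" by simp
    from MVT2[OF this D] obtain z where "z > y + h" "z < y" "\<psi> y - \<psi> (y + h) = (y - (y + h)) * \<psi>' z" by blast
    then show ?thesis using that[of z] 3 by (simp add: algebra_simps)
  qed
qed

text \<open>Two applications of the mean value theorem. The remainder is uniform in y, so it can be
  integrated directly against the kernel in \<open>test_fun_powker_has_derivative\<close>.\<close>

lemma test_fun_second_order:
  assumes "test_fun T \<phi>"
  obtains M where "M > 0" "\<And>y h. \<bar>\<phi> (y + h) - \<phi> y - h * deriv \<phi> y\<bar> \<le> M * h\<^sup>2"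
proof -
  have t1: "test_fun T (deriv \<phi>)" by (rule test_fun_deriv[OF assms])
  have t2: "test_fun T (deriv (deriv \<phi>))" by (rule test_fun_deriv[OF t1])
  obtain M where M: "M > 0" "\<And>x. \<bar>deriv (deriv \<phi>) x\<bar> \<le> M" using test_fun_bounded[OF t2] by blast
  note mvt = DERIV_mean_value[OF test_fun_has_deriv]
  have "\<bar>\<phi> (y + h) - \<phi> y - h * deriv \<phi> y\<bar> \<le> M * h\<^sup>2" for y h
  proof -
    obtain z where z: "\<bar>z - y\<bar> \<le> \<bar>h\<bar>" "\<phi> (y + h) - \<phi> y = h * deriv \<phi> z" using mvt[OF assms] by blast
    obtain z' where z': "deriv \<phi> (y + (z - y)) - deriv \<phi> y = (z - y) * deriv (deriv \<phi>) z'" using mvt[OF t1] by blast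
    have "\<phi> (y + h) - \<phi> y - h * deriv \<phi> y = h * (deriv \<phi> z - deriv \<phi> y)"
      using z by (simp add: algebra_simps)
    also have "\<dots> = h * ((z - y) * deriv (deriv \<phi>) z')" using z' by simp
    finally have "\<bar>\<phi> (y + h) - \<phi> y - h * deriv \<phi> y\<bar> = \<bar>h\<bar> * (\<bar>z - y\<bar> * \<bar>deriv (deriv \<phi>) z'\<bar>)"
      by (simp add: abs_mult)
    also have "\<dots> \<le> \<bar>h\<bar> * (\<bar>h\<bar> * M)"
      using z(1) M by (intro mult_left_mono mult_mono) auto
    also have "\<dots> = M * h\<^sup>2" by (simp add: power2_eq_square)
    finally show ?thesis .
  qed
  then show ?thesis using M that by blast
qed

lemma test_fun_powker_has_derivative:
  assumes \<phi>: "test_fun T \<phi>" and \<gamma>: "\<gamma> > -1"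
  shows "((\<lambda>s. \<integral>r. powker \<gamma> 0 s r * \<phi> r \<partial>lborel) has_real_derivative
    (\<integral>r. powker \<gamma> 0 t r * deriv \<phi> r \<partial>lborel)) (at t)"
proof -
  note t1 = test_fun_deriv[OF \<phi>]
  note [measurable] = test_fun_borel_measurable[OF \<phi>] test_fun_borel_measurable[OF t1]
  obtain M where M: "M > 0" "\<And>y h. \<bar>\<phi> (y + h) - \<phi> y - h * deriv \<phi> y\<bar> \<le> M * h\<^sup>2"
    using test_fun_second_order[OF \<phi>] by blast
  \<comment> \<open>A kernel length that serves every s < B, in particular a whole neighbourhood of
    t.\<close>
  define B where "B = \<bar>t\<bar> + 1"
  define k where "k r = powker \<gamma> 0 B (B - r)" for r
  have k_nonneg: "k r \<ge> 0" for r by (simp add: k_def powker_nonneg)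
  have k_int: "integrable lborel k"
  proof -
    have "integrable lborel (\<lambda>r. powker \<gamma> 0 B (B + (-1) * r))"
      using has_bochner_integral_powker[OF \<gamma>, of 0 B]
      by (intro lborel_integrable_real_affine) (auto simp: has_bochner_integral_iff B_def)
    moreover have "k = (\<lambda>r. powker \<gamma> 0 B (B - r))" by (simp add: k_def fun_eq_iff)
    ultimately show ?thesis by simp
  qed
  have [measurable]: "k \<in> borel_measurable borel" using k_int by simp
  have int: "integrable lborel (\<lambda>r. k r * \<psi> (s - r))" if \<psi>: "test_fun T \<psi>" for \<psi> s
  proof -
    note [measurable] = test_fun_borel_measurable[OF \<psi>]
    obtain C where C: "C > 0" "\<And>x. \<bar>\<psi> x\<bar> \<le> C" using test_fun_bounded[OF \<psi>] by blast
    have "integrable lborel (\<lambda>r. k r * C)" using k_int by simp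
    then show ?thesis
      by (rule Bochner_Integration.integrable_bound)
        (use C k_nonneg in \<open>auto simp: abs_mult intro!: mult_left_mono\<close>)
  qed
  define c where "c \<psi> s = (\<integral>r. k r * \<psi> (s - r) \<partial>lborel)" for \<psi> s
  have conv: "(\<integral>r. powker \<gamma> 0 s r * \<psi> r \<partial>lborel) = c \<psi> s" if "test_fun T \<psi>" "s \<le> B" for \<psi> s
    unfolding c_def k_def by (rule powker_convolution[OF test_fun_eq_0[OF that(1)] that(2)]) simp
  define I where "I = (\<integral>r. k r \<partial>lborel)"
  have bound: "\<bar>c \<phi> (t + h) - c \<phi> t - h * c (deriv \<phi>) t\<bar> \<le> I * M * h\<^sup>2" for h
  proof -
    define D where "D r = \<phi> (t + h - r) - \<phi> (t - r) - h * deriv \<phi> (t - r)" for r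
    have D_le: "\<bar>D r\<bar> \<le> M * h\<^sup>2" for r
      using M(2)[of "t - r" h] by (simp add: D_def algebra_simps)
    note i1 = int[OF \<phi>, of "t + h"] and i2 = int[OF \<phi>, of t] and i3 = int[OF t1, of t]
    have i4: "integrable lborel (\<lambda>r. k r * \<phi> (t + h - r) - k r * \<phi> (t - r))"
      by (rule Bochner_Integration.integrable_diff[OF i1 i2])
    have i5: "integrable lborel (\<lambda>r. h * (k r * deriv \<phi> (t - r)))"
      by (rule integrable_mult_right[OF i3])
    have kD: "k r * \<phi> (t + h - r) - k r * \<phi> (t - r) - h * (k r * deriv \<phi> (t - r)) = k r * D r" for r
      by (simp add: D_def algebra_simps)
    have i6: "integrable lborel (\<lambda>r. k r * D r)"
      using Bochner_Integration.integrable_diff[OF i4 i5] unfolding kD .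
    have "c \<phi> (t + h) - c \<phi> t - h * c (deriv \<phi>) t = (\<integral>r. k r * D r \<partial>lborel)"
      using Bochner_Integration.integral_diff[OF i4 i5] Bochner_Integration.integral_diff[OF i1 i2]
      unfolding kD c_def integral_mult_right_zero by linarith
    also have "\<bar>\<dots>\<bar> \<le> (\<integral>r. \<bar>k r * D r\<bar> \<partial>lborel)"
      by (rule integral_abs_bound)
    also have "\<dots> \<le> (\<integral>r. k r * (M * h\<^sup>2) \<partial>lborel)"
    proof (rule integral_mono)
      show "integrable lborel (\<lambda>r. \<bar>k r * D r\<bar>)" using i6 by (rule integrable_abs)
      show "integrable lborel (\<lambda>r. k r * (M * h\<^sup>2))" using k_int by (rule integrable_mult_left)
      show "\<bar>k r * D r\<bar> \<le> k r * (M * h\<^sup>2)" for r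
        unfolding abs_mult abs_of_nonneg[OF k_nonneg] by (rule mult_left_mono[OF D_le k_nonneg])
    qed
    also have "\<dots> = I * (M * h\<^sup>2)" unfolding I_def by (rule integral_mult_left_zero)
    also have "\<dots> = I * M * h\<^sup>2" by (rule mult.assoc[symmetric])
    finally show ?thesis .
  qed
  have "((\<lambda>h. (c \<phi> (t + h) - c \<phi> t) / h - c (deriv \<phi>) t) \<longlongrightarrow> 0) (at 0)"
  proof (rule Lim_null_comparison)
    have "((\<lambda>h. I * M * \<bar>h\<bar>) \<longlongrightarrow> I * M * \<bar>0\<bar>) (at 0)" by (intro tendsto_intros)
    then show "((\<lambda>h. I * M * \<bar>h\<bar>) \<longlongrightarrow> 0) (at 0)" by simp
    have "norm ((c \<phi> (t + h) - c \<phi> t) / h - c (deriv \<phi>) t) \<le> I * M * \<bar>h\<bar>" if "h \<noteq> 0" for h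
    proof -
      have "(c \<phi> (t + h) - c \<phi> t) / h - c (deriv \<phi>) t = (c \<phi> (t + h) - c \<phi> t - h * c (deriv \<phi>) t) / h"
        using that by (simp add: field_simps)
      then have "norm ((c \<phi> (t + h) - c \<phi> t) / h - c (deriv \<phi>) t) \<le> (I * M * h\<^sup>2) / \<bar>h\<bar>"
        using bound[of h] by (simp add: abs_divide divide_right_mono)
      also have "\<dots> = I * M * \<bar>h\<bar>" using that by (simp add: power2_eq_square abs_if)
      finally show ?thesis .
    qed
    then show "\<forall>\<^sub>F h in at 0. norm ((c \<phi> (t + h) - c \<phi> t) / h - c (deriv \<phi>) t) \<le> I * M * \<bar>h\<bar>"
      unfolding eventually_at_filter by (intro always_eventually) blast
  qed
  then have "(c \<phi> has_real_derivative c (deriv \<phi>) t) (at t)"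
    unfolding DERIV_def by (rule LIM_zero_cancel)
  then have "((\<lambda>s. \<integral>r. powker \<gamma> 0 s r * \<phi> r \<partial>lborel) has_real_derivative c (deriv \<phi>) t) (at t)"
    by (rule has_field_derivative_transform_within_open[of _ _ _ "{..<B}"])
      (auto simp: conv[OF \<phi>] B_def)
  then show ?thesis using conv[OF t1, of t] by (simp add: B_def)
qed

text \<open>The Riemann-Liouville derivative in Caputo form: as \<phi> vanishes on the negative axis
  and at 0, no boundary term appears when the derivative moves under the integral.\<close>

lemma frac_left_deriv_test_fun:
  assumes \<phi>: "test_fun T \<phi>" and \<alpha>: "0 < \<alpha>" "\<alpha> < 1"
  shows "frac_left_deriv \<alpha> \<phi> t = (1 / Gamma (1 - \<alpha>)) * (\<integral>r. powker (- \<alpha>) 0 t r * deriv \<phi> r \<partial>lborel)"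
proof -
  have "(LINT r:{0..s}|lborel. (s - r) powr (- \<alpha>) * \<phi> r) = (\<integral>r. powker (- \<alpha>) 0 s r * \<phi> r \<partial>lborel)" for s
    unfolding set_lebesgue_integral_def
    by (intro Bochner_Integration.integral_cong) (auto simp: powker_def indicator_def)
  then have "frac_left_deriv \<alpha> \<phi> t
    = deriv (\<lambda>s. (1 / Gamma (1 - \<alpha>)) * (\<integral>r. powker (- \<alpha>) 0 s r * \<phi> r \<partial>lborel)) t"
    using \<alpha> by (simp add: frac_left_deriv_def)
  also have "\<dots> = (1 / Gamma (1 - \<alpha>)) * (\<integral>r. powker (- \<alpha>) 0 t r * deriv \<phi> r \<partial>lborel)"
    using \<alpha> by (intro DERIV_imp_deriv DERIV_cmult test_fun_powker_has_derivative[OF \<phi>]) auto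
  finally show ?thesis .
qed

lemma continuous_on_frac_left_deriv_test_fun:
  assumes \<phi>: "test_fun T \<phi>" and \<alpha>: "0 < \<alpha>" "\<alpha> \<le> 1"
  shows "continuous_on S (frac_left_deriv \<alpha> \<phi>)"
proof (cases "\<alpha> = 1")
  case True
  then show ?thesis
    using test_fun_continuous_on[OF test_fun_deriv[OF \<phi>]] by (simp add: frac_left_deriv_def[abs_def])
next
  case False
  then have "\<alpha> < 1" using \<alpha> by simp
  have "continuous_on S (\<lambda>t. \<integral>r. powker (- \<alpha>) 0 t r * deriv \<phi> r \<partial>lborel)"
    using test_fun_powker_has_derivative[OF test_fun_deriv[OF \<phi>], of "- \<alpha>"] \<open>\<alpha> < 1\<close>
    by (intro DERIV_continuous_on) (auto intro: has_field_derivative_at_within)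
  then have "continuous_on S (\<lambda>t. (1 / Gamma (1 - \<alpha>)) * (\<integral>r. powker (- \<alpha>) 0 t r * deriv \<phi> r \<partial>lborel))"
    by (rule continuous_on_mult_left)
  then show ?thesis
    by (simp only: frac_left_deriv_test_fun[OF \<phi> \<alpha>(1) \<open>\<alpha> < 1\<close>, symmetric])
qed

lemma frac_left_deriv_lincomb:
  assumes \<phi>: "test_fun T \<phi>" and \<psi>: "test_fun T \<psi>" and \<alpha>: "0 < \<alpha>" "\<alpha> \<le> 1" and t: "0 \<le> t"
  shows "frac_left_deriv \<alpha> (\<lambda>x. c * \<phi> x + d * \<psi> x) t
    = c * frac_left_deriv \<alpha> \<phi> t + d * frac_left_deriv \<alpha> \<psi> t"
proof -
  have D: "deriv (\<lambda>x. c * \<phi> x + d * \<psi> x) = (\<lambda>x. c * deriv \<phi> x + d * deriv \<psi> x)"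
    using test_fun_lincomb_funpow[OF \<phi> \<psi>, of 1] by simp
  show ?thesis
  proof (cases "\<alpha> = 1")
    case True
    then show ?thesis by (simp add: frac_left_deriv_def D)
  next
    case False
    then have "\<alpha> < 1" using \<alpha> by simp
    have int: "integrable lborel (\<lambda>r. powker (- \<alpha>) 0 t r * deriv \<eta> r)" if \<eta>: "test_fun T \<eta>" for \<eta>
    proof -
      obtain B where "\<And>x. \<bar>deriv \<eta> x\<bar> \<le> B" using test_fun_bounded[OF test_fun_deriv[OF \<eta>]] by blast
      then show ?thesis
        using test_fun_borel_measurable[OF test_fun_deriv[OF \<eta>]] \<open>\<alpha> < 1\<close> t
        by (intro powker_bounded_integrable) auto
    qed
    have "powker (- \<alpha>) 0 t r * (c * deriv \<phi> r + d * deriv \<psi> r)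
      = c * (powker (- \<alpha>) 0 t r * deriv \<phi> r) + d * (powker (- \<alpha>) 0 t r * deriv \<psi> r)" for r
      by (simp add: algebra_simps)
    then show ?thesis
      unfolding frac_left_deriv_test_fun[OF \<phi> \<alpha>(1) \<open>\<alpha> < 1\<close>] frac_left_deriv_test_fun[OF \<psi> \<alpha>(1) \<open>\<alpha> < 1\<close>]
        frac_left_deriv_test_fun[OF test_fun_lincomb[OF \<phi> \<psi>] \<alpha>(1) \<open>\<alpha> < 1\<close>] D
      using int[OF \<phi>] int[OF \<psi>] by (simp add: add_divide_distrib)
  qed
qed

lemma integral_deriv_test_fun:
  assumes \<phi>: "test_fun T \<phi>" and t: "0 \<le> t"
  shows "(\<integral>x. deriv \<phi> x * indicator {0..t} x \<partial>lborel) = \<phi> t"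
proof -
  have "(\<integral>x. deriv \<phi> x * indicator {0..t} x \<partial>lborel) = \<phi> t - \<phi> 0"
    using test_fun_has_deriv[OF \<phi>] test_fun_has_deriv[OF test_fun_deriv[OF \<phi>]]
    by (intro integral_FTC_Icc_real t) (auto intro: DERIV_isCont)
  then show ?thesis using test_fun_eq_0[OF \<phi>, of 0] by simp
qed

text \<open>After exchanging the integrals, the inner one is the Beta constant Gamma(\<alpha>)
  Gamma(1 - \<alpha>) for every x < t, so only the integral of \<phi>' over [0, t) is left. For
  \<alpha> = 1 this is the fundamental theorem of calculus.\<close>

lemma Ifrac_frac_left_deriv:
  assumes \<phi>: "test_fun T \<phi>" and \<alpha>: "0 < \<alpha>" "\<alpha> \<le> 1" and t: "0 \<le> t"
  shows "Ifrac \<alpha> (frac_left_deriv \<alpha> \<phi>) t = \<phi> t"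
proof (cases "\<alpha> = 1")
  case True
  have "(\<integral>s. powker 0 0 t s * deriv \<phi> s \<partial>lborel) = (\<integral>x. deriv \<phi> x * indicator {0..t} x \<partial>lborel)"
  proof (intro integral_cong_AE)
    have "AE s in lborel. s \<noteq> t" by (rule AE_lborel_singleton)
    then show "AE s in lborel. powker 0 0 t s * deriv \<phi> s = deriv \<phi> s * indicator {0..t} s"
      by eventually_elim (auto simp: powker_def indicator_def)
  qed (use test_fun_borel_measurable[OF test_fun_deriv[OF \<phi>]] in measurable)
  then show ?thesis
    using True integral_deriv_test_fun[OF \<phi> t] by (simp add: Ifrac_def frac_left_deriv_def)
next
  case False
  then have \<alpha>1: "\<alpha> < 1" using \<alpha> by simp
  note [measurable] = test_fun_borel_measurable[OF test_fun_deriv[OF \<phi>]]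
  define G where "G = Gamma \<alpha> * Gamma (1 - \<alpha>)"
  have G: "G > 0" using \<alpha> \<alpha>1 by (simp add: G_def Gamma_real_pos)
  define f where "f x s = powker (\<alpha> - 1) 0 t s * powker (- \<alpha>) 0 s x * deriv \<phi> x" for x s
  have inner: "has_bochner_integral lborel (\<lambda>s. powker (\<alpha> - 1) 0 t s * powker (- \<alpha>) 0 s x)
      (G * indicator {0..<t} x)" for x
  proof (cases "0 \<le> x \<and> x < t")
    case True
    then show ?thesis using has_bochner_integral_powker_Beta[of \<alpha> x t] \<alpha> \<alpha>1 by (simp add: G_def)
  next
    case False
    then have "(\<lambda>s. powker (\<alpha> - 1) 0 t s * powker (- \<alpha>) 0 s x) = (\<lambda>_. 0)" by (auto simp: powker_def fun_eq_iff)
    then show ?thesis using False by (simp add: has_bochner_integral_zero)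
  qed
  have f_int: "has_bochner_integral lborel (f x) (G * indicator {0..<t} x * deriv \<phi> x)" for x
    unfolding f_def by (intro has_bochner_integral_mult_left inner)
  have f_norm_int: "has_bochner_integral lborel (\<lambda>s. norm (f x s)) (G * indicator {0..<t} x * \<bar>deriv \<phi> x\<bar>)" for x
  proof -
    have "norm (f x s) = powker (\<alpha> - 1) 0 t s * powker (- \<alpha>) 0 s x * \<bar>deriv \<phi> x\<bar>" for s
      by (simp add: f_def abs_mult powker_nonneg)
    then show ?thesis by (simp only:) (intro has_bochner_integral_mult_left inner)
  qed
  obtain B where B: "\<And>x. \<bar>deriv \<phi> x\<bar> \<le> B" using test_fun_bounded[OF test_fun_deriv[OF \<phi>]] by blast
  \<comment> \<open>Both kernels are nonnegative, so the inner integral of the absolute value is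
    again the Beta constant, times the bounded function \<bar>\<phi>'\<bar> on a bounded
    interval.\<close>
  have int_pair: "integrable (lborel \<Otimes>\<^sub>M lborel) (case_prod f)"
  proof (rule lborel_pair.Fubini_integrable)
    show "case_prod f \<in> borel_measurable (lborel \<Otimes>\<^sub>M lborel)"
      unfolding f_def by measurable
    have "integrable lborel (\<lambda>x. G * indicator {0..<t} x * \<bar>deriv \<phi> x\<bar>)"
    proof (rule Bochner_Integration.integrable_bound)
      show "integrable lborel (\<lambda>x. G * B * indicator {0..<t} x :: real)"
        using t by (intro integrable_mult_right integrable_real_indicator) simp_all
      show "AE x in lborel. norm (G * indicator {0..<t} x * \<bar>deriv \<phi> x\<bar>) \<le> norm (G * B * indicator {0..<t} x :: real)"
        using B G by (auto simp: indicator_def abs_mult intro!: mult_left_mono order_trans[OF B abs_ge_self])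
    qed measurable
    then show "integrable lborel (\<lambda>x. \<integral>s. norm (case_prod f (x, s)) \<partial>lborel)"
      by (simp only: split_conv has_bochner_integral_integral_eq[OF f_norm_int])
    show "AE x in lborel. integrable lborel (\<lambda>s. case_prod f (x, s))"
      using f_int by (auto simp: has_bochner_integral_iff)
  qed
  have "(\<integral>s. powker (\<alpha> - 1) 0 t s * frac_left_deriv \<alpha> \<phi> s \<partial>lborel)
    = (\<integral>s. (1 / Gamma (1 - \<alpha>)) * (\<integral>x. f x s \<partial>lborel) \<partial>lborel)"
    unfolding f_def frac_left_deriv_test_fun[OF \<phi> \<alpha>(1) \<alpha>1]
    by (simp add: mult.assoc)
  also have "\<dots> = (1 / Gamma (1 - \<alpha>)) * (\<integral>s. (\<integral>x. f x s \<partial>lborel) \<partial>lborel)"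
    by simp
  also have "(\<integral>s. (\<integral>x. f x s \<partial>lborel) \<partial>lborel) = (\<integral>x. (\<integral>s. f x s \<partial>lborel) \<partial>lborel)"
    by (rule lborel_pair.Fubini_integral[OF int_pair])
  also have "\<dots> = (\<integral>x. G * (deriv \<phi> x * indicator {0..<t} x) \<partial>lborel)"
    by (simp only: has_bochner_integral_integral_eq[OF f_int] mult_ac)
  also have "\<dots> = G * (\<integral>x. deriv \<phi> x * indicator {0..<t} x \<partial>lborel)" by simp
  also have "(\<integral>x. deriv \<phi> x * indicator {0..<t} x \<partial>lborel) = (\<integral>x. deriv \<phi> x * indicator {0..t} x \<partial>lborel)"
  proof (intro integral_cong_AE)
    have "AE s in lborel. s \<noteq> t" by (rule AE_lborel_singleton)
    then show "AE s in lborel. deriv \<phi> s * indicator {0..<t} s = deriv \<phi> s * indicator {0..t} s"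
      by eventually_elim (auto simp: indicator_def)
  qed measurable
  also have "1 / Gamma (1 - \<alpha>) * (G * (\<integral>x. deriv \<phi> x * indicator {0..t} x \<partial>lborel)) = Gamma \<alpha> * \<phi> t"
  proof -
    have "Gamma (1 - \<alpha>) \<noteq> 0" using Gamma_real_pos[of "1 - \<alpha>"] \<alpha>1 by linarith
    then show ?thesis
      using integral_deriv_test_fun[OF \<phi> t] by (simp add: G_def)
  qed
  finally have "(\<integral>s. powker (\<alpha> - 1) 0 t s * frac_left_deriv \<alpha> \<phi> s \<partial>lborel) = Gamma \<alpha> * \<phi> t" .
  then show ?thesis using Gamma_real_pos[OF \<alpha>(1)] by (simp add: Ifrac_def)
qed

section \<open>The space \<open>E\<^sub>0\<close>\<close>

lemma tendsto_0_squeeze: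
  fixes f g :: "nat \<Rightarrow> real"
  assumes "\<And>n. 0 \<le> f n" "\<And>n. f n \<le> g n" "g \<longlonglongrightarrow> 0"
  shows "f \<longlonglongrightarrow> 0"
  by (rule tendsto_sandwich[OF _ _ tendsto_const assms(3)]) (simp_all add: assms(1,2))

lemma Lp_fun_bounded:
  assumes "finite_measure M" "p \<ge> 0" "w \<in> borel_measurable M" "\<And>x. x \<in> space M \<Longrightarrow> \<bar>w x\<bar> \<le> B"
  shows "Lp_fun p M w"
proof -
  interpret finite_measure M by fact
  have "AE x in M. norm (\<bar>w x\<bar> powr p) \<le> \<bar>B\<bar> powr p"
  proof (rule AE_I2)
    fix x assume "x \<in> space M"
    then have "\<bar>w x\<bar> \<le> \<bar>B\<bar>" using assms(4)[of x] by linarith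
    then show "norm (\<bar>w x\<bar> powr p) \<le> \<bar>B\<bar> powr p" using assms(2) by (simp add: powr_mono2)
  qed
  moreover have "(\<lambda>x. \<bar>w x\<bar> powr p) \<in> borel_measurable M" using assms(3) by measurable
  ultimately show ?thesis unfolding Lp_fun_def by (simp add: assms(3) integrable_const_bound)
qed

lemma continuous_on_bounded_Icc:
  fixes y :: "real \<Rightarrow> real"
  assumes "continuous_on {c..d} y"
  obtains B where "B > 0" "\<And>t. t \<in> {c..d} \<Longrightarrow> \<bar>y t\<bar> \<le> B"
proof -
  have "compact (y ` {c..d})" by (intro compact_continuous_image assms compact_Icc)
  then obtain B where "B > 0" "\<And>z. z \<in> y ` {c..d} \<Longrightarrow> norm z \<le> B"
    using compact_imp_bounded bounded_pos by metis
  then show ?thesis using that by force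
qed

context frac_exponents
begin

abbreviation "M \<equiv> MT T"
abbreviation "mass \<equiv> Lp_mass p M"

lemma p_pos: "p > 0" "p \<ge> 0" using p by auto

text \<open>Elements of the space are represented by their fractional derivative \<open>w\<close> alone: membership is
  \<open>W w\<close>, and \<open>U w\<close> is the continuous function it determines.\<close>

definition U :: "(real \<Rightarrow> real) \<Rightarrow> real \<Rightarrow> real" where
  "U w t = (if t \<in> {0..T} then Ifrac \<alpha> w t else 0)"

definition W :: "(real \<Rightarrow> real) \<Rightarrow> bool" where
  "W w \<longleftrightarrow> w \<in> borel_measurable borel \<and> Lp_fun p M w \<and>
    (\<exists>\<phi>. (\<forall>n. test_fun T (\<phi> n)) \<and> (\<lambda>n. mass (\<lambda>t. frac_left_deriv \<alpha> (\<phi> n) t - w t)) \<longlonglongrightarrow> 0)"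

lemma W_Lp: "W w \<Longrightarrow> Lp_fun p M w" by (simp add: W_def)

lemma U_continuous_on: "Lp_fun p M w \<Longrightarrow> continuous_on {0..T} (U w)"
  using Ifrac_continuous_on[of w] by (rule continuous_on_cong[THEN iffD1, rotated -1]) (auto simp: U_def)

lemma U_borel_measurable: "Lp_fun p M w \<Longrightarrow> U w \<in> borel_measurable borel"
proof -
  assume "Lp_fun p M w"
  then have "(\<lambda>t. indicator {0..T} t *\<^sub>R Ifrac \<alpha> w t) \<in> borel_measurable borel"
    using borel_measurable_continuous_on_indicator[OF _ Ifrac_continuous_on] by auto
  moreover have "U w = (\<lambda>t. indicator {0..T} t *\<^sub>R Ifrac \<alpha> w t)"
    by (auto simp: U_def fun_eq_iff indicator_def)
  ultimately show ?thesis by simp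
qed

lemma U_sup:
  assumes "Lp_fun p M w"
  shows "\<bar>U w t\<bar> \<le> KS * mass w powr (1 / p)"
  using Ifrac_sup[OF assms, of t] KS_nonneg by (auto simp: U_def)

lemma U_Hoelder:
  assumes "Lp_fun p M w" "t \<in> {0..T}" "t' \<in> {0..T}"
  shows "\<bar>U w t' - U w t\<bar> \<le> KH * mass w powr (1 / p) * \<bar>t' - t\<bar> powr \<sigma>"
  using Ifrac_Hoelder[OF assms] assms(2,3) by (simp add: U_def)

lemma U_lincomb:
  assumes "Lp_fun p M w" "Lp_fun p M v"
  shows "U (\<lambda>s. c * w s + d * v s) = (\<lambda>t. c * U w t + d * U v t)"
  using Ifrac_lincomb[OF assms] by (auto simp: U_def)

lemma U_scale:
  assumes "Lp_fun p M w"
  shows "U (\<lambda>s. c * w s) = (\<lambda>t. c * U w t)"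
  using U_lincomb[OF assms assms, of c 0] by simp

lemma U_diff:
  assumes "Lp_fun p M w" "Lp_fun p M v"
  shows "U w t - U v t = U (\<lambda>s. w s - v s) t"
  using U_lincomb[OF assms, of 1 "-1"] by (simp add: fun_eq_iff)

lemma U_diff_le:
  assumes "Lp_fun p M w" "Lp_fun p M v"
  shows "\<bar>U w t - U v t\<bar> \<le> KS * mass (\<lambda>s. w s - v s) powr (1 / p)"
  unfolding U_diff[OF assms] by (rule U_sup[OF Lp_fun_diff[OF p_pos(2) assms]])

lemma Lp_fun_frac_left_deriv:
  assumes "test_fun T \<phi>"
  shows "Lp_fun p M (frac_left_deriv \<alpha> \<phi>)"
proof -
  have c: "continuous_on S (frac_left_deriv \<alpha> \<phi>)" for S
    by (rule continuous_on_frac_left_deriv_test_fun[OF assms \<alpha>_pos \<alpha>(2)])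
  obtain B where "\<And>t. t \<in> {0..T} \<Longrightarrow> \<bar>frac_left_deriv \<alpha> \<phi> t\<bar> \<le> B"
    using continuous_on_bounded_Icc[OF c] by blast
  then show ?thesis
    using p_pos by (intro Lp_fun_bounded[OF finite_measure_MT] continuous_on_borel_measurable_MT c) auto
qed

lemma U_frac_left_deriv:
  assumes "test_fun T \<phi>" "t \<in> {0..T}"
  shows "U (frac_left_deriv \<alpha> \<phi>) t = \<phi> t"
  using Ifrac_frac_left_deriv[OF assms(1) \<alpha>_pos \<alpha>(2), of t] assms(2) by (simp add: U_def)

lemma W_frac_left_deriv:
  assumes "test_fun T \<phi>"
  shows "W (frac_left_deriv \<alpha> \<phi>)"
  unfolding W_def
proof (intro conjI exI[of _ "\<lambda>_. \<phi>"] allI assms Lp_fun_frac_left_deriv)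
  show "frac_left_deriv \<alpha> \<phi> \<in> borel_measurable borel"
    by (intro borel_measurable_continuous_onI continuous_on_frac_left_deriv_test_fun[OF assms \<alpha>_pos \<alpha>(2)])
qed (simp add: Lp_mass_def)

lemma mass_bounded_le:
  assumes "w \<in> borel_measurable M" "\<And>t. t \<in> {0..T} \<Longrightarrow> \<bar>w t\<bar> \<le> B" "B \<ge> 0"
  shows "mass w \<le> B powr p * T"
proof -
  interpret finite_measure M by (rule finite_measure_MT)
  have "mass w \<le> (\<integral>t. B powr p \<partial>M)"
    unfolding Lp_mass_def
    using assms p_pos Lp_fun_integrable[OF Lp_fun_bounded[OF finite_measure_MT, of p w T B]]
    by (intro integral_mono) (auto intro: powr_mono2)
  also have "\<dots> = B powr p * T"
    using T by (simp add: measure_restrict_space)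
  finally show ?thesis .
qed

lemma mass_root_tendsto_0:
  assumes "(\<lambda>n. mass (v n)) \<longlonglongrightarrow> 0"
  shows "(\<lambda>n. KS * mass (v n) powr (1 / p)) \<longlonglongrightarrow> 0"
proof -
  have "(\<lambda>n. mass (v n) powr (1 / p)) \<longlonglongrightarrow> 0 powr (1 / p)"
    by (rule tendsto_powr'[OF assms tendsto_const]) (simp add: p_pos)
  then show ?thesis by (simp add: tendsto_mult_right_zero)
qed

lemma mass_uniform_tendsto_0:
  assumes e: "e \<longlonglongrightarrow> 0" "\<And>n. e n \<ge> 0"
    and g: "\<And>n. g n \<in> borel_measurable M" "\<And>n t. t \<in> {0..T} \<Longrightarrow> \<bar>g n t\<bar> \<le> e n"
  shows "(\<lambda>n. mass (g n)) \<longlonglongrightarrow> 0"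
proof (rule tendsto_0_squeeze[OF Lp_mass_nonneg])
  have "(\<lambda>n. e n powr p) \<longlonglongrightarrow> 0 powr p"
    by (rule tendsto_powr'[OF e(1) tendsto_const]) (simp add: e(2) p_pos)
  then show "(\<lambda>n. e n powr p * T) \<longlonglongrightarrow> 0"
    by (simp add: tendsto_mult_left_zero)
  show "mass (g n) \<le> e n powr p * T" for n
    by (intro mass_bounded_le g e)
qed

lemma Lp_fun_U:
  assumes "Lp_fun p M w"
  shows "Lp_fun p M (U w)"
  using U_sup[OF assms] p_pos
  by (intro Lp_fun_bounded[OF finite_measure_MT] continuous_on_borel_measurable_MT U_continuous_on assms) auto

lemma mass_test_fun_minus_U_tendsto:
  assumes w: "Lp_fun p M w" and \<phi>: "\<And>n. test_fun T (\<phi> n)"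
    and lim: "(\<lambda>n. mass (\<lambda>t. frac_left_deriv \<alpha> (\<phi> n) t - w t)) \<longlonglongrightarrow> 0"
  shows "(\<lambda>n. mass (\<lambda>t. \<phi> n t - U w t)) \<longlonglongrightarrow> 0"
proof (rule mass_uniform_tendsto_0[OF mass_root_tendsto_0[OF lim]])
  show "0 \<le> KS * mass (\<lambda>t. frac_left_deriv \<alpha> (\<phi> n) t - w t) powr (1 / p)" for n
    using KS_nonneg by simp
  show "(\<lambda>t. \<phi> n t - U w t) \<in> borel_measurable M" for n
    by (intro continuous_on_borel_measurable_MT continuous_on_diff test_fun_continuous_on[OF \<phi>] U_continuous_on w)
  show "\<bar>\<phi> n t - U w t\<bar> \<le> KS * mass (\<lambda>t. frac_left_deriv \<alpha> (\<phi> n) t - w t) powr (1 / p)"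
    if "t \<in> {0..T}" for n t
    using U_diff_le[OF Lp_fun_frac_left_deriv[OF \<phi>] w, of n t] U_frac_left_deriv[OF \<phi> that] by simp
qed

text \<open>The approximating test functions are the fractional integrals of their own derivatives,
  so they converge uniformly to \<open>U w\<close>; they also converge to u in mass. Hence u is
  determined by w almost everywhere.\<close>

lemma in_E_imp:
  assumes "in_E T \<alpha> p u w"
  shows "W w" "u \<in> borel_measurable M" "AE t in M. u t = U w t"
proof -
  have [measurable]: "u \<in> borel_measurable borel" "w \<in> borel_measurable borel"
    using assms by (auto simp: in_E_def)
  show u: "u \<in> borel_measurable M" by (rule borel_measurable_MT) measurable
  have w': "w \<in> borel_measurable M" by (rule borel_measurable_MT) measurable
  have uL: "Lp_fun p M u" and wL: "Lp_fun p M w"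
    using assms u w' by (auto simp: in_E_def set_integrable_eq_MT Lp_fun_def)
  obtain \<phi> where \<phi>: "\<And>n. test_fun T (\<phi> n)"
    and lim1: "(\<lambda>n. mass (\<lambda>t. \<phi> n t - u t)) \<longlonglongrightarrow> 0"
    and lim2: "(\<lambda>n. mass (\<lambda>t. frac_left_deriv \<alpha> (\<phi> n) t - w t)) \<longlonglongrightarrow> 0"
    using assms by (auto simp: in_E_def set_integral_eq_MT Lp_mass_def)
  show "W w" using wL \<phi> lim2 by (auto simp: W_def)
  note UL = Lp_fun_U[OF wL]
  have \<phi>L: "Lp_fun p M (\<phi> n)" for n
  proof -
    obtain B where "\<And>x. \<bar>\<phi> n x\<bar> \<le> B" using test_fun_bounded[OF \<phi>] by blast
    then show ?thesis
      using p_pos by (intro Lp_fun_bounded[OF finite_measure_MT] continuous_on_borel_measurable_MT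
          test_fun_continuous_on[OF \<phi>]) auto
  qed
  note lim3 = mass_test_fun_minus_U_tendsto[OF wL \<phi> lim2]
  have le: "mass (\<lambda>t. u t - U w t) \<le> 2 powr p * (mass (\<lambda>t. \<phi> n t - u t) + mass (\<lambda>t. \<phi> n t - U w t))" for n
    unfolding Lp_mass_diff_commute[of p M "\<phi> n" u] by (rule Lp_mass_triangle[OF p_pos(2) uL \<phi>L UL])
  have "(\<lambda>n. 2 powr p * (mass (\<lambda>t. \<phi> n t - u t) + mass (\<lambda>t. \<phi> n t - U w t))) \<longlonglongrightarrow> 2 powr p * (0 + 0)"
    by (intro tendsto_mult tendsto_add tendsto_const lim1 lim3)
  then have "(\<lambda>n. 2 powr p * (mass (\<lambda>t. \<phi> n t - u t) + mass (\<lambda>t. \<phi> n t - U w t))) \<longlonglongrightarrow> 0"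
    by simp
  then have "(\<lambda>n. mass (\<lambda>t. u t - U w t)) \<longlonglongrightarrow> 0"
    by (rule tendsto_0_squeeze[OF Lp_mass_nonneg le])
  then have "mass (\<lambda>t. u t - U w t) = 0" by (simp add: LIMSEQ_const_iff)
  then show "AE t in M. u t = U w t"
    using Lp_mass_eq_0_AE[OF Lp_fun_diff[OF p_pos(2) uL UL]] by simp
qed

lemma in_E_U:
  assumes "W w"
  shows "in_E T \<alpha> p (U w) w"
proof -
  have wL: "Lp_fun p M w" by (rule W_Lp[OF assms])
  note UL = Lp_fun_U[OF wL]
  obtain \<phi> where \<phi>: "\<And>n. test_fun T (\<phi> n)"
    and lim2: "(\<lambda>n. mass (\<lambda>t. frac_left_deriv \<alpha> (\<phi> n) t - w t)) \<longlonglongrightarrow> 0"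
    using assms by (auto simp: W_def)
  note lim3 = mass_test_fun_minus_U_tendsto[OF wL \<phi> lim2]
  show ?thesis
    unfolding in_E_def set_integrable_eq_MT set_integral_eq_MT
    using assms U_borel_measurable[OF wL] UL wL \<phi> lim2 lim3
    by (auto simp: W_def Lp_fun_def Lp_mass_def intro!: exI[of _ \<phi>])
qed

lemma W_lincomb:
  assumes "W w" "W v"
  shows "W (\<lambda>t. c * w t + d * v t)"
proof -
  note L = W_Lp[OF assms(1)] W_Lp[OF assms(2)]
  obtain \<phi> where \<phi>: "\<And>n. test_fun T (\<phi> n)" "(\<lambda>n. mass (\<lambda>t. frac_left_deriv \<alpha> (\<phi> n) t - w t)) \<longlonglongrightarrow> 0"
    using assms(1) by (auto simp: W_def)
  obtain \<psi> where \<psi>: "\<And>n. test_fun T (\<psi> n)" "(\<lambda>n. mass (\<lambda>t. frac_left_deriv \<alpha> (\<psi> n) t - v t)) \<longlonglongrightarrow> 0"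
    using assms(2) by (auto simp: W_def)
  define \<eta> where "\<eta> n x = c * \<phi> n x + d * \<psi> n x" for n x
  have \<eta>: "test_fun T (\<eta> n)" for n unfolding \<eta>_def by (rule test_fun_lincomb[OF \<phi>(1) \<psi>(1)])
  define D1 where "D1 n t = frac_left_deriv \<alpha> (\<phi> n) t - w t" for n t
  define D2 where "D2 n t = frac_left_deriv \<alpha> (\<psi> n) t - v t" for n t
  have D: "Lp_fun p M (D1 n)" "Lp_fun p M (D2 n)" for n
    unfolding D1_def D2_def by (intro Lp_fun_diff p_pos Lp_fun_frac_left_deriv \<phi> \<psi> L)+
  have eq: "frac_left_deriv \<alpha> (\<eta> n) t - (c * w t + d * v t) = c * D1 n t + d * D2 n t" if "t \<in> {0..T}" for n t
    using that unfolding \<eta>_def D1_def D2_def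
    by (subst frac_left_deriv_lincomb[OF \<phi>(1) \<psi>(1) \<alpha>_pos \<alpha>(2)]) (auto simp: algebra_simps)
  have "mass (\<lambda>t. frac_left_deriv \<alpha> (\<eta> n) t - (c * w t + d * v t)) = mass (\<lambda>t. c * D1 n t + d * D2 n t)" for n
    unfolding Lp_mass_def by (intro Bochner_Integration.integral_cong) (auto simp: eq)
  also have "\<dots> n \<le> 2 powr p * (\<bar>c\<bar> powr p * mass (D1 n) + \<bar>d\<bar> powr p * mass (D2 n))" for n
    using Lp_mass_add_le[OF p_pos(2) Lp_fun_scale[OF D(1)] Lp_fun_scale[OF D(2)], of c n d n]
    by (simp add: Lp_mass_scale)
  finally have le: "mass (\<lambda>t. frac_left_deriv \<alpha> (\<eta> n) t - (c * w t + d * v t))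
      \<le> 2 powr p * (\<bar>c\<bar> powr p * mass (D1 n) + \<bar>d\<bar> powr p * mass (D2 n))" for n .
  have "(\<lambda>n. 2 powr p * (\<bar>c\<bar> powr p * mass (D1 n) + \<bar>d\<bar> powr p * mass (D2 n)))
      \<longlonglongrightarrow> 2 powr p * (\<bar>c\<bar> powr p * 0 + \<bar>d\<bar> powr p * 0)"
    unfolding D1_def D2_def by (intro tendsto_mult tendsto_add tendsto_const \<phi> \<psi>)
  then have "(\<lambda>n. 2 powr p * (\<bar>c\<bar> powr p * mass (D1 n) + \<bar>d\<bar> powr p * mass (D2 n))) \<longlonglongrightarrow> 0"
    by simp
  then have "(\<lambda>n. mass (\<lambda>t. frac_left_deriv \<alpha> (\<eta> n) t - (c * w t + d * v t))) \<longlonglongrightarrow> 0"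
    by (rule tendsto_0_squeeze[OF Lp_mass_nonneg le])
  moreover have "Lp_fun p M (\<lambda>t. c * w t + d * v t)"
    by (intro Lp_fun_add Lp_fun_scale p_pos L)
  moreover have "(\<lambda>t. c * w t + d * v t) \<in> borel_measurable borel"
    using assms by (auto simp: W_def)
  ultimately show ?thesis using \<eta> by (auto simp: W_def)
qed

lemma W_scale: "W w \<Longrightarrow> W (\<lambda>t. c * w t)"
  using W_lincomb[of w w c 0] by simp

text \<open>That the limit stays in the closure is a diagonal argument: the n-th member of the
  sequence is replaced by a test function whose derivative is within 1 / (n + 1) of it in
  mass.\<close>

lemma W_complete:
  assumes wn: "\<And>n. W (wn n)"
    and cauchy: "\<And>e. e > 0 \<Longrightarrow> \<exists>K. \<forall>m\<ge>K. \<forall>n\<ge>K. mass (\<lambda>x. wn m x - wn n x) < e"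
  obtains w where "W w" "(\<lambda>n. mass (\<lambda>t. wn n t - w t)) \<longlonglongrightarrow> 0"
proof -
  obtain v where v: "Lp_fun p M v" "(\<lambda>n. mass (\<lambda>t. wn n t - v t)) \<longlonglongrightarrow> 0"
    using Lp_complete[OF p_pos(1) W_Lp[OF wn] cauchy] by blast
  \<comment> \<open>The limit is measurable only with respect to [0, T], whereas \<open>W\<close>
    demands a Borel function on the line; the cut-off extends it by 0.\<close>
  define w where "w t = indicator {0..T} t *\<^sub>R v t" for t
  have w_eq: "w t = v t" if "t \<in> {0..T}" for t using that by (simp add: w_def)
  have mass_eq: "mass (\<lambda>t. g t - w t) = mass (\<lambda>t. g t - v t)" for g
    unfolding Lp_mass_def by (intro Bochner_Integration.integral_cong) (auto simp: w_eq)
  have w_borel: "w \<in> borel_measurable borel"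
    using Lp_fun_measurable[OF v(1)] borel_measurable_restrict_space_iff[of "{0..T}" lborel v]
    unfolding w_def by (simp add: mult.commute)
  have wL: "Lp_fun p M w"
    unfolding Lp_fun_def
  proof
    show "w \<in> borel_measurable M" by (rule borel_measurable_MT[OF w_borel])
    show "integrable M (\<lambda>x. \<bar>w x\<bar> powr p)"
      using Lp_fun_integrable[OF v(1)]
      by (rule Bochner_Integration.integrable_cong[THEN iffD1, rotated -1]) (auto simp: w_eq)
  qed
  have "\<exists>\<phi>. test_fun T \<phi> \<and> mass (\<lambda>t. frac_left_deriv \<alpha> \<phi> t - wn n t) < 1 / real (Suc n)" for n
  proof -
    obtain \<psi> where "\<And>k. test_fun T (\<psi> k)" and l: "(\<lambda>k. mass (\<lambda>t. frac_left_deriv \<alpha> (\<psi> k) t - wn n t)) \<longlonglongrightarrow> 0"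
      using wn[of n] by (auto simp: W_def)
    moreover have "\<forall>\<^sub>F k in sequentially. mass (\<lambda>t. frac_left_deriv \<alpha> (\<psi> k) t - wn n t) < 1 / real (Suc n)"
      by (rule order_tendstoD(2)[OF l]) simp
    ultimately show ?thesis by (meson eventually_sequentially order_refl)
  qed
  then obtain \<phi> where \<phi>: "\<And>n. test_fun T (\<phi> n)"
    "\<And>n. mass (\<lambda>t. frac_left_deriv \<alpha> (\<phi> n) t - wn n t) < 1 / real (Suc n)" by metis
  have lim: "(\<lambda>n. mass (\<lambda>t. wn n t - w t)) \<longlonglongrightarrow> 0" using v(2) by (simp add: mass_eq)
  have "(\<lambda>n. mass (\<lambda>t. frac_left_deriv \<alpha> (\<phi> n) t - w t)) \<longlonglongrightarrow> 0"
  proof (rule tendsto_0_squeeze[OF Lp_mass_nonneg])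
    have "(\<lambda>n. 2 powr p * (1 / real (Suc n) + mass (\<lambda>t. wn n t - w t))) \<longlonglongrightarrow> 2 powr p * (0 + 0)"
      by (intro tendsto_mult tendsto_add tendsto_const lim LIMSEQ_Suc[OF lim_1_over_n])
    then show "(\<lambda>n. 2 powr p * (1 / real (Suc n) + mass (\<lambda>t. wn n t - w t))) \<longlonglongrightarrow> 0" by simp
    show "mass (\<lambda>t. frac_left_deriv \<alpha> (\<phi> n) t - w t) \<le> 2 powr p * (1 / real (Suc n) + mass (\<lambda>t. wn n t - w t))" for n
    proof -
      have "mass (\<lambda>t. frac_left_deriv \<alpha> (\<phi> n) t - w t)
        \<le> 2 powr p * (mass (\<lambda>t. frac_left_deriv \<alpha> (\<phi> n) t - wn n t) + mass (\<lambda>t. wn n t - w t))"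
        by (rule Lp_mass_triangle[OF p_pos(2) Lp_fun_frac_left_deriv[OF \<phi>(1)] W_Lp[OF wn] wL])
      also have "\<dots> \<le> 2 powr p * (1 / real (Suc n) + mass (\<lambda>t. wn n t - w t))"
        using \<phi>(2)[of n] by (intro mult_left_mono add_right_mono) auto
      finally show ?thesis .
    qed
  qed
  then have "W w" using w_borel wL \<phi>(1) by (auto simp: W_def)
  then show ?thesis using lim that by blast
qed

lemma W_nontrivial: obtains w t where "W w" "t \<in> {0..T}" "U w t \<noteq> 0"
proof -
  obtain \<phi> where \<phi>: "test_fun T \<phi>" "\<phi> (T / 2) > 0" using test_fun_exists[OF T] by blast
  moreover have "T / 2 \<in> {0..T}" using T by simp
  ultimately show ?thesis
    using that[OF W_frac_left_deriv[OF \<phi>(1)], of "T / 2"] U_frac_left_deriv[OF \<phi>(1)] by simp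
qed

text \<open>Bounded masses give a common sup bound and a common Hoelder constant, which is what the
  Arzela-Ascoli theorem requires.\<close>

lemma U_compact:
  assumes wn: "\<And>n. Lp_fun p M (wn n)" and B: "\<And>n. mass (wn n) \<le> B"
  obtains u k where "continuous_on {0..T} u" "strict_mono (k :: nat \<Rightarrow> nat)"
    "\<forall>e>0. \<exists>N. \<forall>n\<ge>N. \<forall>t\<in>{0..T}. \<bar>U (wn (k n)) t - u t\<bar> < e"
proof -
  have root: "mass (wn n) powr (1 / p) \<le> B powr (1 / p)" for n
    using B p_pos by (intro powr_mono2) auto
  have bnd: "norm (U (wn n) t) \<le> KS * B powr (1 / p)" for n t
    using U_sup[OF wn, of n t] mult_left_mono[OF root KS_nonneg] by (auto intro: order_trans)
  \<comment> \<open>The added 1 allows division by \<open>A\<close> in the choice of d, which solves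
    A d^\<sigma> = e.\<close>
  define A where "A = KH * B powr (1 / p) + 1"
  have A: "A > 0" using KH_nonneg by (simp add: A_def add_nonneg_pos)
  have hoelder: "\<bar>U (wn n) t' - U (wn n) t\<bar> \<le> A * \<bar>t' - t\<bar> powr \<sigma>" if "t \<in> {0..T}" "t' \<in> {0..T}" for n t t'
  proof -
    have "KH * mass (wn n) powr (1 / p) \<le> A"
      using mult_left_mono[OF root KH_nonneg, of n] by (simp add: A_def)
    then show ?thesis using U_Hoelder[OF wn that, of n] by (meson mult_right_mono order_trans powr_ge_zero)
  qed
  have equi: "\<exists>d. 0 < d \<and> (\<forall>n y. y \<in> {0..T} \<and> norm (x - y) < d \<longrightarrow> norm (U (wn n) x - U (wn n) y) < e)"
    if "x \<in> {0..T}" "0 < e" for x e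
  proof -
    define d where "d = (e / A) powr (1 / \<sigma>)"
    have "d > 0" using that A by (simp add: d_def)
    moreover have "norm (U (wn n) x - U (wn n) y) < e" if y: "y \<in> {0..T}" "norm (x - y) < d" for n y
    proof -
      have "\<bar>x - y\<bar> powr \<sigma> < d powr \<sigma>" using y(2) \<sigma>_pos by (intro powr_less_mono2) auto
      also have "d powr \<sigma> = e / A" using \<sigma>_pos A \<open>0 < e\<close> by (simp add: d_def powr_powr)
      finally have "A * \<bar>x - y\<bar> powr \<sigma> < e" using A by (simp add: field_simps)
      then show ?thesis using hoelder[OF y(1) \<open>x \<in> {0..T}\<close>, of n] by simp
    qed
    ultimately show ?thesis by blast
  qed
  obtain u k where "continuous_on {0..T} u" "strict_mono (k :: nat \<Rightarrow> nat)"
    "\<And>e. 0 < e \<Longrightarrow> \<exists>N. \<forall>n x. n \<ge> N \<and> x \<in> {0..T} \<longrightarrow> norm (U (wn (k n)) x - u x) < e"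
    using Arzela_Ascoli[of "{0..T}" "\<lambda>n. U (wn n)", OF compact_Icc bnd equi] by blast
  then show ?thesis using that[of u k] by (metis real_norm_def)
qed

end

section \<open>The nonlinearity\<close>

text \<open>The common core of the two fibering estimates, where \<open>D\<close> compares a
  function of r with its tangent at r = 1.\<close>

lemma DERIV_sign_change_minimum:
  fixes D D' :: "real \<Rightarrow> real"
  assumes D: "\<And>r. r > 0 \<Longrightarrow> (D has_real_derivative D' r) (at r)"
    and pos: "\<And>r. r \<ge> c \<Longrightarrow> D' r \<ge> 0" and neg: "\<And>r. 0 < r \<Longrightarrow> r \<le> c \<Longrightarrow> D' r \<le> 0"
    and "c > 0" "r > 0"
  shows "D c \<le> D r"
proof (cases "c \<le> r")
  case True
  then show ?thesis
  proof (rule DERIV_nonneg_imp_nondecreasing)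
    fix x assume "c \<le> x" "x \<le> r"
    then show "\<exists>y. (D has_real_derivative y) (at x) \<and> 0 \<le> y"
      using D[of x] pos[of x] \<open>c > 0\<close> by (intro exI[of _ "D' x"]) simp
  qed
next
  case False
  then have "r \<le> c" by simp
  then show ?thesis
  proof (rule DERIV_nonpos_imp_nonincreasing)
    fix x assume "r \<le> x" "x \<le> c"
    then show "\<exists>y. (D has_real_derivative y) (at x) \<and> y \<le> 0"
      using D[of x] neg[of x] \<open>r > 0\<close> by (intro exI[of _ "D' x"]) simp
  qed
qed

locale kirchhoff = frac_exponents +
  fixes a b :: real and f :: "real \<Rightarrow> real \<Rightarrow> real"
  assumes a: "a > 0" and b: "b > 0"
    and f_cont: "continuous_on ({0..T} \<times> UNIV) (\<lambda>(t, x). f t x)"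
    and f_mono: "\<And>t. t \<in> {0..T} \<Longrightarrow> strict_mono_on (- {0}) (\<lambda>x. f t x / \<bar>x\<bar> powr (p^2 - 1))"
    and f_small: "\<And>e. e > 0 \<Longrightarrow> \<exists>d>0. \<forall>t\<in>{0..T}. \<forall>x. 0 < \<bar>x\<bar> \<and> \<bar>x\<bar> < d \<longrightarrow>
        \<bar>f t x\<bar> \<le> e * \<bar>x\<bar> powr (p - 1)"
    and f_AR: "\<exists>\<mu> R. \<mu> > p^2 \<and> R > 0 \<and> (\<forall>t\<in>{0..T}. \<forall>x. \<bar>x\<bar> \<ge> R \<longrightarrow>
        0 < \<mu> * Fprim f t x \<and> \<mu> * Fprim f t x \<le> x * f t x)"
begin

text \<open>The constants of (iii) are fixed by choice, first \<mu> and then an R that suits it, so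
  that later bounds can name them.\<close>

definition "\<mu> = (SOME \<mu>. \<exists>R. \<mu> > p^2 \<and> R > 0 \<and> (\<forall>t\<in>{0..T}. \<forall>x. \<bar>x\<bar> \<ge> R \<longrightarrow>
        0 < \<mu> * Fprim f t x \<and> \<mu> * Fprim f t x \<le> x * f t x))"

definition "R = (SOME R. \<mu> > p^2 \<and> R > 0 \<and> (\<forall>t\<in>{0..T}. \<forall>x. \<bar>x\<bar> \<ge> R \<longrightarrow>
        0 < \<mu> * Fprim f t x \<and> \<mu> * Fprim f t x \<le> x * f t x))"

lemma pp: "p^2 > 1" "p^2 > p" "p^2 > 0"
  using p less_1_mult[OF p p] mult_strict_left_mono[of 1 p p] by (simp_all add: power2_eq_square)

lemma AR: "\<mu> > p^2" "R > 0"
    "\<And>t x. t \<in> {0..T} \<Longrightarrow> \<bar>x\<bar> \<ge> R \<Longrightarrow> 0 < \<mu> * Fprim f t x"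
    "\<And>t x. t \<in> {0..T} \<Longrightarrow> \<bar>x\<bar> \<ge> R \<Longrightarrow> \<mu> * Fprim f t x \<le> x * f t x"
  using someI_ex[OF someI_ex[OF f_AR, folded \<mu>_def], folded R_def] by blast+

lemma \<mu>_pos: "\<mu> > 0" using AR(1) pp by linarith

lemma f_isCont: "t \<in> {0..T} \<Longrightarrow> continuous_on S (f t)"
proof -
  assume t: "t \<in> {0..T}"
  have "continuous_on S ((\<lambda>(t, x). f t x) \<circ> (\<lambda>x. (t, x)))"
    by (intro continuous_on_compose continuous_on_subset[OF f_cont] continuous_intros) (use t in auto)
  then show ?thesis by (simp add: o_def)
qed

lemma Fprim_deriv:
  assumes t: "t \<in> {0..T}"
  shows "(Fprim f t has_real_derivative f t x) (at x)"
proof -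
  \<comment> \<open>An interval that contains 0 and has x in its interior, so that the derivative
    within it is the full derivative.\<close>
  define A where "A = - \<bar>x\<bar> - 1"
  define B where "B = \<bar>x\<bar> + 1"
  have AB: "A \<le> 0" "0 \<le> B" "A < x" "x < B" by (auto simp: A_def B_def)
  have "((\<lambda>u. LBINT y=ereal 0..ereal u. f t y) has_vector_derivative f t x) (at x within {A..B})"
    using AB by (intro interval_integral_FTC2 f_isCont[OF t]) simp_all
  moreover have "at x within {A..B} = at x"
    by (rule at_within_interior) (use AB in simp)
  ultimately show ?thesis
    by (simp add: has_real_derivative_iff_has_vector_derivative Fprim_def[abs_def] zero_ereal_def)
qed

lemma Fprim_0: "Fprim f t 0 = 0"
  by (simp add: Fprim_def zero_ereal_def[symmetric])

text \<open>On the fixed interval [0, 1] the variable x occurs only in the integrand; joint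
  continuity of \<open>Fprim\<close> then follows from continuity of parameter integrals.\<close>

lemma Fprim_eq_integral:
  assumes t: "t \<in> {0..T}"
  shows "Fprim f t x = integral {0..1} (\<lambda>s. f t (x * s) * x)"
proof -
  have "((\<lambda>s. f t (x * s) * x) has_integral Fprim f t (x * 1) - Fprim f t (x * 0)) {0..1}"
  proof (rule fundamental_theorem_of_calculus)
    fix s :: real
    have "((\<lambda>s. x * s) has_real_derivative x) (at s)" by (auto intro!: derivative_eq_intros)
    from DERIV_chain2[where f = "Fprim f t", OF Fprim_deriv[OF t] this]
    have "((\<lambda>s. Fprim f t (x * s)) has_real_derivative f t (x * s) * x) (at s)" .
    then show "((\<lambda>s. Fprim f t (x * s)) has_vector_derivative f t (x * s) * x) (at s within {0..1})"
      by (simp add: has_real_derivative_iff_has_vector_derivative has_vector_derivative_at_within)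
  qed simp
  then have "((\<lambda>s. f t (x * s) * x) has_integral Fprim f t x) {0..1}" by (simp add: Fprim_0)
  then show ?thesis by (rule integral_unique[symmetric])
qed

lemma Fprim_cont: "continuous_on ({0..T} \<times> UNIV) (\<lambda>(t, x). Fprim f t x)"
proof -
  have "continuous_on (({0..T} \<times> UNIV) \<times> cbox 0 1)
      (\<lambda>w. (\<lambda>(t, x). f t x) (fst (fst w), snd (fst w) * snd w) * snd (fst w))"
    by (intro continuous_on_mult continuous_on_compose2[OF f_cont] continuous_intros) auto
  then have "continuous_on ({0..T} \<times> UNIV)
      (\<lambda>z. integral (cbox 0 1) (\<lambda>s. f (fst z) (snd z * s) * snd z))"
    by (intro integral_continuous_on_param) (simp add: case_prod_beta)
  then show ?thesis
    by (rule continuous_on_cong[THEN iffD1, rotated -1]) (auto simp: Fprim_eq_integral)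
qed

lemma f_times_cont: "continuous_on ({0..T} \<times> UNIV) (\<lambda>(t, x). f t x * x)"
proof -
  have "continuous_on ({0..T} \<times> UNIV) (\<lambda>z. (\<lambda>(t, x). f t x) z * snd z)"
    by (intro continuous_on_mult f_cont continuous_on_snd continuous_on_id)
  then show ?thesis by (simp add: case_prod_beta)
qed

lemma compact_bound:
  fixes \<psi> :: "real \<Rightarrow> real \<Rightarrow> real"
  assumes "continuous_on ({0..T} \<times> UNIV) (\<lambda>(t, x). \<psi> t x)"
  obtains B where "B > 0" "\<And>t x. t \<in> {0..T} \<Longrightarrow> \<bar>x\<bar> \<le> K \<Longrightarrow> \<bar>\<psi> t x\<bar> \<le> B"
proof -
  have "compact ((\<lambda>(t, x). \<psi> t x) ` ({0..T} \<times> {-K..K}))"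
    by (intro compact_continuous_image continuous_on_subset[OF assms] compact_Times compact_Icc) auto
  then obtain B where B: "B > 0" "\<And>z. z \<in> (\<lambda>(t, x). \<psi> t x) ` ({0..T} \<times> {-K..K}) \<Longrightarrow> norm z \<le> B"
    using compact_imp_bounded bounded_pos by metis
  have "\<bar>\<psi> t x\<bar> \<le> B" if "t \<in> {0..T}" "\<bar>x\<bar> \<le> K" for t x
  proof -
    have "(t, x) \<in> {0..T} \<times> {-K..K}" using that by auto
    then show ?thesis using B(2)[of "\<psi> t x"] by force
  qed
  then show ?thesis using that B(1) by blast
qed

lemma comp_continuous_on:
  fixes \<psi> :: "real \<Rightarrow> real \<Rightarrow> real"
  assumes "continuous_on ({0..T} \<times> UNIV) (\<lambda>(t, x). \<psi> t x)" "continuous_on {0..T} y"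
  shows "continuous_on {0..T} (\<lambda>t. \<psi> t (y t))"
proof -
  have "continuous_on {0..T} (\<lambda>t. (t, y t))" by (intro continuous_on_Pair continuous_on_id assms(2))
  then have "continuous_on {0..T} (\<lambda>t. (\<lambda>(t, x). \<psi> t x) (t, y t))"
    by (rule continuous_on_compose2[OF assms(1)]) auto
  then show ?thesis by simp
qed

lemma comp_measurable:
  fixes \<psi> :: "real \<Rightarrow> real \<Rightarrow> real"
  assumes "continuous_on ({0..T} \<times> UNIV) (\<lambda>(t, x). \<psi> t x)" and y [measurable]: "y \<in> borel_measurable M"
  shows "(\<lambda>t. \<psi> t (y t)) \<in> borel_measurable M"
proof -
  have [measurable]: "(\<lambda>t. t) \<in> borel_measurable M" by (rule borel_measurable_MT) simp
  have "(\<lambda>t. (t, y t)) \<in> measurable M (restrict_space borel ({0..T} \<times> UNIV))"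
  proof (rule measurable_restrict_space2)
    show "(\<lambda>t. (t, y t)) \<in> measurable M borel"
      unfolding borel_prod[symmetric] by measurable
  qed auto
  from measurable_comp[OF this borel_measurable_continuous_on_restrict[OF assms(1)]]
  show ?thesis by (simp add: o_def)
qed

lemma integrable_continuous: "continuous_on {0..T} z \<Longrightarrow> integrable M (z :: real \<Rightarrow> real)"
proof -
  assume z: "continuous_on {0..T} z"
  interpret finite_measure M by (rule finite_measure_MT)
  obtain B where "\<And>t. t \<in> {0..T} \<Longrightarrow> \<bar>z t\<bar> \<le> B" using continuous_on_bounded_Icc[OF z] by blast
  then show ?thesis
    by (intro integrable_const_bound[of z B] continuous_on_borel_measurable_MT z AE_I2) simp
qed

lemma integral_comp_tendsto:
  fixes \<psi> :: "real \<Rightarrow> real \<Rightarrow> real"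
  assumes \<psi>: "continuous_on ({0..T} \<times> UNIV) (\<lambda>(t, x). \<psi> t x)"
    and yk: "\<And>k :: nat. yk k \<in> borel_measurable M" "\<And>k t. t \<in> {0..T} \<Longrightarrow> \<bar>yk k t\<bar> \<le> K"
    and y: "y \<in> borel_measurable M"
    and lim: "\<And>t. t \<in> {0..T} \<Longrightarrow> (\<lambda>k. yk k t) \<longlonglongrightarrow> y t"
  shows "(\<lambda>k. \<integral>t. \<psi> t (yk k t) \<partial>M) \<longlonglongrightarrow> (\<integral>t. \<psi> t (y t) \<partial>M)"
proof -
  interpret finite_measure M by (rule finite_measure_MT)
  obtain B where B: "\<And>t x. t \<in> {0..T} \<Longrightarrow> \<bar>x\<bar> \<le> K \<Longrightarrow> \<bar>\<psi> t x\<bar> \<le> B"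
    using compact_bound[OF \<psi>] by blast
  show ?thesis
  proof (rule integral_dominated_convergence[where w = "\<lambda>_. B"])
    show "(\<lambda>t. \<psi> t (y t)) \<in> borel_measurable M" by (rule comp_measurable[OF \<psi> y])
    show "(\<lambda>t. \<psi> t (yk k t)) \<in> borel_measurable M" for k by (rule comp_measurable[OF \<psi> yk(1)])
    show "AE t in M. norm (\<psi> t (yk k t)) \<le> B" for k
      using B yk(2) by (intro AE_I2) simp
    show "AE t in M. (\<lambda>k. \<psi> t (yk k t)) \<longlonglongrightarrow> \<psi> t (y t)"
    proof (rule AE_I2)
      fix t assume "t \<in> space M"
      then have t: "t \<in> {0..T}" by simp
      have "continuous_on UNIV (\<lambda>x::real. (t, x))" by (intro continuous_on_Pair continuous_on_id continuous_on_const)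
      then have "continuous_on UNIV (\<lambda>x. (\<lambda>(t, x). \<psi> t x) (t, x))"
        by (rule continuous_on_compose2[OF \<psi>]) (use t in auto)
      then have "isCont (\<psi> t) (y t)" by (simp add: continuous_on_eq_continuous_at)
      then show "(\<lambda>k. \<psi> t (yk k t)) \<longlonglongrightarrow> \<psi> t (y t)"
        by (rule isCont_tendsto_compose[OF _ lim[OF t]])
    qed
  qed simp
qed

text \<open>The quotient is the ratio of (i) at z x, times the factor
  \<open>\<bar>x\<bar> powr Q * x\<close>, which does not depend on z. For x < 0 both the order of
  the arguments and the sign of this factor are reversed, so the direction is the same.\<close>

lemma f_ratio_mono:
  assumes t: "t \<in> {0..T}" and s: "0 < s" "s \<le> r"
  shows "f t (s * x) * (s * x) / s powr (p^2) \<le> f t (r * x) * (r * x) / r powr (p^2)"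
proof (cases "x = 0")
  case False
  define Q where "Q = p^2 - 1"
  have r: "r > 0" using s by simp
  have eq: "f t (z * x) * (z * x) / z powr (p^2) = (f t (z * x) / \<bar>z * x\<bar> powr Q) * (\<bar>x\<bar> powr Q * x)" if "z > 0" for z
  proof -
    have 1: "z powr (p^2) = z * z powr Q" using that powr_add[of z 1 Q] by (simp add: Q_def)
    have 2: "\<bar>z * x\<bar> powr Q = z powr Q * \<bar>x\<bar> powr Q" using that by (simp add: abs_mult powr_mult)
    show ?thesis unfolding 1 2 using that False by simp
  qed
  define H where "H z = f t z / \<bar>z\<bar> powr Q" for z
  have H: "H u \<le> H v" if "u \<noteq> 0" "v \<noteq> 0" "u \<le> v" for u v
  proof (cases "u = v")
    case False
    then show ?thesis
      using strict_mono_onD[OF f_mono[OF t], of u v] that by (simp add: H_def Q_def)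
  qed simp
  have "H (s * x) * (\<bar>x\<bar> powr Q * x) \<le> H (r * x) * (\<bar>x\<bar> powr Q * x)"
  proof (cases "x > 0")
    case True
    have "s * x \<le> r * x" using True s by simp
    then have "H (s * x) \<le> H (r * x)" using True s r by (intro H) auto
    then show ?thesis using True by (intro mult_right_mono) auto
  next
    case neg: False
    then have x: "x < 0" using False by simp
    have "r * x \<le> s * x" using x s by simp
    then have "H (r * x) \<le> H (s * x)" using x s r by (intro H) auto
    moreover have "\<bar>x\<bar> powr Q * x \<le> 0" using x by (simp add: mult_nonneg_nonpos)
    ultimately show ?thesis by (intro mult_right_mono_neg)
  qed
  then show ?thesis unfolding eq[OF s(1)] eq[OF r] H_def .
qed simp

text \<open>The tangent inequality at r = 1 for F(t, r x) as a function of r^(p^2): its derivative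
  in that variable is, up to the factor p^2, the quotient that \<open>f_ratio_mono\<close> shows to
  be nondecreasing. Multiplying D' by r exhibits this quotient.\<close>

lemma Fprim_fiber_convex:
  assumes t: "t \<in> {0..T}" and r: "r > 0"
  shows "f t x * x * ((r powr (p^2) - 1) / p^2) \<le> Fprim f t (r * x) - Fprim f t x"
proof -
  define D where "D r = Fprim f t (r * x) - f t x * x * (r powr (p^2) / p^2)" for r
  define D' where "D' r = f t (r * x) * x - f t x * x * r powr (p^2 - 1)" for r
  have eq: "r * D' r = r powr (p^2) * (f t (r * x) * (r * x) / r powr (p^2) - f t (1 * x) * (1 * x) / 1 powr (p^2))"
    if "r > 0" for r
  proof -
    have "r powr (p^2) = r * r powr (p^2 - 1)" using that powr_add[of r 1 "p^2 - 1"] by simp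
    then show ?thesis using that by (simp add: D'_def field_simps)
  qed
  have "D 1 \<le> D r"
  proof (rule DERIV_sign_change_minimum[where D' = D', OF _ _ _ _ r])
    fix r :: real assume r: "r > 0"
    have "((\<lambda>r. r * x) has_real_derivative x) (at r)" by (auto intro!: derivative_eq_intros)
    from DERIV_chain2[where f = "Fprim f t", OF Fprim_deriv[OF t] this]
    have 1: "((\<lambda>r. Fprim f t (r * x)) has_real_derivative f t (r * x) * x) (at r)" .
    have "((\<lambda>r. r powr (p^2)) has_real_derivative p^2 * r powr (p^2 - 1)) (at r)"
      using r by (rule has_real_derivative_powr)
    from DERIV_cmult[OF DERIV_cdivide[OF this, of "p^2"], of "f t x * x"]
    have 2: "((\<lambda>r. f t x * x * (r powr (p^2) / p^2)) has_real_derivative f t x * x * r powr (p^2 - 1)) (at r)"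
      using pp by simp
    show "(D has_real_derivative D' r) (at r)"
      unfolding D_def D'_def by (rule DERIV_diff[OF 1 2])
  next
    fix r :: real assume r: "1 \<le> r"
    then have "0 \<le> r * D' r"
      using f_ratio_mono[OF t, of 1 r x] eq[of r] by (simp add: zero_le_mult_iff)
    then show "0 \<le> D' r" using r by (simp add: zero_le_mult_iff)
  next
    fix r :: real assume r: "0 < r" "r \<le> 1"
    then have "r * D' r \<le> 0"
      using f_ratio_mono[OF t, of r 1 x] eq[of r] by (simp add: mult_le_0_iff)
    then show "D' r \<le> 0" using r by (simp add: mult_le_0_iff)
  qed simp
  then show ?thesis by (simp add: D_def diff_divide_distrib right_diff_distrib)
qed

text \<open>By (iii), F(t, g u) u^(-\<mu>) is nondecreasing in u \<ge> R for g = 1 and g = -1. Its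
  values at u = R have a positive minimum over the compact interval of t, which makes the constant
  uniform.\<close>

lemma f_growth:
  obtains c where "c > 0" "\<And>t x. t \<in> {0..T} \<Longrightarrow> \<bar>x\<bar> \<ge> R \<Longrightarrow> c * \<bar>x\<bar> powr \<mu> \<le> f t x * x"
proof -
  have Fpos: "Fprim f t x > 0" if "t \<in> {0..T}" "\<bar>x\<bar> \<ge> R" for t x
    using AR(3)[OF that] \<mu>_pos by (simp add: zero_less_mult_iff)
  have "compact ({0..T} \<times> {R, -R})" by (intro compact_Times compact_Icc) auto
  moreover have "({0..T} \<times> {R, -R}) \<noteq> {}" using T by auto
  moreover have "continuous_on ({0..T} \<times> {R, -R}) (\<lambda>(t, x). Fprim f t x)"
    by (rule continuous_on_subset[OF Fprim_cont]) auto
  ultimately obtain z where z: "z \<in> {0..T} \<times> {R, -R}"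
    "\<forall>z'\<in>{0..T} \<times> {R, -R}. (\<lambda>(t, x). Fprim f t x) z \<le> (\<lambda>(t, x). Fprim f t x) z'"
    using continuous_attains_inf by blast
  define m where "m = (\<lambda>(t, x). Fprim f t x) z"
  have m: "m > 0" using z(1) Fpos AR(2) by (auto simp: m_def)
  have m_le: "m \<le> Fprim f t R" "m \<le> Fprim f t (- R)" if "t \<in> {0..T}" for t
    using z(2) that by (auto simp: m_def)
  define c where "c = \<mu> * m * R powr (- \<mu>)"
  have c: "c > 0" using m \<mu>_pos AR(2) by (simp add: c_def)
  have main: "c * x powr \<mu> \<le> f t (g * x) * (g * x)" if t: "t \<in> {0..T}" and x: "x \<ge> R" and g: "g = 1 \<or> g = -1" for t x g
  proof -
    have gabs: "\<bar>g * u\<bar> = \<bar>u\<bar>" for u :: real using g by auto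
    define E where "E u = Fprim f t (g * u) * u powr (- \<mu>)" for u
    have "E R \<le> E x"
    proof (rule DERIV_nonneg_imp_nondecreasing[OF x])
      fix u assume u: "R \<le> u" "u \<le> x"
      have u0: "u > 0" using u AR(2) by simp
      have "((\<lambda>u. g * u) has_real_derivative g) (at u)" by (auto intro!: derivative_eq_intros)
      from DERIV_chain2[where f = "Fprim f t", OF Fprim_deriv[OF t] this]
      have 1: "((\<lambda>u. Fprim f t (g * u)) has_real_derivative f t (g * u) * g) (at u)" .
      have 2: "((\<lambda>u. u powr (- \<mu>)) has_real_derivative (- \<mu>) * u powr (- \<mu> - 1)) (at u)"
        using u0 by (rule has_real_derivative_powr)
      have "(E has_real_derivative f t (g * u) * g * u powr (- \<mu>) + (- \<mu>) * u powr (- \<mu> - 1) * Fprim f t (g * u)) (at u)"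
        unfolding E_def by (rule DERIV_mult[OF 1 2])
      moreover have "f t (g * u) * g * u powr (- \<mu>) + (- \<mu>) * u powr (- \<mu> - 1) * Fprim f t (g * u)
          = u powr (- \<mu> - 1) * ((g * u) * f t (g * u) - \<mu> * Fprim f t (g * u))"
      proof -
        have "u powr (- \<mu>) = u * u powr (- \<mu> - 1)" using u0 powr_add[of u 1 "- \<mu> - 1"] by simp
        then show ?thesis by (simp add: algebra_simps)
      qed
      moreover have "\<mu> * Fprim f t (g * u) \<le> (g * u) * f t (g * u)"
        using u u0 by (intro AR(4)[OF t]) (simp add: gabs)
      ultimately show "\<exists>y. (E has_real_derivative y) (at u) \<and> 0 \<le> y" by force
    qed
    have x0: "x > 0" using x AR(2) by simp
    have "m \<le> Fprim f t (g * R)" using g m_le[OF t] by auto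
    then have "m * R powr (- \<mu>) \<le> E R" unfolding E_def by (intro mult_right_mono) auto
    then have "m * R powr (- \<mu>) \<le> Fprim f t (g * x) * x powr (- \<mu>)" using \<open>E R \<le> E x\<close> by (simp add: E_def)
    then have "m * R powr (- \<mu>) * x powr \<mu> \<le> Fprim f t (g * x) * x powr (- \<mu>) * x powr \<mu>"
      by (intro mult_right_mono) auto
    also have "\<dots> = Fprim f t (g * x)" using x0 by (simp add: mult.assoc powr_add[symmetric])
    finally have "\<mu> * (m * R powr (- \<mu>) * x powr \<mu>) \<le> \<mu> * Fprim f t (g * x)"
      using \<mu>_pos by (intro mult_left_mono) auto
    also have "\<dots> \<le> (g * x) * f t (g * x)"
      using x x0 by (intro AR(4)[OF t]) (simp add: gabs)
    finally show ?thesis by (simp add: c_def mult_ac)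
  qed
  have "c * \<bar>x\<bar> powr \<mu> \<le> f t x * x" if "t \<in> {0..T}" "\<bar>x\<bar> \<ge> R" for t x
  proof (cases "x \<ge> 0")
    case True
    then show ?thesis using main[OF that(1), of x 1] that by simp
  next
    case False
    then show ?thesis using main[OF that(1), of "- x" "-1"] that by simp
  qed
  then show ?thesis using that c by blast
qed

text \<open>Condition (iii) gives a sign outside [-R, R], and compactness gives a constant inside;
  the bound feeds the coercivity on the Nehari set.\<close>

lemma f_AR_lower:
  obtains C where "C > 0" "\<And>t x. t \<in> {0..T} \<Longrightarrow> - C \<le> f t x * x / \<mu> - Fprim f t x"
proof -
  obtain B1 where B1: "B1 > 0" "\<And>t x. t \<in> {0..T} \<Longrightarrow> \<bar>x\<bar> \<le> R \<Longrightarrow> \<bar>f t x * x\<bar> \<le> B1"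
    using compact_bound[OF f_times_cont] by blast
  obtain B2 where B2: "B2 > 0" "\<And>t x. t \<in> {0..T} \<Longrightarrow> \<bar>x\<bar> \<le> R \<Longrightarrow> \<bar>Fprim f t x\<bar> \<le> B2"
    using compact_bound[OF Fprim_cont] by blast
  have C: "B1 / \<mu> + B2 > 0" using B1(1) B2(1) \<mu>_pos by (simp add: add_pos_pos)
  have "- (B1 / \<mu> + B2) \<le> f t x * x / \<mu> - Fprim f t x" if t: "t \<in> {0..T}" for t x
  proof (cases "\<bar>x\<bar> \<le> R")
    case True
    have "\<bar>f t x * x / \<mu>\<bar> = \<bar>f t x * x\<bar> / \<mu>" using \<mu>_pos by (simp add: abs_divide)
    also have "\<dots> \<le> B1 / \<mu>" using B1(2)[OF t True] \<mu>_pos by (intro divide_right_mono) auto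
    finally show ?thesis using B2(2)[OF t True] by linarith
  next
    case False
    then have "\<mu> * Fprim f t x \<le> x * f t x" by (intro AR(4)[OF t]) simp
    then have "Fprim f t x \<le> f t x * x / \<mu>" using \<mu>_pos by (simp add: field_simps)
    then show ?thesis using C by linarith
  qed
  then show ?thesis using that C by blast
qed

lemma f_small_times:
  assumes "e > 0"
  obtains d where "d > 0" "\<And>t x. t \<in> {0..T} \<Longrightarrow> \<bar>x\<bar> < d \<Longrightarrow> \<bar>f t x * x\<bar> \<le> e * \<bar>x\<bar> powr p"
proof -
  obtain d where d: "d > 0" "\<forall>t\<in>{0..T}. \<forall>x. 0 < \<bar>x\<bar> \<and> \<bar>x\<bar> < d \<longrightarrow> \<bar>f t x\<bar> \<le> e * \<bar>x\<bar> powr (p - 1)"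
    using f_small[OF assms] by blast
  have "\<bar>f t x * x\<bar> \<le> e * \<bar>x\<bar> powr p" if "t \<in> {0..T}" "\<bar>x\<bar> < d" for t x
  proof (cases "x = 0")
    case False
    then have "\<bar>f t x\<bar> * \<bar>x\<bar> \<le> e * \<bar>x\<bar> powr (p - 1) * \<bar>x\<bar>"
      using d(2) that by (intro mult_right_mono) auto
    also have "\<dots> = e * \<bar>x\<bar> powr p" using False powr_add[of "\<bar>x\<bar>" "p - 1" 1] by simp
    finally show ?thesis by (simp add: abs_mult)
  qed simp
  then show ?thesis using that d(1) by blast
qed

section \<open>The fibering map\<close>

definition Sf :: "(real \<Rightarrow> real) \<Rightarrow> real" where
  "Sf y = (\<integral>t. f t (y t) * y t \<partial>M)"

definition PF :: "(real \<Rightarrow> real) \<Rightarrow> real" where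
  "PF y = (\<integral>t. Fprim f t (y t) \<partial>M)"

text \<open>The energy and its radial derivative depend on \<open>w\<close> only through \<open>B = \<parallel>w\<parallel>\<^sup>p\<close> and
  \<open>y = U w\<close>. Treating \<open>B\<close> and \<open>y\<close> as independent gives meaning to limits along sequences
  whose functions, but not yet their derivatives, are known to converge.\<close>

definition gN :: "real \<Rightarrow> (real \<Rightarrow> real) \<Rightarrow> real" where
  "gN B y = (a + b * B) powr (p - 1) * B - Sf y"

definition Phi :: "real \<Rightarrow> (real \<Rightarrow> real) \<Rightarrow> real" where
  "Phi B y = ((a + b * B) powr p - a powr p) / (b * p^2) - PF y"

text \<open>The derivative of the energy along a ray, divided by \<open>s powr (p^2 - 1)\<close>; this normalisation
  makes it monotone in \<open>s\<close>.\<close>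

definition hN :: "real \<Rightarrow> (real \<Rightarrow> real) \<Rightarrow> real \<Rightarrow> real" where
  "hN B y s = (a * s powr (- p) + b * B) powr (p - 1) * B - Sf (\<lambda>t. s * y t) / s powr (p^2)"

lemma hN_1: "hN B y 1 = gN B y"
  by (simp add: hN_def gN_def)

text \<open>The exponents combine as p (p - 1) + p = p^2. Hence the zeros of \<open>hN B y\<close>
  are the dilation factors that bring a ray to the Nehari set.\<close>

lemma gN_scale:
  assumes "s > 0" "B \<ge> 0"
  shows "gN (s powr p * B) (\<lambda>t. s * y t) = s powr (p^2) * hN B y s"
proof -
  have "(a + b * (s powr p * B)) = s powr p * (a * s powr (- p) + b * B)"
    using assms by (simp add: algebra_simps powr_add[symmetric])
  then have "(a + b * (s powr p * B)) powr (p - 1) * (s powr p * B)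
      = (s powr p) powr (p - 1) * (a * s powr (- p) + b * B) powr (p - 1) * (s powr p * B)"
    by (simp only: powr_mult)
  also have "\<dots> = ((s powr p) powr (p - 1) * s powr p) * ((a * s powr (- p) + b * B) powr (p - 1) * B)"
    by (simp only: mult_ac)
  also have "(s powr p) powr (p - 1) * s powr p = s powr (p^2)"
    by (simp add: powr_powr powr_add[symmetric] power2_eq_square algebra_simps)
  finally show ?thesis using assms by (simp add: gN_def hN_def right_diff_distrib)
qed

lemma Sf_integrable: "continuous_on {0..T} y \<Longrightarrow> integrable M (\<lambda>t. f t (y t) * y t)"
  by (intro integrable_continuous comp_continuous_on[OF f_times_cont])

lemma PF_integrable: "continuous_on {0..T} y \<Longrightarrow> integrable M (\<lambda>t. Fprim f t (y t))"
  by (intro integrable_continuous comp_continuous_on[OF Fprim_cont])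

lemma measure_MT: "measure M {0..T} = T"
  using T by (simp add: measure_restrict_space)

lemma Sf_ratio_mono:
  assumes y: "continuous_on {0..T} y" and s: "0 < s" "s \<le> r"
  shows "Sf (\<lambda>t. s * y t) / s powr (p^2) \<le> Sf (\<lambda>t. r * y t) / r powr (p^2)"
proof -
  have i: "integrable M (\<lambda>t. f t (z * y t) * (z * y t))" for z
    by (rule Sf_integrable[of "\<lambda>t. z * y t"]) (intro continuous_on_mult_left y)
  have "(\<integral>t. f t (s * y t) * (s * y t) / s powr (p^2) \<partial>M) \<le> (\<integral>t. f t (r * y t) * (r * y t) / r powr (p^2) \<partial>M)"
  proof (rule integral_mono)
    fix t assume "t \<in> space M"
    then show "f t (s * y t) * (s * y t) / s powr (p^2) \<le> f t (r * y t) * (r * y t) / r powr (p^2)"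
      by (intro f_ratio_mono s) simp
  qed (intro integrable_divide i)+
  then show ?thesis by (simp add: Sf_def)
qed

text \<open>The summand \<open>a * s powr (- p)\<close> decreases strictly because a > 0; the
  potential part contributes monotonicity in the same direction.\<close>

lemma hN_strict:
  assumes y: "continuous_on {0..T} y" and B: "B > 0" and s: "0 < s" "s < r"
  shows "hN B y r < hN B y s"
proof -
  have "r powr (- p) < s powr (- p)" using s p_pos by (intro powr_less_mono2_neg) auto
  then have "a * r powr (- p) + b * B < a * s powr (- p) + b * B" using a by simp
  moreover have "0 \<le> a * r powr (- p) + b * B" using a b B by simp
  ultimately have "(a * r powr (- p) + b * B) powr (p - 1) < (a * s powr (- p) + b * B) powr (p - 1)"
    using p by (intro powr_less_mono2) auto
  then have "(a * r powr (- p) + b * B) powr (p - 1) * B < (a * s powr (- p) + b * B) powr (p - 1) * B"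
    using B by simp
  moreover have "Sf (\<lambda>t. s * y t) / s powr (p^2) \<le> Sf (\<lambda>t. r * y t) / r powr (p^2)"
    by (rule Sf_ratio_mono[OF y]) (use s in auto)
  ultimately show ?thesis unfolding hN_def by linarith
qed

lemma Sf_abs_le:
  assumes y: "continuous_on {0..T} y" and bound: "\<And>t. t \<in> {0..T} \<Longrightarrow> \<bar>f t (y t) * y t\<bar> \<le> C"
  shows "\<bar>Sf y\<bar> \<le> C * T"
proof -
  interpret finite_measure M by (rule finite_measure_MT)
  have "\<bar>Sf y\<bar> \<le> (\<integral>t. \<bar>f t (y t) * y t\<bar> \<partial>M)" unfolding Sf_def by (rule integral_abs_bound)
  also have "\<dots> \<le> (\<integral>t. C \<partial>M)"
    using bound by (intro integral_mono integrable_abs Sf_integrable y) simp_all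
  also have "\<dots> = C * T" using measure_MT by simp
  finally show ?thesis .
qed

text \<open>For small s the Kirchhoff part is at least s^(p - p^2) A, while (ii) bounds the
  potential part by half of that. The constant e is chosen so that e K^p T = A / 2, and s so that s
  y stays below the threshold d.\<close>

lemma hN_pos:
  assumes y: "continuous_on {0..T} y" and B: "B > 0"
  obtains s where "s > 0" "hN B y s > 0"
proof -
  obtain K where K: "K > 0" "\<And>t. t \<in> {0..T} \<Longrightarrow> \<bar>y t\<bar> \<le> K" using continuous_on_bounded_Icc[OF y] by blast
  define A where "A = a powr (p - 1) * B"
  have A: "A > 0" using a B by (simp add: A_def)
  define e where "e = A / (2 * (K powr p * T))"
  have KT: "K powr p * T > 0" using K(1) T by simp
  have e: "e > 0" using A KT by (simp add: e_def)
  obtain d where d: "d > 0" "\<And>t x. t \<in> {0..T} \<Longrightarrow> \<bar>x\<bar> < d \<Longrightarrow> \<bar>f t x * x\<bar> \<le> e * \<bar>x\<bar> powr p"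
    using f_small_times[OF e] by blast
  define s where "s = d / (2 * K)"
  have s: "s > 0" using d(1) K(1) by (simp add: s_def)
  have "\<bar>Sf (\<lambda>t. s * y t)\<bar> \<le> (e * (s * K) powr p) * T"
  proof (rule Sf_abs_le)
    fix t assume t: "t \<in> {0..T}"
    have le: "\<bar>s * y t\<bar> \<le> s * K" using K(2)[OF t] s by (simp add: abs_mult)
    also have "s * K < d" using d(1) K(1) by (simp add: s_def)
    finally have "\<bar>f t (s * y t) * (s * y t)\<bar> \<le> e * \<bar>s * y t\<bar> powr p" by (rule d(2)[OF t])
    also have "\<dots> \<le> e * (s * K) powr p"
      using e le p_pos by (intro mult_left_mono powr_mono2) auto
    finally show "\<bar>f t (s * y t) * (s * y t)\<bar> \<le> e * (s * K) powr p" .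
  qed (intro continuous_on_mult_left y)
  also have "\<dots> = s powr p * (e * (K powr p * T))" by (simp add: powr_mult)
  also have "e * (K powr p * T) = A / 2" unfolding e_def using KT K(1) T by simp
  finally have 1: "Sf (\<lambda>t. s * y t) \<le> s powr p * (A / 2)" by linarith
  have "Sf (\<lambda>t. s * y t) / s powr (p^2) \<le> (s powr p * (A / 2)) / s powr (p^2)"
    using 1 by (intro divide_right_mono) auto
  also have "\<dots> = s powr (p - p^2) * (A / 2)" by (simp add: powr_diff)
  finally have 2: "Sf (\<lambda>t. s * y t) / s powr (p^2) \<le> s powr (p - p^2) * (A / 2)" .
  have "s powr (p - p^2) * A = (a * s powr (- p)) powr (p - 1) * B"
    by (simp add: A_def powr_mult powr_powr power2_eq_square algebra_simps)
  also have "\<dots> \<le> (a * s powr (- p) + b * B) powr (p - 1) * B"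
    using a b B p by (intro mult_right_mono powr_mono2) auto
  finally have 3: "s powr (p - p^2) * A \<le> (a * s powr (- p) + b * B) powr (p - 1) * B" .
  have "s powr (p - p^2) * A > 0" using s A by simp
  then have "hN B y s > 0" using 2 3 unfolding hN_def by (simp add: algebra_simps)
  then show ?thesis using that s by blast
qed

lemma continuous_nonzero_interval:
  assumes y: "continuous_on {0..T} (y :: real \<Rightarrow> real)" and t0: "t0 \<in> {0..T}" "y t0 \<noteq> 0"
  obtains c d \<eta> where "0 \<le> c" "c < d" "d \<le> T" "\<eta> > 0" "\<And>t. t \<in> {c..d} \<Longrightarrow> \<bar>y t\<bar> \<ge> \<eta>"
proof -
  define \<eta> where "\<eta> = \<bar>y t0\<bar> / 2"
  have \<eta>: "\<eta> > 0" using t0 by (simp add: \<eta>_def)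
  obtain \<delta> where \<delta>: "\<delta> > 0" "\<And>t. t \<in> {0..T} \<Longrightarrow> dist t t0 < \<delta> \<Longrightarrow> dist (y t) (y t0) < \<eta>"
    using y t0(1) \<eta> unfolding continuous_on_iff by blast
  define c where "c = max 0 (t0 - \<delta> / 2)"
  define d where "d = min T (t0 + \<delta> / 2)"
  have "c < d" using t0 T \<delta>(1) by (auto simp: c_def d_def)
  moreover have "0 \<le> c" "d \<le> T" by (auto simp: c_def d_def)
  moreover have "\<bar>y t\<bar> \<ge> \<eta>" if "t \<in> {c..d}" for t
  proof -
    have "t \<in> {0..T}" "dist t t0 < \<delta>" using that \<delta>(1) by (auto simp: c_def d_def dist_real_def)
    then have "dist (y t) (y t0) < \<eta>" by (rule \<delta>(2))
    then show ?thesis unfolding \<eta>_def dist_real_def by linarith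
  qed
  ultimately show ?thesis using that \<eta> by blast
qed

text \<open>On an interval where y stays away from 0 the potential grows like s^\<mu> with \<mu> >
  p^2; elsewhere \<open>f_ratio_mono\<close> bounds the quotient from below by its value at s =
  1.\<close>

lemma hN_neg:
  assumes y: "continuous_on {0..T} y" and t0: "t0 \<in> {0..T}" "y t0 \<noteq> 0" and B: "B > 0"
  obtains s where "s > 0" "hN B y s < 0"
proof -
  interpret finite_measure M by (rule finite_measure_MT)
  obtain c d \<eta> where cd: "0 \<le> c" "c < d" "d \<le> T" and \<eta>: "\<eta> > 0" "\<And>t. t \<in> {c..d} \<Longrightarrow> \<bar>y t\<bar> \<ge> \<eta>"
    using continuous_nonzero_interval[OF y t0] by blast
  obtain k where k: "k > 0" "\<And>t x. t \<in> {0..T} \<Longrightarrow> \<bar>x\<bar> \<ge> R \<Longrightarrow> k * \<bar>x\<bar> powr \<mu> \<le> f t x * x"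
    using f_growth by blast
  obtain C where C: "C > 0" "\<And>t. t \<in> {0..T} \<Longrightarrow> \<bar>f t (y t) * y t\<bar> \<le> C"
    using continuous_on_bounded_Icc[OF comp_continuous_on[OF f_times_cont y]] by blast
  define A where "A = (a + b * B) powr (p - 1) * B"
  define E where "E = k * \<eta> powr \<mu> * (d - c)"
  have E: "E > 0" using k(1) \<eta>(1) cd by (simp add: E_def)
  have A: "A \<ge> 0" using B by (simp add: A_def)
  \<comment> \<open>The size s^(\<mu> - p^2) must reach to outweigh the Kirchhoff part, at most A,
    and the loss C T off the interval; the 1 leaves a strict inequality.\<close>
  define X where "X = (C * T + A + 1) / E"
  have X: "X > 0" unfolding X_def using C(1) A T E by (intro divide_pos_pos add_nonneg_pos add_nonneg_nonneg) auto
  have \<mu>p: "\<mu> - p^2 > 0" using AR(1) by simp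
  \<comment> \<open>s \<ge> 1 permits the comparison with s = 1, s \<ge> R / \<eta> brings s y into
    the range of \<open>f_growth\<close>, and the last bound gives s^(\<mu> - p^2) \<ge> X.\<close>
  define s where "s = max 1 (max (R / \<eta>) (X powr (1 / (\<mu> - p^2))))"
  have s: "s \<ge> 1" "s > 0" "s \<ge> R / \<eta>" "s \<ge> X powr (1 / (\<mu> - p^2))" by (auto simp: s_def)
  have "X = (X powr (1 / (\<mu> - p^2))) powr (\<mu> - p^2)" using X \<mu>p by (simp add: powr_powr)
  also have "\<dots> \<le> s powr (\<mu> - p^2)" using \<mu>p s by (intro powr_mono2) auto
  finally have sX: "E * s powr (\<mu> - p^2) \<ge> C * T + A + 1"
    using E by (simp add: X_def field_simps)
  define Z where "Z = k * \<eta> powr \<mu> * s powr (\<mu> - p^2)"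
  have Z: "Z > 0" using k(1) \<eta>(1) s by (simp add: Z_def)
  have pw: "Z * indicator {c..d} t - C \<le> f t (s * y t) * (s * y t) / s powr (p^2)" if t: "t \<in> {0..T}" for t
  proof (cases "t \<in> {c..d}")
    case True
    have ys: "\<bar>s * y t\<bar> \<ge> s * \<eta>" using \<eta>(2)[OF True] s by (simp add: abs_mult)
    moreover have "s * \<eta> \<ge> R" using s(3) \<eta>(1) by (simp add: field_simps)
    ultimately have "k * \<bar>s * y t\<bar> powr \<mu> \<le> f t (s * y t) * (s * y t)" by (intro k(2)[OF t]) linarith
    moreover have "k * (s * \<eta>) powr \<mu> \<le> k * \<bar>s * y t\<bar> powr \<mu>"
      using ys k(1) s \<eta>(1) \<mu>_pos by (intro mult_left_mono powr_mono2) auto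
    ultimately have "k * (s * \<eta>) powr \<mu> \<le> f t (s * y t) * (s * y t)" by linarith
    then have "k * (s * \<eta>) powr \<mu> / s powr (p^2) \<le> f t (s * y t) * (s * y t) / s powr (p^2)"
      by (intro divide_right_mono) auto
    moreover have "k * (s * \<eta>) powr \<mu> / s powr (p^2) = Z"
      by (simp add: Z_def powr_mult powr_diff)
    ultimately show ?thesis using True C(1) by simp
  next
    case False
    have "f t (1 * y t) * (1 * y t) / 1 powr (p^2) \<le> f t (s * y t) * (s * y t) / s powr (p^2)"
      by (rule f_ratio_mono[OF t]) (use s in auto)
    moreover have "- C \<le> f t (y t) * y t" using C(2)[OF t] by linarith
    ultimately show ?thesis using False by simp
  qed
  have cdM: "{c..d} \<in> sets M" using cd by (auto simp: sets_restrict_space_iff)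
  have i_cd: "integrable M (indicator {c..d} :: real \<Rightarrow> real)"
    using cdM by (intro integrable_real_indicator) (auto simp: less_top[symmetric])
  have "Z * (d - c) - C * T = (\<integral>t. Z * indicator {c..d} t - C \<partial>M)"
  proof -
    have sub: "{c..d} \<subseteq> {0..T}" using cd by auto
    then have m_cd: "measure M {c..d} = d - c" using cd by (subst measure_restrict_space) auto
    have "(\<integral>t. Z * indicator {c..d} t - C \<partial>M) = (\<integral>t. Z * indicator {c..d} t \<partial>M) - (\<integral>t. C \<partial>M)"
      by (intro Bochner_Integration.integral_diff integrable_mult_right i_cd) simp
    also have "(\<integral>t. Z * indicator {c..d} t \<partial>M) = Z * (\<integral>t. indicator {c..d} t \<partial>M)"
      by (rule integral_mult_right_zero)
    also have "(\<integral>t. indicator {c..d} t \<partial>M) = d - c"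
      using m_cd cd by (simp add: max_def min_def)
    also have "(\<integral>t. C \<partial>M) = C * T" using measure_MT by simp
    finally show ?thesis by simp
  qed
  also have "\<dots> \<le> (\<integral>t. f t (s * y t) * (s * y t) / s powr (p^2) \<partial>M)"
  proof (rule integral_mono)
    show "integrable M (\<lambda>t. Z * indicator {c..d} t - C)"
      by (intro Bochner_Integration.integrable_diff integrable_mult_right i_cd) simp
    show "integrable M (\<lambda>t. f t (s * y t) * (s * y t) / s powr (p^2))"
      by (intro integrable_divide Sf_integrable continuous_on_mult_left y)
  qed (use pw in simp)
  also have "\<dots> = Sf (\<lambda>t. s * y t) / s powr (p^2)" by (simp add: Sf_def)
  finally have "Z * (d - c) - C * T \<le> Sf (\<lambda>t. s * y t) / s powr (p^2)" .
  moreover have "Z * (d - c) = E * s powr (\<mu> - p^2)" by (simp add: Z_def E_def)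
  moreover have "(a * s powr (- p) + b * B) powr (p - 1) * B \<le> A"
  proof -
    have "s powr (- p) \<le> s powr 0" using s p_pos by (intro powr_mono) auto
    then have "a * s powr (- p) \<le> a * 1" using a s by (intro mult_left_mono) auto
    then show ?thesis unfolding A_def using a b B p by (intro mult_right_mono powr_mono2) auto
  qed
  ultimately have "hN B y s < 0" using sX unfolding hN_def by linarith
  then show ?thesis using that s(2) by blast
qed

section \<open>Continuity of the fibering map and of its zero\<close>

definition ptw_conv :: "(nat \<Rightarrow> real \<Rightarrow> real) \<Rightarrow> (real \<Rightarrow> real) \<Rightarrow> bool" where
  "ptw_conv yk y \<longleftrightarrow> (\<forall>k. continuous_on {0..T} (yk k)) \<and> continuous_on {0..T} y \<and>
     (\<exists>K. \<forall>k. \<forall>t\<in>{0..T}. \<bar>yk k t\<bar> \<le> K) \<and> (\<forall>t\<in>{0..T}. (\<lambda>k. yk k t) \<longlonglongrightarrow> y t)"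

lemma ptw_conv_const: "continuous_on {0..T} y \<Longrightarrow> ptw_conv (\<lambda>_. y) y"
  unfolding ptw_conv_def using continuous_on_bounded_Icc[of 0 T y] by (metis tendsto_const)

lemma ptw_conv_scale:
  assumes "ptw_conv yk y" "sk \<longlonglongrightarrow> s"
  shows "ptw_conv (\<lambda>k t. sk k * yk k t) (\<lambda>t. s * y t)"
proof -
  obtain K where K: "\<And>k t. t \<in> {0..T} \<Longrightarrow> \<bar>yk k t\<bar> \<le> K" using assms(1) unfolding ptw_conv_def by blast
  have "Bseq sk" using assms(2) convergentI convergent_imp_Bseq by blast
  then obtain L where L: "L > 0" "\<And>k. \<bar>sk k\<bar> \<le> L" by (auto simp: Bseq_def)
  have "\<bar>sk k * yk k t\<bar> \<le> L * K" if "t \<in> {0..T}" for k t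
    unfolding abs_mult using L K[OF that] by (intro mult_mono) auto
  then show ?thesis
    using assms unfolding ptw_conv_def
    by (intro conjI allI ballI exI[of _ "L * K"] continuous_on_mult continuous_on_const tendsto_mult) auto
qed

lemma ptw_conv_tendsto:
  assumes "ptw_conv yk y"
  shows "(\<lambda>k. Sf (yk k)) \<longlonglongrightarrow> Sf y" "(\<lambda>k. PF (yk k)) \<longlonglongrightarrow> PF y"
proof -
  obtain K where K: "\<And>k t. t \<in> {0..T} \<Longrightarrow> \<bar>yk k t\<bar> \<le> K" using assms(1) unfolding ptw_conv_def by blast
  have m: "yk k \<in> borel_measurable M" "y \<in> borel_measurable M" for k
    using assms by (auto simp: ptw_conv_def intro: continuous_on_borel_measurable_MT)
  have l: "(\<lambda>k. yk k t) \<longlonglongrightarrow> y t" if "t \<in> {0..T}" for t using assms that by (simp add: ptw_conv_def)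
  show "(\<lambda>k. Sf (yk k)) \<longlonglongrightarrow> Sf y"
    unfolding Sf_def by (rule integral_comp_tendsto[OF f_times_cont m(1) K m(2) l])
  show "(\<lambda>k. PF (yk k)) \<longlonglongrightarrow> PF y"
    unfolding PF_def by (rule integral_comp_tendsto[OF Fprim_cont m(1) K m(2) l])
qed

lemma gN_tendsto:
  assumes "Bk \<longlonglongrightarrow> B" "B \<ge> 0" "ptw_conv yk y"
  shows "(\<lambda>k. gN (Bk k) (yk k)) \<longlonglongrightarrow> gN B y"
proof -
  have "a + b * B \<noteq> 0" using a b assms(2) by (smt (verit) mult_nonneg_nonneg)
  then show ?thesis unfolding gN_def
    by (intro tendsto_diff tendsto_mult tendsto_powr tendsto_add tendsto_const assms ptw_conv_tendsto)
qed

lemma Phi_tendsto: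
  assumes "Bk \<longlonglongrightarrow> B" "B \<ge> 0" "ptw_conv yk y"
  shows "(\<lambda>k. Phi (Bk k) (yk k)) \<longlonglongrightarrow> Phi B y"
proof -
  have "a + b * B \<noteq> 0" using a b assms(2) by (smt (verit) mult_nonneg_nonneg)
  moreover have "b * p^2 \<noteq> 0" using b pp by simp
  ultimately show ?thesis unfolding Phi_def
    by (intro tendsto_diff tendsto_divide tendsto_mult tendsto_powr tendsto_add tendsto_const assms ptw_conv_tendsto)
qed

lemma hN_tendsto:
  assumes "Bk \<longlonglongrightarrow> B" "B \<ge> 0" "ptw_conv yk y" "sk \<longlonglongrightarrow> s" "s > 0"
  shows "(\<lambda>k. hN (Bk k) (yk k) (sk k)) \<longlonglongrightarrow> hN B y s"
proof -
  have "a * s powr (- p) > 0" using a assms(5) by simp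
  then have "a * s powr (- p) + b * B \<noteq> 0" using b assms(2) by (smt (verit) mult_nonneg_nonneg)
  moreover have "s \<noteq> 0" "s powr (p^2) \<noteq> 0" using assms(5) by auto
  ultimately show ?thesis unfolding hN_def
    by (intro tendsto_diff tendsto_divide tendsto_mult tendsto_powr tendsto_add tendsto_const assms
        ptw_conv_tendsto[OF ptw_conv_scale])
qed

lemma hN_zero_exists:
  assumes y: "continuous_on {0..T} y" and t0: "t0 \<in> {0..T}" "y t0 \<noteq> 0" and B: "B > 0"
  obtains s where "s > 0" "hN B y s = 0"
proof -
  obtain s1 where s1: "s1 > 0" "hN B y s1 > 0" using hN_pos[OF y B] by blast
  obtain s2 where s2: "s2 > 0" "hN B y s2 < 0" using hN_neg[OF y t0 B] by blast
  have le: "s1 \<le> s2" using hN_strict[OF y B, of s2 s1] s1 s2 by (cases "s2 < s1") auto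
  have "continuous_on {s1..s2} (hN B y)"
  proof (rule continuous_on_sequentiallyI)
    fix u :: "nat \<Rightarrow> real" and s
    assume "\<forall>n. u n \<in> {s1..s2}" "s \<in> {s1..s2}" "u \<longlonglongrightarrow> s"
    then show "(\<lambda>n. hN B y (u n)) \<longlonglongrightarrow> hN B y s"
      using s1 B by (intro hN_tendsto tendsto_const ptw_conv_const y) auto
  qed
  then obtain s where "s1 \<le> s" "s \<le> s2" "hN B y s = 0"
    using IVT2'[of "hN B y" s2 0 s1] s1 s2 le by auto
  then show ?thesis using that[of s] s1(1) by simp
qed

text \<open>Strict monotonicity does the work of an implicit function theorem: the limit fibering
  map is positive at any point left of s and negative at any point right of s, these signs persist
  for large k, and they trap the zero of the k-th map.\<close>

lemma hN_zero_perturb: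
  assumes y: "ptw_conv yk y" and t0: "t0 \<in> {0..T}" "y t0 \<noteq> 0" and B: "Bk \<longlonglongrightarrow> B" "B > 0"
    and s: "s > 0" "hN B y s = 0"
  obtains sk where "sk \<longlonglongrightarrow> s" "\<forall>\<^sub>F k in sequentially. sk k > 0 \<and> hN (Bk k) (yk k) (sk k) = 0"
proof -
  have yc: "continuous_on {0..T} y" "\<And>k. continuous_on {0..T} (yk k)" using y by (auto simp: ptw_conv_def)
  \<comment> \<open>Where no zero exists the value is arbitrary; this can happen only for finitely
    many k.\<close>
  define sk where "sk k = (SOME s. s > 0 \<and> hN (Bk k) (yk k) s = 0)" for k
  have ev1: "\<forall>\<^sub>F k in sequentially. Bk k > 0" by (rule order_tendstoD(1)[OF B])
  have "(\<lambda>k. \<bar>yk k t0\<bar>) \<longlonglongrightarrow> \<bar>y t0\<bar>" using y t0 by (intro tendsto_rabs) (simp add: ptw_conv_def)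
  then have ev2: "\<forall>\<^sub>F k in sequentially. \<bar>yk k t0\<bar> > 0" by (rule order_tendstoD(1)) (use t0 in simp)
  have ev: "\<forall>\<^sub>F k in sequentially. Bk k > 0 \<and> sk k > 0 \<and> hN (Bk k) (yk k) (sk k) = 0"
    using ev1 ev2
  proof eventually_elim
    case (elim k)
    have "yk k t0 \<noteq> 0" using elim by auto
    then obtain r where "r > 0" "hN (Bk k) (yk k) r = 0"
      using hN_zero_exists[OF yc(2) t0(1) _ elim(1)] by blast
    then have "sk k > 0 \<and> hN (Bk k) (yk k) (sk k) = 0"
      unfolding sk_def by (intro someI[of "\<lambda>s. s > 0 \<and> hN (Bk k) (yk k) s = 0" r]) simp
    then show ?case using elim by simp
  qed
  have "sk \<longlonglongrightarrow> s"
  proof (rule order_tendstoI)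
    fix u assume "u < s"
    \<comment> \<open>The maximum with s / 2 keeps the test point positive, as monotonicity of
      \<open>hN\<close> holds on positive arguments.\<close>
    define r where "r = max u (s / 2)"
    have r: "0 < r" "r < s" "u \<le> r" using \<open>u < s\<close> s by (auto simp: r_def)
    have "hN B y r > 0" using hN_strict[OF yc(1) B(2) r(1) r(2)] s by simp
    moreover have "(\<lambda>k. hN (Bk k) (yk k) r) \<longlonglongrightarrow> hN B y r"
      using B r by (intro hN_tendsto y tendsto_const) auto
    ultimately have "\<forall>\<^sub>F k in sequentially. hN (Bk k) (yk k) r > 0" by (metis order_tendstoD(1))
    with ev show "\<forall>\<^sub>F k in sequentially. u < sk k"
    proof eventually_elim
      case (elim k)
      have "r < sk k"
      proof (rule ccontr)
        assume "\<not> r < sk k"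
        then have "hN (Bk k) (yk k) r \<le> hN (Bk k) (yk k) (sk k)"
          using hN_strict[OF yc(2), of "Bk k" "sk k" r k] elim by (cases "sk k = r") auto
        then show False using elim by simp
      qed
      then show ?case using r by simp
    qed
  next
    fix u assume "s < u"
    then have r: "0 < u" using s by simp
    have "hN B y u < 0" using hN_strict[OF yc(1) B(2) s(1) \<open>s < u\<close>] s by simp
    moreover have "(\<lambda>k. hN (Bk k) (yk k) u) \<longlonglongrightarrow> hN B y u"
      using B r by (intro hN_tendsto y tendsto_const) auto
    ultimately have "\<forall>\<^sub>F k in sequentially. hN (Bk k) (yk k) u < 0" by (metis order_tendstoD(2))
    with ev show "\<forall>\<^sub>F k in sequentially. sk k < u"
    proof eventually_elim
      case (elim k)
      show ?case
      proof (rule ccontr)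
        assume "\<not> sk k < u"
        then have "hN (Bk k) (yk k) (sk k) \<le> hN (Bk k) (yk k) u"
          using hN_strict[OF yc(2), of "Bk k" u "sk k" k] elim r by (cases "sk k = u") auto
        then show False using elim by simp
      qed
    qed
  qed
  moreover have "\<forall>\<^sub>F k in sequentially. sk k > 0 \<and> hN (Bk k) (yk k) (sk k) = 0"
    using ev by eventually_elim simp
  ultimately show ?thesis using that by blast
qed

text \<open>Along a ray, the Kirchhoff term is a concave and the potential term a convex function of
  \<open>r powr (p^2)\<close>, so a critical point of the fibering map is its maximum.\<close>

lemma kirchhoff_fiber_concave:
  assumes B: "B \<ge> 0" and r: "r > 0"
  shows "((a + b * (r powr p * B)) powr p - (a + b * B) powr p) / (b * p^2)
    \<le> (a + b * B) powr (p - 1) * B * ((r powr (p^2) - 1) / p^2)"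
proof -
  define A where "A = (a + b * B) powr (p - 1) * B"
  define D where "D r = A * (r powr (p^2) / p^2) - (a + b * (r powr p * B)) powr p / (b * p^2)" for r
  define D' where "D' r = A * r powr (p^2 - 1) - (a + b * (r powr p * B)) powr (p - 1) * r powr (p - 1) * B" for r
  have base: "a + b * (r powr p * B) > 0" for r using a b B by (simp add: add_pos_nonneg)
  \<comment> \<open>Brings both terms of D' into the same form, so that the comparison reduces to
    r^p (a + b B) against a + b r^p B, whose difference is a (r^p - 1).\<close>
  have eq: "A * r powr (p^2 - 1) = (r powr p * (a + b * B)) powr (p - 1) * r powr (p - 1) * B" if "r > 0" for r
  proof -
    have "r powr (p^2 - 1) = r powr (p * (p - 1)) * r powr (p - 1)"
      unfolding powr_add[symmetric] by (simp add: power2_eq_square algebra_simps)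
    then show ?thesis by (simp add: A_def powr_mult powr_powr)
  qed
  have "D 1 \<le> D r"
  proof (rule DERIV_sign_change_minimum[where D' = D', OF _ _ _ _ r])
    fix r :: real assume r: "r > 0"
    have d1: "((\<lambda>r. r powr (p^2)) has_real_derivative p^2 * r powr (p^2 - 1)) (at r)"
      using r by (rule has_real_derivative_powr)
    have d2: "((\<lambda>r. r powr p) has_real_derivative p * r powr (p - 1)) (at r)"
      using r by (rule has_real_derivative_powr)
    have d3: "((\<lambda>r. a + b * (r powr p * B)) has_real_derivative b * (p * r powr (p - 1) * B)) (at r)"
      using DERIV_add[OF DERIV_const[of a] DERIV_cmult[OF DERIV_cmult_right[OF d2, of B], of b]] by simp
    have d4: "((\<lambda>r. (a + b * (r powr p * B)) powr p) has_real_derivative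
        p * (a + b * (r powr p * B)) powr (p - 1) * (b * (p * r powr (p - 1) * B))) (at r)"
      using DERIV_chain2[where f = "\<lambda>x. x powr p", OF has_real_derivative_powr[OF base] d3] .
    have "(D has_real_derivative (A / p^2) * (p^2 * r powr (p^2 - 1))
        - (1 / (b * p^2)) * (p * (a + b * (r powr p * B)) powr (p - 1) * (b * (p * r powr (p - 1) * B)))) (at r)"
      using DERIV_diff[OF DERIV_cmult[OF d1, of "A / p^2"] DERIV_cmult[OF d4, of "1 / (b * p^2)"]]
      by (simp add: D_def[abs_def])
    moreover have "(A / p^2) * (p^2 * r powr (p^2 - 1))
        - (1 / (b * p^2)) * (p * (a + b * (r powr p * B)) powr (p - 1) * (b * (p * r powr (p - 1) * B))) = D' r"
      using b p by (simp add: D'_def power2_eq_square)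
    ultimately show "(D has_real_derivative D' r) (at r)" by simp
  next
    fix r :: real assume r: "1 \<le> r"
    have "1 \<le> r powr p" using r p_pos by (simp add: ge_one_powr_ge_zero)
    then have "a * 1 \<le> a * r powr p" using a by (intro mult_left_mono) auto
    then have "a + b * (r powr p * B) \<le> r powr p * (a + b * B)" by (simp add: algebra_simps)
    then have "(a + b * (r powr p * B)) powr (p - 1) \<le> (r powr p * (a + b * B)) powr (p - 1)"
      using base[of r] p by (intro powr_mono2) auto
    then have "(a + b * (r powr p * B)) powr (p - 1) * r powr (p - 1) * B
        \<le> (r powr p * (a + b * B)) powr (p - 1) * r powr (p - 1) * B"
      using B by (intro mult_right_mono) auto
    then show "0 \<le> D' r" using eq[of r] r by (simp add: D'_def)
  next
    fix r :: real assume r: "0 < r" "r \<le> 1"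
    have "r powr p \<le> 1 powr p" using r p_pos by (intro powr_mono2) auto
    then have "a * r powr p \<le> a * 1" using a by (intro mult_left_mono) auto
    then have "r powr p * (a + b * B) \<le> a + b * (r powr p * B)" by (simp add: algebra_simps)
    then have "(r powr p * (a + b * B)) powr (p - 1) \<le> (a + b * (r powr p * B)) powr (p - 1)"
      using a b B p by (intro powr_mono2) auto
    then have "(r powr p * (a + b * B)) powr (p - 1) * r powr (p - 1) * B
        \<le> (a + b * (r powr p * B)) powr (p - 1) * r powr (p - 1) * B"
      using B by (intro mult_right_mono) auto
    then show "D' r \<le> 0" using eq[of r] r by (simp add: D'_def)
  qed simp
  then show ?thesis by (simp add: D_def A_def diff_divide_distrib right_diff_distrib)
qed

text \<open>By \<open>gN B y = 0\<close> the concave Kirchhoff term and the convex potential have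
  equal slope at r = 1 in the variable r^(p^2), so both tangent inequalities have the same linear
  part. B and y may be unrelated, as for the limit pair in \<open>midpoint_mass\<close>.\<close>

lemma Phi_fiber_max:
  assumes B: "B \<ge> 0" and y: "continuous_on {0..T} y" and crit: "gN B y = 0" and r: "r > 0"
  shows "Phi (r powr p * B) (\<lambda>t. r * y t) \<le> Phi B y"
proof -
  define c where "c = (r powr (p^2) - 1) / p^2"
  have "Sf y * c \<le> PF (\<lambda>t. r * y t) - PF y"
  proof -
    have i: "integrable M (\<lambda>t. Fprim f t (r * y t))"
      by (rule PF_integrable[of "\<lambda>t. r * y t"]) (intro continuous_on_mult_left y)
    have "(\<integral>t. f t (y t) * y t * c \<partial>M) \<le> (\<integral>t. Fprim f t (r * y t) - Fprim f t (y t) \<partial>M)"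
    proof (rule integral_mono)
      show "integrable M (\<lambda>t. f t (y t) * y t * c)" by (intro integrable_mult_left Sf_integrable y)
      show "integrable M (\<lambda>t. Fprim f t (r * y t) - Fprim f t (y t))"
        by (intro Bochner_Integration.integrable_diff i PF_integrable y)
      fix t assume "t \<in> space M"
      then show "f t (y t) * y t * c \<le> Fprim f t (r * y t) - Fprim f t (y t)"
        unfolding c_def by (intro Fprim_fiber_convex r) simp
    qed
    also have "\<dots> = PF (\<lambda>t. r * y t) - PF y"
      unfolding PF_def by (rule Bochner_Integration.integral_diff[OF i PF_integrable[OF y]])
    finally show ?thesis by (simp add: Sf_def)
  qed
  moreover have "((a + b * (r powr p * B)) powr p - (a + b * B) powr p) / (b * p^2) \<le> Sf y * c"
    using kirchhoff_fiber_concave[OF B r] crit by (simp add: gN_def c_def)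
  ultimately have "((a + b * (r powr p * B)) powr p - (a + b * B) powr p) / (b * p^2)
      \<le> PF (\<lambda>t. r * y t) - PF y" by linarith
  then show ?thesis unfolding Phi_def diff_divide_distrib by linarith
qed

end

section \<open>Minimisation on the Nehari manifold\<close>

context kirchhoff
begin

definition NN :: "(real \<Rightarrow> real) \<Rightarrow> bool" where
  "NN w \<longleftrightarrow> W w \<and> (\<exists>t\<in>{0..T}. U w t \<noteq> 0) \<and> gN (mass w) (U w) = 0"

definition level :: "(real \<Rightarrow> real) \<Rightarrow> real" where
  "level w = Phi (mass w) (U w)"

lemma mass_pos:
  assumes "Lp_fun p M w" "U w t \<noteq> 0"
  shows "mass w > 0"
proof (rule ccontr)
  assume "\<not> mass w > 0"
  then have "mass w = 0" using Lp_mass_nonneg[of p M w] by linarith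
  then show False using U_sup[OF assms(1), of t] assms(2) by simp
qed

lemma NN_scale:
  assumes w: "W w" "t \<in> {0..T}" "U w t \<noteq> 0" and s: "s > 0" "hN (mass w) (U w) s = 0"
  shows "NN (\<lambda>t. s * w t)" "level (\<lambda>t. s * w t) = Phi (s powr p * mass w) (\<lambda>t. s * U w t)"
proof -
  have m: "mass (\<lambda>t. s * w t) = s powr p * mass w" using s by (simp add: Lp_mass_scale)
  have u: "U (\<lambda>t. s * w t) = (\<lambda>t. s * U w t)" by (rule U_scale[OF W_Lp[OF w(1)]])
  show "level (\<lambda>t. s * w t) = Phi (s powr p * mass w) (\<lambda>t. s * U w t)"
    by (simp add: level_def m u)
  have "gN (s powr p * mass w) (\<lambda>t. s * U w t) = 0"
    using gN_scale[where B = "mass w" and y = "U w", OF s(1)] s(2) by simp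
  moreover have "s * U w t \<noteq> 0" using s w by simp
  ultimately show "NN (\<lambda>t. s * w t)"
    unfolding NN_def m u using W_scale[OF w(1)] w(2) by blast
qed

lemma NN_nonempty: obtains w where "NN w"
proof -
  obtain w t where w: "W w" "t \<in> {0..T}" "U w t \<noteq> 0" using W_nontrivial by blast
  obtain s where "s > 0" "hN (mass w) (U w) s = 0"
    using hN_zero_exists[OF U_continuous_on[OF W_Lp[OF w(1)]] w(2,3) mass_pos[OF W_Lp[OF w(1)] w(3)]] by blast
  then show ?thesis using NN_scale(1)[OF w] that by blast
qed

text \<open>If \<open>U w\<close> were small everywhere, (ii) and the sup bound would make
  \<open>Sf (U w)\<close> at most half of a^(p-1) times the mass, although membership forces it to
  be at least all of that. The bound concerns the function, since it is the uniform limit that must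
  not vanish.\<close>

lemma NN_bounded_away:
  obtains d where "d > 0" "\<And>w. NN w \<Longrightarrow> \<exists>t\<in>{0..T}. \<bar>U w t\<bar> \<ge> d"
proof -
  \<comment> \<open>The added 1 makes the divisor in e positive even if \<open>KS\<close> is
    0.\<close>
  define X where "X = KS powr p * T + 1"
  have X: "X > 0" using T by (simp add: X_def add_nonneg_pos)
  define e where "e = a powr (p - 1) / (2 * X)"
  have e: "e > 0" using a X by (simp add: e_def)
  obtain d where d: "d > 0" "\<And>t x. t \<in> {0..T} \<Longrightarrow> \<bar>x\<bar> < d \<Longrightarrow> \<bar>f t x * x\<bar> \<le> e * \<bar>x\<bar> powr p"
    using f_small_times[OF e] by blast
  have "\<exists>t\<in>{0..T}. \<bar>U w t\<bar> \<ge> d" if NNw: "NN w" for w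
  proof (rule ccontr)
    assume neg: "\<not> (\<exists>t\<in>{0..T}. \<bar>U w t\<bar> \<ge> d)"
    have wL: "Lp_fun p M w" using NNw by (simp add: NN_def W_Lp)
    obtain t0 where "U w t0 \<noteq> 0" using NNw unfolding NN_def by blast
    then have B: "mass w > 0" by (rule mass_pos[OF wL])
    have "\<bar>Sf (U w)\<bar> \<le> e * (KS * mass w powr (1 / p)) powr p * T"
    proof (rule Sf_abs_le[OF U_continuous_on[OF wL]])
      fix t assume t: "t \<in> {0..T}"
      have "\<bar>U w t\<bar> < d" using neg t by force
      then have "\<bar>f t (U w t) * U w t\<bar> \<le> e * \<bar>U w t\<bar> powr p" by (rule d(2)[OF t])
      also have "\<dots> \<le> e * (KS * mass w powr (1 / p)) powr p"
        using e U_sup[OF wL, of t] p_pos by (intro mult_left_mono powr_mono2) auto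
      finally show "\<bar>f t (U w t) * U w t\<bar> \<le> e * (KS * mass w powr (1 / p)) powr p" .
    qed
    also have "\<dots> = e * (KS powr p * T) * mass w"
      using p_pos B by (simp add: powr_mult powr_powr)
    also have "\<dots> \<le> e * X * mass w"
      using e B by (intro mult_right_mono mult_left_mono) (auto simp: X_def)
    also have "e * X = a powr (p - 1) / 2" using X by (simp add: e_def)
    finally have "Sf (U w) \<le> a powr (p - 1) / 2 * mass w" by linarith
    moreover have "Sf (U w) = (a + b * mass w) powr (p - 1) * mass w"
      using NNw by (simp add: NN_def gN_def)
    moreover have "a powr (p - 1) * mass w \<le> (a + b * mass w) powr (p - 1) * mass w"
      using a b B p by (intro mult_right_mono powr_mono2) auto
    moreover have "a powr (p - 1) * mass w > 0" using a B by simp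
    ultimately show False by linarith
  qed
  then show ?thesis using that d(1) by blast
qed

text \<open>On the Nehari set the radial derivative vanishes, so 1/\<mu> times it may be subtracted
  from the energy. By (iii) the potential terms are then bounded below, and the Kirchhoff term keeps
  the positive factor 1/p^2 - 1/\<mu>.\<close>

lemma NN_coercive:
  obtains k C where "k > 0" "\<And>w. NN w \<Longrightarrow> k * mass w - C \<le> level w"
proof -
  obtain C0 where C0: "C0 > 0" "\<And>t x. t \<in> {0..T} \<Longrightarrow> - C0 \<le> f t x * x / \<mu> - Fprim f t x"
    using f_AR_lower by blast
  define k where "k = a powr (p - 1) * (1 / p^2 - 1 / \<mu>)"
  have dpos: "1 / p^2 - 1 / \<mu> > 0" using AR(1) pp by (simp add: frac_less2)
  have k: "k > 0" using a dpos by (simp add: k_def)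
  define C where "C = a powr p / (b * p^2) + C0 * T"
  interpret finite_measure M by (rule finite_measure_MT)
  have "k * mass w - C \<le> level w" if w: "NN w" for w
  proof -
    define B where "B = mass w"
    have B: "B \<ge> 0" by (simp add: B_def)
    have y: "continuous_on {0..T} (U w)" using w by (intro U_continuous_on) (simp add: NN_def W_Lp)
    have ab: "a + b * B > 0" using a b B by (simp add: add_pos_nonneg)
    define E where "E = (a + b * B) powr (p - 1)"
    have E: "E \<ge> a powr (p - 1)" unfolding E_def using a b B p by (intro powr_mono2) auto
    have Ep: "(a + b * B) powr p = E * (a + b * B)"
      using ab powr_add[of "a + b * B" "p - 1" 1] by (simp add: E_def)
    have S: "Sf (U w) = E * B" using w by (simp add: NN_def gN_def E_def B_def)
    have "- C0 * T = (\<integral>t. - C0 \<partial>M)" using measure_MT by simp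
    also have "\<dots> \<le> (\<integral>t. f t (U w t) * U w t / \<mu> - Fprim f t (U w t) \<partial>M)"
      by (intro integral_mono Bochner_Integration.integrable_diff integrable_divide Sf_integrable PF_integrable y)
        (simp_all add: C0(2))
    also have "\<dots> = (\<integral>t. f t (U w t) * U w t / \<mu> \<partial>M) - PF (U w)"
      unfolding PF_def
      by (intro Bochner_Integration.integral_diff integrable_divide Sf_integrable PF_integrable y)
    also have "\<dots> = Sf (U w) / \<mu> - PF (U w)"
      by (simp add: Sf_def)
    finally have 1: "- C0 * T \<le> E * B / \<mu> - PF (U w)" using S by simp
    have 2: "E * (B / p^2) \<le> (a + b * B) powr p / (b * p^2)"
    proof -
      have "(a + b * B) powr p / (b * p^2) = E * ((a + b * B) / (b * p^2))" by (simp add: Ep)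
      moreover have "B / p^2 \<le> (a + b * B) / (b * p^2)" using a b pp by (simp add: field_simps)
      moreover have "E \<ge> 0" by (simp add: E_def)
      ultimately show ?thesis by (simp only: mult_left_mono)
    qed
    have "k * B \<le> E * (1 / p^2 - 1 / \<mu>) * B"
      unfolding k_def using E dpos B by (intro mult_right_mono) auto
    also have "\<dots> = E * (B / p^2) - E * B / \<mu>" by (simp add: algebra_simps)
    finally have 3: "k * B \<le> E * (B / p^2) - E * B / \<mu>" .
    have "level w = (a + b * B) powr p / (b * p^2) - a powr p / (b * p^2) - PF (U w)"
      by (simp add: level_def Phi_def B_def diff_divide_distrib)
    then show ?thesis using 1 2 3 unfolding C_def B_def[symmetric] by linarith
  qed
  then show ?thesis using that k by blast
qed

lemma NN_level_max:
  assumes "NN w" "r > 0"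
  shows "Phi (r powr p * mass w) (\<lambda>t. r * U w t) \<le> level w"
  unfolding level_def using assms
  by (intro Phi_fiber_max U_continuous_on) (auto simp: NN_def W_Lp)

definition c0 :: real where "c0 = Inf (level ` Collect NN)"

lemma c0_le: "NN w \<Longrightarrow> c0 \<le> level w"
proof -
  assume w: "NN w"
  obtain k C where k: "k > 0" "\<And>w. NN w \<Longrightarrow> k * mass w - C \<le> level w" using NN_coercive by blast
  have "bdd_below (level ` Collect NN)"
  proof (rule bdd_belowI2)
    fix w assume "w \<in> Collect NN"
    moreover have "k * mass w \<ge> 0" using k(1) by simp
    ultimately show "- C \<le> level w" using k(2)[of w] by simp
  qed
  then show ?thesis unfolding c0_def by (intro cInf_lower) (use w in auto)
qed

text \<open>The projections of \<open>z k\<close> onto the Nehari set, whose factors converge by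
  \<open>hN_zero_perturb\<close>. The sequence of factors is exposed because the derivative argument
  for the minimiser needs it, and not only the limit.\<close>

lemma level_lower_limit:
  assumes z: "\<And>k :: nat. W (z k)" and m: "(\<lambda>k. mass (z k)) \<longlonglongrightarrow> B" "B > 0"
    and u: "ptw_conv (\<lambda>k. U (z k)) u" and t0: "t0 \<in> {0..T}" "u t0 \<noteq> 0"
    and s: "s > 0" "hN B u s = 0"
  obtains sk where "sk \<longlonglongrightarrow> s"
    "\<forall>\<^sub>F k in sequentially. sk k > 0 \<and> c0 \<le> Phi (sk k powr p * mass (z k)) (\<lambda>t. sk k * U (z k) t)"
proof -
  obtain sk where sk: "sk \<longlonglongrightarrow> s"
    and ev: "\<forall>\<^sub>F k in sequentially. sk k > 0 \<and> hN (mass (z k)) (U (z k)) (sk k) = 0"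
    using hN_zero_perturb[OF u t0 m s] by blast
  have "(\<lambda>k. \<bar>U (z k) t0\<bar>) \<longlonglongrightarrow> \<bar>u t0\<bar>" using u t0 by (intro tendsto_rabs) (simp add: ptw_conv_def)
  then have "\<forall>\<^sub>F k in sequentially. \<bar>U (z k) t0\<bar> > 0" by (rule order_tendstoD(1)) (use t0 in simp)
  with ev have "\<forall>\<^sub>F k in sequentially. sk k > 0 \<and> c0 \<le> Phi (sk k powr p * mass (z k)) (\<lambda>t. sk k * U (z k) t)"
  proof eventually_elim
    case (elim k)
    have nz: "U (z k) t0 \<noteq> 0" using elim by auto
    have "sk k > 0" "hN (mass (z k)) (U (z k)) (sk k) = 0" using elim by auto
    from NN_scale[OF z t0(1) nz this] c0_le show ?case using elim by metis
  qed
  then show ?thesis using that sk by blast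
qed

text \<open>The infimum bounds limit pairs (B, u) as well, even though no element with mass B and
  function u need be known.\<close>

lemma c0_le_limit:
  assumes z: "\<And>k :: nat. W (z k)" and m: "(\<lambda>k. mass (z k)) \<longlonglongrightarrow> B" "B > 0"
    and u: "ptw_conv (\<lambda>k. U (z k)) u" and t0: "t0 \<in> {0..T}" "u t0 \<noteq> 0"
    and s: "s > 0" "hN B u s = 0"
  shows "c0 \<le> Phi (s powr p * B) (\<lambda>t. s * u t)"
proof -
  obtain sk where sk: "sk \<longlonglongrightarrow> s"
    and ev: "\<forall>\<^sub>F k in sequentially. sk k > 0 \<and> c0 \<le> Phi (sk k powr p * mass (z k)) (\<lambda>t. sk k * U (z k) t)"
    using level_lower_limit[OF assms] by blast
  have "(\<lambda>k. sk k powr p * mass (z k)) \<longlonglongrightarrow> s powr p * B"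
    using s by (intro tendsto_mult tendsto_powr sk tendsto_const m) auto
  then have "(\<lambda>k. Phi (sk k powr p * mass (z k)) (\<lambda>t. sk k * U (z k) t)) \<longlonglongrightarrow> Phi (s powr p * B) (\<lambda>t. s * u t)"
    using m(2) by (intro Phi_tendsto ptw_conv_scale u sk) auto
  then show ?thesis
    by (rule tendsto_lowerbound) (use ev in \<open>auto elim: eventually_mono\<close>)
qed

text \<open>A loss of mass at the same function lowers the energy strictly; this yields the
  contradiction in \<open>midpoint_mass\<close>.\<close>

lemma Phi_strict_mono:
  assumes "0 \<le> B" "B < A"
  shows "Phi B y < Phi A y"
proof -
  have "(a + b * B) powr p < (a + b * A) powr p"
    using a b assms p by (intro powr_less_mono2) auto
  then show ?thesis using b pp unfolding Phi_def by (simp add: divide_strict_right_mono)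
qed

lemma mass_lower_from_U:
  assumes z: "\<And>k :: nat. Lp_fun p M (z k)" and m: "(\<lambda>k. mass (z k)) \<longlonglongrightarrow> B"
    and u: "(\<lambda>k. U (z k) t0) \<longlonglongrightarrow> u0" "u0 \<noteq> 0"
  shows "B > 0"
proof (rule ccontr)
  assume "\<not> B > 0"
  moreover have "B \<ge> 0" by (rule LIMSEQ_le_const[OF m]) simp
  ultimately have "(\<lambda>k. mass (z k)) \<longlonglongrightarrow> 0" using m by simp
  from mass_root_tendsto_0[OF this]
  have "(\<lambda>k. \<bar>U (z k) t0\<bar>) \<longlonglongrightarrow> 0"
    by (rule tendsto_0_squeeze[OF abs_ge_zero U_sup[OF z]])
  then have "(\<lambda>k. U (z k) t0) \<longlonglongrightarrow> 0" by (rule tendsto_rabs_zero_cancel)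
  then show False using u LIMSEQ_unique by blast
qed

lemma bounded_real_subseq:
  fixes x :: "nat \<Rightarrow> real"
  assumes "\<And>n. x n \<in> {c..d}"
  obtains r l where "strict_mono r" "l \<in> {c..d}" "(\<lambda>n. x (r n)) \<longlonglongrightarrow> l"
proof -
  have "seq_compact {c..d}" using compact_Icc compact_eq_seq_compact_metric by blast
  then obtain l r where "l \<in> {c..d}" "strict_mono r" "(x \<circ> r) \<longlonglongrightarrow> l"
    using assms unfolding seq_compact_def by metis
  then show ?thesis using that by (simp add: o_def)
qed

lemma ptw_conv_U:
  assumes z: "\<And>k. Lp_fun p M (z k)" "\<And>k. mass (z k) \<le> B" and u: "continuous_on {0..T} u"
    and lim: "\<And>t. t \<in> {0..T} \<Longrightarrow> (\<lambda>k. U (z k) t) \<longlonglongrightarrow> u t"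
  shows "ptw_conv (\<lambda>k. U (z k)) u"
  unfolding ptw_conv_def
proof (intro conjI allI ballI U_continuous_on z u lim exI[of _ "KS * B powr (1 / p)"])
  fix k t
  have "KS * mass (z k) powr (1 / p) \<le> KS * B powr (1 / p)"
    using z(2)[of k] KS_nonneg p_pos by (intro mult_left_mono powr_mono2) auto
  then show "\<bar>U (z k) t\<bar> \<le> KS * B powr (1 / p)" using U_sup[OF z(1), of k t] by linarith
qed

text \<open>Replaces weak compactness: along a minimising sequence whose functions converge, midpoints
  cannot lose mass, since the fibering map would otherwise push them below the infimum; uniform
  convexity then makes the sequence Cauchy.\<close>

lemma midpoint_mass:
  assumes v: "\<And>n :: nat. W (v n)" and m: "(\<lambda>n. mass (v n)) \<longlonglongrightarrow> A"
    and u: "ptw_conv (\<lambda>n. U (v n)) u" and t0: "t0 \<in> {0..T}" "u t0 \<noteq> 0"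
    and crit: "gN A u = 0" "Phi A u = c0" and e: "e > 0"
  shows "\<exists>K. \<forall>i\<ge>K. \<forall>j\<ge>K. mass (\<lambda>t. 1/2 * v i t + 1/2 * v j t) > A - e"
proof (rule ccontr)
  assume "\<not> ?thesis"
  then have "\<forall>K. \<exists>i j. i \<ge> K \<and> j \<ge> K \<and> mass (\<lambda>t. 1/2 * v i t + 1/2 * v j t) \<le> A - e"
    by (metis not_le)
  then obtain i j where ij: "\<And>K. i K \<ge> K" "\<And>K. j K \<ge> K"
    "\<And>K. mass (\<lambda>t. 1/2 * v (i K) t + 1/2 * v (j K) t) \<le> A - e" by metis
  define z where "z K = (\<lambda>t. 1/2 * v (i K) t + 1/2 * v (j K) t)" for K
  have zW: "W (z K)" for K unfolding z_def by (rule W_lincomb[OF v v])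
  have zL: "Lp_fun p M (z K)" for K by (rule W_Lp[OF zW])
  have Uz: "U (z K) = (\<lambda>t. 1/2 * U (v (i K)) t + 1/2 * U (v (j K)) t)" for K
    unfolding z_def by (rule U_lincomb[OF W_Lp[OF v] W_Lp[OF v]])
  have "mass (z K) \<in> {0..A - e}" for K using ij(3)[of K] by (simp add: z_def)
  then obtain r B where r: "strict_mono r" and B: "B \<in> {0..A - e}" "(\<lambda>K. mass (z (r K))) \<longlonglongrightarrow> B"
    using bounded_real_subseq[of "\<lambda>K. mass (z K)" 0 "A - e"] by blast
  have "filterlim (\<lambda>K. i (r K)) at_top sequentially" "filterlim (\<lambda>K. j (r K)) at_top sequentially"
    by (rule filterlim_at_top_mono[OF filterlim_subseq[OF r]], use ij in simp)+
  note sub = this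
  have uc: "continuous_on {0..T} u" using u by (simp add: ptw_conv_def)
  \<comment> \<open>Both index sequences tend to infinity, so averaging leaves the limit function
    unchanged; only the mass can drop.\<close>
  have lim: "(\<lambda>K. U (z (r K)) t) \<longlonglongrightarrow> u t" if t: "t \<in> {0..T}" for t
  proof -
    have l: "(\<lambda>n. U (v n) t) \<longlonglongrightarrow> u t" using u t by (simp add: ptw_conv_def)
    have "(\<lambda>K. 1/2 * U (v (i (r K))) t + 1/2 * U (v (j (r K))) t) \<longlonglongrightarrow> 1/2 * u t + 1/2 * u t"
      by (intro tendsto_add tendsto_mult tendsto_const filterlim_compose[OF l] sub)
    then show ?thesis by (simp add: Uz)
  qed
  have conv: "ptw_conv (\<lambda>K. U (z (r K))) u"
    by (rule ptw_conv_U[where B = "A - e", OF zL _ uc lim]) (use ij(3) in \<open>simp add: z_def\<close>)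
  have Bpos: "B > 0" by (rule mass_lower_from_U[OF zL B(2) lim[OF t0(1)] t0(2)])
  \<comment> \<open>The factor belongs to (B, u), yet the chain applies it to (A, u) too: there the
    dilation factor 1 is optimal, so dilating by s cannot raise the energy above c0.\<close>
  obtain s where s: "s > 0" "hN B u s = 0" using hN_zero_exists[OF uc t0 Bpos] by blast
  have "c0 \<le> Phi (s powr p * B) (\<lambda>t. s * u t)"
    by (rule c0_le_limit[OF zW B(2) Bpos conv t0 s])
  also have "\<dots> < Phi (s powr p * A) (\<lambda>t. s * u t)"
    using B(1) Bpos s(1) e by (intro Phi_strict_mono) auto
  also have "\<dots> \<le> Phi A u"
    using B(1) e by (intro Phi_fiber_max uc crit s) auto
  finally show False using crit(2) by simp
qed

text \<open>The pointwise inequality integrated; the term with weight e stays small along sequences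
  of bounded mass.\<close>

lemma Lp_mass_uniform_convexity:
  assumes "e > 0"
  obtains C where "C \<ge> 0" "\<And>v w. Lp_fun p M v \<Longrightarrow> Lp_fun p M w \<Longrightarrow>
    mass (\<lambda>t. v t - w t) \<le> e * (mass v + mass w) + C * ((mass v + mass w) / 2 - mass (\<lambda>t. 1/2 * v t + 1/2 * w t))"
proof -
  obtain C where C: "C \<ge> 0" "\<And>x y. \<bar>x - y\<bar> powr p \<le> e * (\<bar>x\<bar> powr p + \<bar>y\<bar> powr p)
           + C * ((\<bar>x\<bar> powr p + \<bar>y\<bar> powr p) / 2 - \<bar>(x + y) / 2\<bar> powr p)"
    using abs_powr_uniform_convexity[OF p assms] by blast
  have "mass (\<lambda>t. v t - w t) \<le> e * (mass v + mass w) + C * ((mass v + mass w) / 2 - mass (\<lambda>t. 1/2 * v t + 1/2 * w t))"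
    if L: "Lp_fun p M v" "Lp_fun p M w" for v w
  proof -
    have mid: "(\<lambda>t. 1/2 * v t + 1/2 * w t) = (\<lambda>t. (v t + w t) / 2)" by (simp add: fun_eq_iff add_divide_distrib)
    have "Lp_fun p M (\<lambda>t. 1/2 * v t + 1/2 * w t)" by (intro Lp_fun_add Lp_fun_scale L p_pos)
    then have i3: "integrable M (\<lambda>t. \<bar>(v t + w t) / 2\<bar> powr p)" unfolding mid by (rule Lp_fun_integrable)
    note i1 = Lp_fun_integrable[OF L(1)] and i2 = Lp_fun_integrable[OF L(2)]
    have i4: "integrable M (\<lambda>t. \<bar>v t - w t\<bar> powr p)"
      by (rule Lp_fun_integrable[OF Lp_fun_diff[OF p_pos(2) L]])
    define G where "G t = e * (\<bar>v t\<bar> powr p + \<bar>w t\<bar> powr p)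
           + C * ((\<bar>v t\<bar> powr p + \<bar>w t\<bar> powr p) / 2 - \<bar>(v t + w t) / 2\<bar> powr p)" for t
    have i12: "has_bochner_integral M (\<lambda>t. \<bar>v t\<bar> powr p + \<bar>w t\<bar> powr p) (mass v + mass w)"
      unfolding Lp_mass_def
      by (intro has_bochner_integral_add has_bochner_integral_integrable i1 i2)
    have "has_bochner_integral M G (e * (mass v + mass w)
        + C * ((mass v + mass w) / 2 - mass (\<lambda>t. (v t + w t) / 2)))"
      unfolding G_def
    proof (intro has_bochner_integral_add has_bochner_integral_mult_right has_bochner_integral_diff i12
        has_bochner_integral_divide)
      show "has_bochner_integral M (\<lambda>t. \<bar>(v t + w t) / 2\<bar> powr p) (mass (\<lambda>t. (v t + w t) / 2))"
        unfolding Lp_mass_def by (rule has_bochner_integral_integrable[OF i3])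
    qed (use i1 i2 in \<open>simp_all add: Lp_mass_def has_bochner_integral_integrable\<close>)
    then have G: "integrable M G" "(\<integral>t. G t \<partial>M) = e * (mass v + mass w)
        + C * ((mass v + mass w) / 2 - mass (\<lambda>t. (v t + w t) / 2))"
      by (auto simp: has_bochner_integral_iff)
    have "mass (\<lambda>t. v t - w t) \<le> (\<integral>t. G t \<partial>M)"
      unfolding Lp_mass_def G_def by (rule integral_mono[OF i4 G(1)[unfolded G_def] C(2)])
    then show ?thesis unfolding G mid .
  qed
  then show ?thesis using that C(1) by blast
qed

lemma minimising_Cauchy:
  assumes v: "\<And>n :: nat. W (v n)" and m: "(\<lambda>n. mass (v n)) \<longlonglongrightarrow> A"
    and u: "ptw_conv (\<lambda>n. U (v n)) u" and t0: "t0 \<in> {0..T}" "u t0 \<noteq> 0"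
    and crit: "gN A u = 0" "Phi A u = c0" and e: "e > 0"
  shows "\<exists>K. \<forall>i\<ge>K. \<forall>j\<ge>K. mass (\<lambda>t. v i t - v j t) < e"
proof -
  have A: "A \<ge> 0" by (rule LIMSEQ_le_const[OF m]) simp
  \<comment> \<open>For large indices both masses are below A + 1, so the first term contributes at
    most e / 2.\<close>
  define e1 where "e1 = e / (4 * (A + 1))"
  have e1: "e1 > 0" using A e by (simp add: e1_def)
  obtain C where C: "C \<ge> 0" "\<And>v w. Lp_fun p M v \<Longrightarrow> Lp_fun p M w \<Longrightarrow>
    mass (\<lambda>t. v t - w t) \<le> e1 * (mass v + mass w) + C * ((mass v + mass w) / 2 - mass (\<lambda>t. 1/2 * v t + 1/2 * w t))"
    using Lp_mass_uniform_convexity[OF e1] by blast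
  \<comment> \<open>The midpoint defect is at most 2 e2, so the second term contributes at most e /
    4; the cap 1 gives the mass bound A + 1 used with e1.\<close>
  define e2 where "e2 = min 1 (e / (8 * (C + 1)))"
  have e2: "e2 > 0" "e2 \<le> 1" using C(1) e by (simp_all add: e2_def)
  have Ce2: "C * (2 * e2) \<le> e / 4"
  proof -
    have "C * (2 * e2) \<le> (C + 1) * (2 * (e / (8 * (C + 1))))"
      using C(1) e2 by (intro mult_mono) (auto simp: e2_def)
    also have "\<dots> = e / 4" using C(1) by (simp add: field_simps)
    finally show ?thesis .
  qed
  obtain K1 where K1: "\<And>i j. i \<ge> K1 \<Longrightarrow> j \<ge> K1 \<Longrightarrow> mass (\<lambda>t. 1/2 * v i t + 1/2 * v j t) > A - e2"
    using midpoint_mass[OF v m u t0 crit e2(1)] by blast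
  have "\<forall>\<^sub>F n in sequentially. mass (v n) < A + e2" by (rule order_tendstoD(2)[OF m]) (use e2 in simp)
  then obtain K2 where K2: "\<And>n. n \<ge> K2 \<Longrightarrow> mass (v n) < A + e2" unfolding eventually_sequentially by blast
  have "mass (\<lambda>t. v i t - v j t) < e" if "i \<ge> max K1 K2" "j \<ge> max K1 K2" for i j
  proof -
    have mi: "mass (v i) < A + e2" "mass (v j) < A + e2" and mm: "mass (\<lambda>t. 1/2 * v i t + 1/2 * v j t) > A - e2"
      using that K1 K2 by auto
    have "mass (\<lambda>t. v i t - v j t) \<le> e1 * (mass (v i) + mass (v j))
        + C * ((mass (v i) + mass (v j)) / 2 - mass (\<lambda>t. 1/2 * v i t + 1/2 * v j t))"
      by (rule C(2)[OF W_Lp[OF v] W_Lp[OF v]])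
    also have "e1 * (mass (v i) + mass (v j)) \<le> e1 * (2 * (A + 1))"
      using e1 mi e2 by (intro mult_left_mono) auto
    also have "e1 * (2 * (A + 1)) = e / 2" using A by (simp add: e1_def field_simps)
    also have "C * ((mass (v i) + mass (v j)) / 2 - mass (\<lambda>t. 1/2 * v i t + 1/2 * v j t)) \<le> C * (2 * e2)"
    proof (rule mult_left_mono[OF _ C(1)])
      have "x < A + e2 \<Longrightarrow> y < A + e2 \<Longrightarrow> A - e2 < m \<Longrightarrow> (x + y) / 2 - m \<le> 2 * e2" for x y m
        by (simp add: field_simps)
      then show "(mass (v i) + mass (v j)) / 2 - mass (\<lambda>t. 1/2 * v i t + 1/2 * v j t) \<le> 2 * e2"
        using mi mm by blast
    qed
    finally show ?thesis using Ce2 e by linarith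
  qed
  then show ?thesis by blast
qed

text \<open>Criticality and the value c0 pass to the pair (A, u) with uniform convergence alone.
  Only this makes \<open>minimising_Cauchy\<close> applicable, and completeness then provides an
  actual element.\<close>

lemma minimiser_exists:
  obtains w where "NN w" "\<And>v. NN v \<Longrightarrow> level w \<le> level v"
proof -
  obtain w0 where w0: "NN w0" using NN_nonempty by blast
  have "\<exists>w. NN w \<and> level w < c0 + 1 / real (Suc n)" for n
  proof -
    have "Inf (level ` Collect NN) < c0 + 1 / real (Suc n)" by (simp add: c0_def)
    then show ?thesis using cInf_lessD[of "level ` Collect NN"] w0 by blast
  qed
  then obtain wn where wn: "\<And>n. NN (wn n)" "\<And>n. level (wn n) < c0 + 1 / real (Suc n)" by metis
  have wnW: "W (wn n)" for n using wn(1) by (simp add: NN_def)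
  have wnL: "Lp_fun p M (wn n)" for n by (rule W_Lp[OF wnW])
  obtain k C where k: "k > 0" "\<And>w. NN w \<Longrightarrow> k * mass w - C \<le> level w" using NN_coercive by blast
  \<comment> \<open>Coercivity solved for the mass, for levels up to c0 + 1.\<close>
  define B0 where "B0 = (c0 + 1 + C) / k"
  have bnd: "mass (wn n) \<le> B0" for n
  proof -
    have "1 / real (Suc n) \<le> 1" by simp
    then have "k * mass (wn n) \<le> c0 + 1 + C" using k(2)[OF wn(1), of n] wn(2)[of n] by linarith
    then show ?thesis using k(1) by (simp add: B0_def field_simps)
  qed
  obtain u r1 where uc: "continuous_on {0..T} u" and r1: "strict_mono (r1 :: nat \<Rightarrow> nat)"
    and unif': "\<forall>e>0. \<exists>N. \<forall>n\<ge>N. \<forall>t\<in>{0..T}. \<bar>U (wn (r1 n)) t - u t\<bar> < e"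
    by (rule U_compact[OF wnL bnd])
  have unif: "\<exists>N. \<forall>n\<ge>N. \<forall>t\<in>{0..T}. \<bar>U (wn (r1 n)) t - u t\<bar> < e" if "e > 0" for e
    using unif' that by blast
  have "mass (wn (r1 n)) \<in> {0..B0}" for n using bnd by simp
  then obtain r2 A where r2: "strict_mono r2" and A0: "A \<in> {0..B0}" and A: "(\<lambda>n. mass (wn (r1 (r2 n)))) \<longlonglongrightarrow> A"
    using bounded_real_subseq[of "\<lambda>n. mass (wn (r1 n))" 0 B0] by blast
  define v where "v n = wn (r1 (r2 n))" for n
  have vN: "NN (v n)" for n unfolding v_def by (rule wn(1))
  have vW: "W (v n)" for n using vN by (simp add: NN_def)
  have vL: "Lp_fun p M (v n)" for n by (rule W_Lp[OF vW])
  have vm: "(\<lambda>n. mass (v n)) \<longlonglongrightarrow> A" using A by (simp add: v_def)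
  have vb: "mass (v n) \<le> B0" for n unfolding v_def by (rule bnd)
  have lim: "(\<lambda>n. U (v n) t) \<longlonglongrightarrow> u t" if t: "t \<in> {0..T}" for t
  proof -
    have "(\<lambda>n. U (wn (r1 n)) t) \<longlonglongrightarrow> u t"
    proof (rule LIMSEQ_I)
      fix e :: real assume "e > 0"
      then show "\<exists>N. \<forall>n\<ge>N. norm (U (wn (r1 n)) t - u t) < e" using unif[of e] t by (metis real_norm_def)
    qed
    then show ?thesis unfolding v_def by (rule LIMSEQ_subseq_LIMSEQ[OF _ r2, unfolded o_def])
  qed
  have conv: "ptw_conv (\<lambda>n. U (v n)) u" by (rule ptw_conv_U[OF vL vb uc lim])
  \<comment> \<open>A uniform limit of functions that each reach the size d somewhere cannot vanish
    identically.\<close>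
  obtain t0 where t0: "t0 \<in> {0..T}" "u t0 \<noteq> 0"
  proof -
    obtain d where d: "d > 0" "\<And>w. NN w \<Longrightarrow> \<exists>t\<in>{0..T}. \<bar>U w t\<bar> \<ge> d" using NN_bounded_away by blast
    obtain N where N: "\<forall>n\<ge>N. \<forall>t\<in>{0..T}. \<bar>U (wn (r1 n)) t - u t\<bar> < d" using unif[OF d(1)] by blast
    obtain t where t: "t \<in> {0..T}" "\<bar>U (wn (r1 N)) t\<bar> \<ge> d" using d(2)[OF wn(1)] by blast
    have "\<bar>U (wn (r1 N)) t - u t\<bar> < d" using N t(1) by simp
    then have "u t \<noteq> 0" using t(2) by auto
    then show ?thesis using that t(1) by blast
  qed
  have gN0: "gN A u = 0"
  proof -
    have "(\<lambda>n. gN (mass (v n)) (U (v n))) \<longlonglongrightarrow> gN A u" using A0 by (intro gN_tendsto vm conv) simp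
    moreover have "gN (mass (v n)) (U (v n)) = 0" for n using vN by (simp add: NN_def)
    ultimately show ?thesis by (simp add: LIMSEQ_const_iff)
  qed
  have lev: "(\<lambda>n. level (v n)) \<longlonglongrightarrow> c0"
  proof -
    have "(\<lambda>n. level (wn n)) \<longlonglongrightarrow> c0"
    proof (rule LIM_zero_cancel, rule tendsto_0_squeeze)
      show "0 \<le> level (wn n) - c0" for n using c0_le[OF wn(1)] by simp
      show "level (wn n) - c0 \<le> 1 / real (Suc n)" for n using wn(2)[of n] by linarith
      show "(\<lambda>n. 1 / real (Suc n)) \<longlonglongrightarrow> 0" by (rule LIMSEQ_Suc[OF lim_1_over_n])
    qed
    from LIMSEQ_subseq_LIMSEQ[OF LIMSEQ_subseq_LIMSEQ[OF this r1] r2]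
    show ?thesis by (simp add: v_def o_def)
  qed
  have "(\<lambda>n. level (v n)) \<longlonglongrightarrow> Phi A u" unfolding level_def using A0 by (intro Phi_tendsto vm conv) simp
  then have Phi0: "Phi A u = c0" using lev LIMSEQ_unique by blast
  obtain w where w: "W w" "(\<lambda>n. mass (\<lambda>t. v n t - w t)) \<longlonglongrightarrow> 0"
    using W_complete[OF vW minimising_Cauchy[OF vW vm conv t0 gN0 Phi0]] by blast
  have wL: "Lp_fun p M w" by (rule W_Lp[OF w(1)])
  have wm: "(\<lambda>n. mass (v n)) \<longlonglongrightarrow> mass w" by (rule Lp_mass_tendsto[OF p_pos(1) wL vL w(2)])
  have limw: "(\<lambda>n. U (v n) t) \<longlonglongrightarrow> U w t" for t
  proof (rule LIM_zero_cancel, rule tendsto_rabs_zero_cancel)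
    show "(\<lambda>n. \<bar>U (v n) t - U w t\<bar>) \<longlonglongrightarrow> 0"
      by (rule tendsto_0_squeeze[OF abs_ge_zero U_diff_le[OF vL wL] mass_root_tendsto_0[OF w(2)]])
  qed
  have convw: "ptw_conv (\<lambda>n. U (v n)) (U w)"
    by (rule ptw_conv_U[OF vL vb U_continuous_on[OF wL] limw])
  have "U w t0 = u t0" using limw lim[OF t0(1)] LIMSEQ_unique by blast
  moreover have "gN (mass w) (U w) = 0"
  proof -
    have "(\<lambda>n. gN (mass (v n)) (U (v n))) \<longlonglongrightarrow> gN (mass w) (U w)" by (intro gN_tendsto wm convw Lp_mass_nonneg)
    moreover have "gN (mass (v n)) (U (v n)) = 0" for n using vN by (simp add: NN_def)
    ultimately show ?thesis by (simp add: LIMSEQ_const_iff)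
  qed
  ultimately have "NN w" using t0 w(1) unfolding NN_def by metis
  moreover have "level w = c0"
  proof -
    have "(\<lambda>n. level (v n)) \<longlonglongrightarrow> level w" unfolding level_def by (intro Phi_tendsto wm convw Lp_mass_nonneg)
    then show ?thesis using lev LIMSEQ_unique by blast
  qed
  ultimately show ?thesis using that c0_le by metis
qed

section \<open>Minimisers are critical points\<close>

lemma phi_p_mult_integrable:
  assumes "Lp_fun p M w" "Lp_fun p M v"
  shows "integrable M (\<lambda>t. phi_p p (w t) * v t)"
    and "\<bar>phi_p p (w t) * v t\<bar> \<le> \<bar>\<bar>w t\<bar> + \<bar>v t\<bar>\<bar> powr p"
proof -
  have [measurable]: "w \<in> borel_measurable M" "v \<in> borel_measurable M" using assms by (auto simp: Lp_fun_def)
  have le: "\<bar>phi_p p (w t) * v t\<bar> \<le> \<bar>\<bar>w t\<bar> + \<bar>v t\<bar>\<bar> powr p" for t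
  proof (cases "\<bar>w t\<bar> + \<bar>v t\<bar> = 0")
    case False
    have "\<bar>phi_p p (w t) * v t\<bar> = \<bar>w t\<bar> powr (p - 1) * \<bar>v t\<bar>" by (simp add: abs_mult abs_phi_p)
    also have "\<dots> \<le> (\<bar>w t\<bar> + \<bar>v t\<bar>) powr (p - 1) * (\<bar>w t\<bar> + \<bar>v t\<bar>)"
      using p by (intro mult_mono powr_mono2) auto
    also have "\<dots> = (\<bar>w t\<bar> + \<bar>v t\<bar>) powr p"
      using False powr_add[of "\<bar>w t\<bar> + \<bar>v t\<bar>" "p - 1" 1] by simp
    finally show ?thesis by simp
  qed (auto simp: phi_p_def)
  then show "\<bar>phi_p p (w t) * v t\<bar> \<le> \<bar>\<bar>w t\<bar> + \<bar>v t\<bar>\<bar> powr p" .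
  have "Lp_fun p M (\<lambda>t. \<bar>w t\<bar>)" "Lp_fun p M (\<lambda>t. \<bar>v t\<bar>)" using assms by (auto simp: Lp_fun_def)
  then have "integrable M (\<lambda>t. \<bar>\<bar>w t\<bar> + \<bar>v t\<bar>\<bar> powr p)"
    by (intro Lp_fun_integrable Lp_fun_add p_pos)
  moreover have "(\<lambda>t. phi_p p (w t) * v t) \<in> borel_measurable M" unfolding phi_p_eq_sgn by measurable
  ultimately show "integrable M (\<lambda>t. phi_p p (w t) * v t)"
    by (rule Bochner_Integration.integrable_bound) (intro AE_I2, use le in simp)
qed

definition dJ :: "(real \<Rightarrow> real) \<Rightarrow> (real \<Rightarrow> real) \<Rightarrow> real" where
  "dJ w v = (a + b * mass w) powr (p - 1) * (\<integral>t. phi_p p (w t) * v t \<partial>M) - (\<integral>t. f t (U w t) * U v t \<partial>M)"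

lemma phi_p_mult_tendsto:
  assumes w: "Lp_fun p M w" and v: "Lp_fun p M v"
    and s: "s \<longlonglongrightarrow> 0" "\<And>k :: nat. 0 \<le> s k \<and> s k \<le> 1"
  shows "(\<lambda>k. \<integral>t. phi_p p (w t + s k * v t) * v t \<partial>M) \<longlonglongrightarrow> (\<integral>t. phi_p p (w t) * v t \<partial>M)"
proof (rule integral_dominated_convergence)
  have abs: "Lp_fun p M (\<lambda>t. \<bar>w t\<bar>)" "Lp_fun p M (\<lambda>t. \<bar>v t\<bar>)" using w v by (auto simp: Lp_fun_def)
  \<comment> \<open>The factor 2 covers one copy of v from the argument w + s v with s \<le> 1 and
    one from the multiplier.\<close>
  show "integrable M (\<lambda>t. \<bar>\<bar>w t\<bar> + 2 * \<bar>v t\<bar>\<bar> powr p)"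
    by (intro Lp_fun_integrable Lp_fun_add Lp_fun_scale p_pos abs)
  have L: "Lp_fun p M (\<lambda>t. w t + s k * v t)" for k by (intro Lp_fun_add Lp_fun_scale p_pos w v)
  show "(\<lambda>t. phi_p p (w t) * v t) \<in> borel_measurable M"
    by (rule borel_measurable_integrable[OF phi_p_mult_integrable(1)[OF w v]])
  show "(\<lambda>t. phi_p p (w t + s k * v t) * v t) \<in> borel_measurable M" for k
    by (rule borel_measurable_integrable[OF phi_p_mult_integrable(1)[OF L v]])
  show "AE t in M. norm (phi_p p (w t + s k * v t) * v t) \<le> \<bar>\<bar>w t\<bar> + 2 * \<bar>v t\<bar>\<bar> powr p" for k
  proof (intro AE_I2)
    fix t
    have "\<bar>s k * v t\<bar> \<le> 1 * \<bar>v t\<bar>" unfolding abs_mult using s(2)[of k] by (intro mult_right_mono) auto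
    then have "\<bar>w t + s k * v t\<bar> + \<bar>v t\<bar> \<le> \<bar>w t\<bar> + 2 * \<bar>v t\<bar>"
      using abs_triangle_ineq[of "w t" "s k * v t"] by linarith
    then have "\<bar>\<bar>w t + s k * v t\<bar> + \<bar>v t\<bar>\<bar> powr p \<le> \<bar>\<bar>w t\<bar> + 2 * \<bar>v t\<bar>\<bar> powr p"
      by (intro powr_mono2[OF p_pos(2) abs_ge_zero] order_trans[OF _ abs_ge_self]) simp
    with phi_p_mult_integrable(2)[OF L[of k] v, of t]
    show "norm (phi_p p (w t + s k * v t) * v t) \<le> \<bar>\<bar>w t\<bar> + 2 * \<bar>v t\<bar>\<bar> powr p"
      unfolding real_norm_def by (rule order_trans)
  qed
  show "AE t in M. (\<lambda>k. phi_p p (w t + s k * v t) * v t) \<longlonglongrightarrow> phi_p p (w t) * v t"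
  proof (intro AE_I2 tendsto_mult tendsto_const isCont_tendsto_compose[OF isCont_phi_p[OF p]])
    fix t
    have "(\<lambda>k. w t + s k * v t) \<longlonglongrightarrow> w t + 0 * v t" by (intro tendsto_add tendsto_mult tendsto_const s)
    then show "(\<lambda>k. w t + s k * v t) \<longlonglongrightarrow> w t" by simp
  qed
qed

text \<open>Both terms carry the same dilation \<open>r k\<close>, so the mean value theorem writes
  the quotient as r y f(t, z) with z tending to x; only r -> 1 enters, not its speed.\<close>

lemma PF_quotient_tendsto:
  assumes x: "continuous_on {0..T} x" and y: "continuous_on {0..T} y"
    and s: "s \<longlonglongrightarrow> 0" "\<And>k :: nat. 0 < s k \<and> s k \<le> 1" and r: "r \<longlonglongrightarrow> 1"
  shows "(\<lambda>k. (PF (\<lambda>t. r k * (x t + s k * y t)) - PF (\<lambda>t. r k * x t)) / s k)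
    \<longlonglongrightarrow> (\<integral>t. f t (x t) * y t \<partial>M)"
proof -
  interpret finite_measure M by (rule finite_measure_MT)
  have c: "continuous_on {0..T} (\<lambda>t. r k * (x t + s k * y t))" "continuous_on {0..T} (\<lambda>t. r k * x t)" for k
    by (intro continuous_on_mult continuous_on_add continuous_on_const x y)+
  define Q where "Q k t = (Fprim f t (r k * (x t + s k * y t)) - Fprim f t (r k * x t)) / s k" for k t
  have Q_int: "integrable M (Q k)" for k
    unfolding Q_def by (intro integrable_divide Bochner_Integration.integrable_diff PF_integrable c)
  have Q: "(PF (\<lambda>t. r k * (x t + s k * y t)) - PF (\<lambda>t. r k * x t)) / s k = (\<integral>t. Q k t \<partial>M)" for k
    unfolding Q_def PF_def using Bochner_Integration.integral_diff[OF PF_integrable[OF c(1)] PF_integrable[OF c(2)], of k k]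
    by simp
  obtain X where X: "X > 0" "\<And>t. t \<in> {0..T} \<Longrightarrow> \<bar>x t\<bar> \<le> X" using continuous_on_bounded_Icc[OF x] by blast
  obtain Y where Y: "Y > 0" "\<And>t. t \<in> {0..T} \<Longrightarrow> \<bar>y t\<bar> \<le> Y" using continuous_on_bounded_Icc[OF y] by blast
  have "Bseq r" using r convergentI convergent_imp_Bseq by blast
  then obtain L where L: "L > 0" "\<And>k. \<bar>r k\<bar> \<le> L" by (auto simp: Bseq_def)
  obtain B where B: "B > 0" "\<And>t x. t \<in> {0..T} \<Longrightarrow> \<bar>x\<bar> \<le> L * X + L * Y \<Longrightarrow> \<bar>f t x\<bar> \<le> B"
    using compact_bound[OF f_cont] by blast
  have mv: "\<exists>z. \<bar>z - r k * x t\<bar> \<le> \<bar>r k * s k * y t\<bar> \<and> Q k t = r k * y t * f t z" if t: "t \<in> {0..T}" for k t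
  proof -
    obtain z where z: "\<bar>z - r k * x t\<bar> \<le> \<bar>r k * s k * y t\<bar>"
      "Fprim f t (r k * x t + r k * s k * y t) - Fprim f t (r k * x t) = r k * s k * y t * f t z"
      using DERIV_mean_value[OF Fprim_deriv[OF t]] by blast
    have "r k * (x t + s k * y t) = r k * x t + r k * s k * y t" by (simp add: algebra_simps)
    then have "Q k t = r k * s k * y t * f t z / s k" using z(2) by (simp add: Q_def)
    also have "\<dots> = r k * y t * f t z" using s(2)[of k] by simp
    finally show ?thesis using z(1) by blast
  qed
  have "(\<lambda>k. \<integral>t. Q k t \<partial>M) \<longlonglongrightarrow> (\<integral>t. f t (x t) * y t \<partial>M)"
  proof (rule integral_dominated_convergence[where w = "\<lambda>_. L * Y * B"])
    show "Q k \<in> borel_measurable M" for k by (rule borel_measurable_integrable[OF Q_int])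
    show "(\<lambda>t. f t (x t) * y t) \<in> borel_measurable M"
      by (intro continuous_on_borel_measurable_MT continuous_on_mult y comp_continuous_on[OF f_cont x])
    show "AE t in M. norm (Q k t) \<le> L * Y * B" for k
    proof (rule AE_I2)
      fix t assume "t \<in> space M"
      then have t: "t \<in> {0..T}" by simp
      obtain z where z: "\<bar>z - r k * x t\<bar> \<le> \<bar>r k * s k * y t\<bar>" "Q k t = r k * y t * f t z" using mv[OF t] by blast
      have 1: "\<bar>r k * x t\<bar> \<le> L * X" unfolding abs_mult using L X(2)[OF t] by (intro mult_mono) auto
      have 2: "\<bar>r k * y t\<bar> \<le> L * Y" unfolding abs_mult using L Y(2)[OF t] by (intro mult_mono) auto
      have "\<bar>r k * s k * y t\<bar> = s k * \<bar>r k * y t\<bar>" using s(2)[of k] by (simp add: abs_mult)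
      also have "\<dots> \<le> 1 * \<bar>r k * y t\<bar>" using s(2)[of k] by (intro mult_right_mono) auto
      finally have "\<bar>z\<bar> \<le> L * X + L * Y" using z(1) 1 2 by linarith
      then have "\<bar>f t z\<bar> \<le> B" by (rule B(2)[OF t])
      then show "norm (Q k t) \<le> L * Y * B"
        unfolding z(2) real_norm_def abs_mult[of "r k * y t"] using 2 L(1) Y(1) by (intro mult_mono) auto
    qed
    show "AE t in M. (\<lambda>k. Q k t) \<longlonglongrightarrow> f t (x t) * y t"
    proof (rule AE_I2)
      fix t assume "t \<in> space M"
      then have t: "t \<in> {0..T}" by simp
      obtain z where z: "\<And>k. \<bar>z k - r k * x t\<bar> \<le> \<bar>r k * s k * y t\<bar>" "\<And>k. Q k t = r k * y t * f t (z k)"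
        using mv[OF t] by metis
      have "(\<lambda>k. \<bar>r k * s k * y t\<bar>) \<longlonglongrightarrow> \<bar>1 * 0 * y t\<bar>" by (intro tendsto_rabs tendsto_mult tendsto_const r s)
      then have "(\<lambda>k. \<bar>z k - r k * x t\<bar>) \<longlonglongrightarrow> 0"
        by (intro tendsto_0_squeeze[OF abs_ge_zero z(1)]) simp
      then have "(\<lambda>k. z k - r k * x t) \<longlonglongrightarrow> 0" by (rule tendsto_rabs_zero_cancel)
      from tendsto_add[OF this tendsto_mult[OF r tendsto_const[of "x t"]]]
      have "z \<longlonglongrightarrow> x t" by simp
      moreover have "isCont (f t) (x t)" using f_isCont[OF t, of UNIV] by (simp add: continuous_on_eq_continuous_at)
      ultimately have "(\<lambda>k. f t (z k)) \<longlonglongrightarrow> f t (x t)" using isCont_tendsto_compose by blast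
      from tendsto_mult[OF tendsto_mult[OF r tendsto_const[of "y t"]] this]
      show "(\<lambda>k. Q k t) \<longlonglongrightarrow> f t (x t) * y t" by (simp add: z(2) mult.commute)
    qed
  qed simp
  then show ?thesis by (simp add: Q)
qed

lemma mass_tangent:
  assumes w: "Lp_fun p M w" and v: "Lp_fun p M v"
  shows "mass w - mass v \<le> p * (\<integral>t. phi_p p (w t) * (w t - v t) \<partial>M)"
proof -
  have d: "Lp_fun p M (\<lambda>t. w t - v t)" by (rule Lp_fun_diff[OF p_pos(2) w v])
  have "mass w - mass v = (\<integral>t. \<bar>w t\<bar> powr p - \<bar>v t\<bar> powr p \<partial>M)"
    unfolding Lp_mass_def
    by (rule Bochner_Integration.integral_diff[OF Lp_fun_integrable[OF w] Lp_fun_integrable[OF v], symmetric])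
  also have "\<dots> \<le> (\<integral>t. p * (phi_p p (w t) * (w t - v t)) \<partial>M)"
  proof (rule integral_mono)
    show "integrable M (\<lambda>t. \<bar>w t\<bar> powr p - \<bar>v t\<bar> powr p)"
      by (intro Bochner_Integration.integrable_diff Lp_fun_integrable w v)
    show "integrable M (\<lambda>t. p * (phi_p p (w t) * (w t - v t)))"
      by (intro integrable_mult_right phi_p_mult_integrable(1) w d)
    show "\<bar>w t\<bar> powr p - \<bar>v t\<bar> powr p \<le> p * (phi_p p (w t) * (w t - v t))" for t
      using abs_powr_tangent[OF p, of "w t" "v t"] by (simp add: mult.assoc)
  qed
  also have "\<dots> = p * (\<integral>t. phi_p p (w t) * (w t - v t) \<partial>M)" by (rule integral_mult_right_zero)
  finally show ?thesis .
qed

text \<open>The minimiser \<open>w\<close> is perturbed to \<open>w + s v\<close> and projected back onto the Nehari manifold by a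
  factor \<open>r\<close> close to 1. Comparing with \<open>r w\<close>, which has at most the minimal energy, removes
  any need to differentiate \<open>r\<close> in \<open>s\<close>.\<close>

lemma minimiser_dJ_nonneg:
  assumes w: "NN w" "\<And>v. NN v \<Longrightarrow> level w \<le> level v" and v: "W v"
  shows "dJ w v \<ge> 0"
proof -
  define A where "A = mass w"
  have wW: "W w" using w(1) by (simp add: NN_def)
  note wL = W_Lp[OF wW] and vL = W_Lp[OF v]
  obtain t0 where t0: "t0 \<in> {0..T}" "U w t0 \<noteq> 0" using w(1) unfolding NN_def by blast
  have A: "A > 0" unfolding A_def by (rule mass_pos[OF wL t0(2)])
  have lev_c0: "level w = c0"
  proof (rule antisym)
    show "level w \<le> c0" unfolding c0_def by (rule cInf_greatest) (use w in auto)
  qed (rule c0_le[OF w(1)])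
  define s where "s k = 1 / real (Suc k)" for k
  have s: "s \<longlonglongrightarrow> 0" "0 < s k \<and> s k \<le> 1" for k
    unfolding s_def by (rule LIMSEQ_Suc[OF lim_1_over_n]) simp
  define z where "z k = (\<lambda>t. 1 * w t + s k * v t)" for k
  have zW: "W (z k)" for k unfolding z_def by (rule W_lincomb[OF wW v])
  note zL = W_Lp[OF zW]
  have Uz: "U (z k) = (\<lambda>t. U w t + s k * U v t)" for k
    using U_lincomb[OF wL vL, of 1 "s k"] by (simp add: z_def)
  have z_eq: "z k t = w t + s k * v t" for k t by (simp add: z_def)
  have zm: "(\<lambda>k. mass (z k)) \<longlonglongrightarrow> A"
    unfolding A_def
  proof (rule Lp_mass_tendsto[OF p_pos(1) wL zL])
    have "mass (\<lambda>t. z k t - w t) = s k powr p * mass v" for k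
      using s(2)[of k] by (simp add: z_eq Lp_mass_scale)
    moreover have "(\<lambda>k. s k powr p * mass v) \<longlonglongrightarrow> 0 powr p * mass v"
      by (intro tendsto_mult tendsto_const tendsto_powr'[OF s(1) tendsto_const])
        (use s(2) p_pos in \<open>simp add: less_imp_le\<close>)
    ultimately show "(\<lambda>k. mass (\<lambda>t. z k t - w t)) \<longlonglongrightarrow> 0" by simp
  qed
  have conv: "ptw_conv (\<lambda>k. U (z k)) (U w)"
  proof -
    have "Bseq (\<lambda>k. mass (z k))" using zm convergentI convergent_imp_Bseq by blast
    then obtain B where B: "\<And>k. norm (mass (z k)) \<le> B" unfolding Bseq_def by blast
    have "(\<lambda>k. U w t + s k * U v t) \<longlonglongrightarrow> U w t + 0 * U v t" for t
      by (intro tendsto_add tendsto_mult tendsto_const s)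
    then have "(\<lambda>k. U (z k) t) \<longlonglongrightarrow> U w t" for t by (simp add: Uz)
    then show ?thesis using B by (intro ptw_conv_U[OF zL _ U_continuous_on[OF wL]]) auto
  qed
  have "hN A (U w) 1 = 0" using w(1) by (simp add: hN_1 NN_def A_def)
  then obtain r where r: "r \<longlonglongrightarrow> 1"
    and ev: "\<forall>\<^sub>F k in sequentially. r k > 0 \<and> c0 \<le> Phi (r k powr p * mass (z k)) (\<lambda>t. r k * U (z k) t)"
    using level_lower_limit[OF zW zm A conv t0, of 1] by auto
  define P where "P k = (\<integral>t. phi_p p (w t + s k * v t) * v t \<partial>M)" for k
  define Q where "Q k = (PF (\<lambda>t. r k * (U w t + s k * U v t)) - PF (\<lambda>t. r k * U w t)) / s k" for k
  define G where "G k = (a + b * (r k powr p * mass (z k))) powr (p - 1) * r k powr p" for k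
  have main: "\<forall>\<^sub>F k in sequentially. 0 \<le> G k * P k - Q k"
    using ev
  proof eventually_elim
    case (elim k)
    have rk: "r k > 0" and sk: "s k > 0" using elim s(2) by auto
    define x where "x = r k powr p * mass (z k)"
    define y where "y = r k powr p * A"
    have x0: "a + b * x > 0" and y0: "a + b * y > 0"
      using a b A unfolding x_def y_def by (auto intro!: add_pos_nonneg mult_nonneg_nonneg)
    have "Phi y (\<lambda>t. r k * U w t) \<le> Phi x (\<lambda>t. r k * U (z k) t)"
      using NN_level_max[OF w(1) rk] elim lev_c0 unfolding x_def y_def A_def by linarith
    then have 1: "PF (\<lambda>t. r k * U (z k) t) - PF (\<lambda>t. r k * U w t) \<le> ((a + b * x) powr p - (a + b * y) powr p) / (b * p^2)"
      unfolding Phi_def diff_divide_distrib by linarith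
    \<comment> \<open>The tangent is taken at the perturbed value x, which bounds the increment from
      above; its slope converges because r tends to 1 and the perturbed masses to A.\<close>
    have "(a + b * x) powr p - (a + b * y) powr p \<le> p * (a + b * x) powr (p - 1) * (b * (x - y))"
      using abs_powr_tangent[OF p, of "a + b * x" "a + b * y"] x0 y0
      by (simp add: phi_p_eq_sgn right_diff_distrib)
    then have "((a + b * x) powr p - (a + b * y) powr p) / (b * p^2)
        \<le> (p * (a + b * x) powr (p - 1) * (b * (x - y))) / (b * p^2)"
      using b pp by (intro divide_right_mono) auto
    also have "\<dots> = (a + b * x) powr (p - 1) * (x - y) / p"
      using b p by (simp add: power2_eq_square)
    finally have 2: "((a + b * x) powr p - (a + b * y) powr p) / (b * p^2)
        \<le> (a + b * x) powr (p - 1) * (x - y) / p" .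
    have "mass (z k) - A \<le> p * (\<integral>t. phi_p p (z k t) * (z k t - w t) \<partial>M)"
      unfolding A_def by (rule mass_tangent[OF zL wL])
    also have "(\<integral>t. phi_p p (z k t) * (z k t - w t) \<partial>M) = s k * P k"
      unfolding P_def z_eq integral_mult_right_zero[symmetric] by (simp add: mult_ac)
    finally have "r k powr p * (mass (z k) - A) \<le> r k powr p * (p * (s k * P k))"
      by (intro mult_left_mono) auto
    then have "x - y \<le> r k powr p * (p * (s k * P k))" by (simp add: x_def y_def right_diff_distrib)
    then have "(a + b * x) powr (p - 1) * (x - y) / p \<le> (a + b * x) powr (p - 1) * (r k powr p * (p * (s k * P k))) / p"
      using p_pos by (intro divide_right_mono mult_left_mono) auto
    also have "\<dots> = s k * (G k * P k)" using p_pos by (simp add: G_def x_def)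
    finally have 3: "(a + b * x) powr (p - 1) * (x - y) / p \<le> s k * (G k * P k)" .
    have "s k * Q k = PF (\<lambda>t. r k * U (z k) t) - PF (\<lambda>t. r k * U w t)"
      using sk by (simp add: Q_def Uz)
    then have "0 \<le> s k * (G k * P k - Q k)" using 1 2 3 by (simp add: right_diff_distrib)
    then show ?case using sk by (simp add: zero_le_mult_iff)
  qed
  have "(\<lambda>k. G k * P k - Q k) \<longlonglongrightarrow> ((a + b * (1 powr p * A)) powr (p - 1) * 1 powr p)
      * (\<integral>t. phi_p p (w t) * v t \<partial>M) - (\<integral>t. f t (U w t) * U v t \<partial>M)"
  proof (intro tendsto_diff tendsto_mult)
    have rp: "(\<lambda>k. r k powr p) \<longlonglongrightarrow> 1 powr p" by (intro tendsto_powr r tendsto_const) simp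
    have "a + b * (1 powr p * A) \<noteq> 0" using a b A by (simp add: add_pos_pos less_imp_neq[THEN not_sym])
    then show "G \<longlonglongrightarrow> (a + b * (1 powr p * A)) powr (p - 1) * 1 powr p"
      unfolding G_def by (intro tendsto_mult tendsto_powr[OF tendsto_add] tendsto_const rp zm)
    show "P \<longlonglongrightarrow> (\<integral>t. phi_p p (w t) * v t \<partial>M)"
      unfolding P_def by (intro phi_p_mult_tendsto wL vL s(1)) (use s(2) in \<open>simp add: less_imp_le\<close>)
    show "Q \<longlonglongrightarrow> (\<integral>t. f t (U w t) * U v t \<partial>M)"
      unfolding Q_def by (intro PF_quotient_tendsto U_continuous_on wL vL s r)
  qed
  then have "(\<lambda>k. G k * P k - Q k) \<longlonglongrightarrow> dJ w v" by (simp add: dJ_def A_def)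
  then show ?thesis by (rule tendsto_lowerbound[OF _ main]) simp
qed

lemma dJ_uminus:
  assumes "Lp_fun p M w" "Lp_fun p M v"
  shows "dJ w (\<lambda>t. (-1) * v t) = - dJ w v"
  unfolding dJ_def U_scale[OF assms(2)] by (simp add: mult.assoc[symmetric])

text \<open>The one-sided inequality is applied to v and to -v.\<close>

lemma minimiser_dJ_eq_0:
  assumes w: "NN w" "\<And>v. NN v \<Longrightarrow> level w \<le> level v" and v: "W v"
  shows "dJ w v = 0"
proof -
  have "Lp_fun p M w" using w(1) by (simp add: NN_def W_Lp)
  then show ?thesis
    using minimiser_dJ_nonneg[OF w v] minimiser_dJ_nonneg[OF w W_scale[OF v, of "-1"]] dJ_uminus[OF _ W_Lp[OF v]]
    by simp
qed

section \<open>Return to pairs of a function and its derivative\<close>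

lemma energy_eq:
  assumes "u \<in> borel_measurable M" "AE t in M. u t = U w t" "W w"
  shows "energy T a b p f u w = level w"
proof -
  have "(\<integral>t. Fprim f t (u t) \<partial>M) = (\<integral>t. Fprim f t (U w t) \<partial>M)"
  proof (rule integral_cong_AE)
    show "(\<lambda>t. Fprim f t (u t)) \<in> borel_measurable M" by (rule comp_measurable[OF Fprim_cont assms(1)])
    show "(\<lambda>t. Fprim f t (U w t)) \<in> borel_measurable M"
      by (rule borel_measurable_integrable[OF PF_integrable[OF U_continuous_on[OF W_Lp[OF assms(3)]]]])
    show "AE t in M. Fprim f t (u t) = Fprim f t (U w t)" using assms(2) by eventually_elim simp
  qed
  then show ?thesis
    by (simp add: energy_def level_def Phi_def PF_def set_integral_eq_MT Lp_mass_def diff_divide_distrib)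
qed

lemma dI_eq:
  assumes u: "u \<in> borel_measurable M" "AE t in M. u t = U w t" and w: "W w"
    and v: "v \<in> borel_measurable M" "AE t in M. v t = U w' t" and w': "W w'"
  shows "dI T a b p f u w v w' = dJ w w'"
proof -
  have "(\<integral>t. f t (u t) * v t \<partial>M) = (\<integral>t. f t (U w t) * U w' t \<partial>M)"
  proof (rule integral_cong_AE)
    show "(\<lambda>t. f t (u t) * v t) \<in> borel_measurable M"
      by (intro borel_measurable_times comp_measurable[OF f_cont u(1)] v(1))
    show "(\<lambda>t. f t (U w t) * U w' t) \<in> borel_measurable M"
      by (intro continuous_on_borel_measurable_MT continuous_on_mult comp_continuous_on[OF f_cont]
          U_continuous_on W_Lp w w')
    show "AE t in M. f t (u t) * v t = f t (U w t) * U w' t" using u(2) v(2) by eventually_elim simp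
  qed
  then show ?thesis by (simp add: dI_def dJ_def set_integral_eq_MT Lp_mass_def)
qed

lemma dJ_self: "dJ w w = gN (mass w) (U w)"
  by (simp add: dJ_def gN_def Sf_def Lp_mass_def phi_p_mult_self)

lemma nehari_imp_NN:
  assumes "nehari T \<alpha> a b p f u w"
  shows "NN w" "energy T a b p f u w = level w"
proof -
  have E: "in_E T \<alpha> p u w" and nt: "nontrivial_on T u" and d: "dI T a b p f u w u w = 0"
    using assms by (auto simp: nehari_def)
  note u = in_E_imp[OF E]
  show "energy T a b p f u w = level w" by (rule energy_eq[OF u(2,3,1)])
  have "\<exists>t\<in>{0..T}. U w t \<noteq> 0"
  proof (rule ccontr)
    assume neg: "\<not> (\<exists>t\<in>{0..T}. U w t \<noteq> 0)"
    have "AE t in M. U w t = 0" by (rule AE_I2) (use neg in simp)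
    with u(3) have "AE t in M. u t = 0" by eventually_elim simp
    then show False using nt by (simp add: nontrivial_on_def AE_MT_iff)
  qed
  moreover have "gN (mass w) (U w) = 0"
    using dI_eq[OF u(2,3,1) u(2,3,1)] d by (simp add: dJ_self)
  ultimately show "NN w" using u(1) by (simp add: NN_def)
qed

text \<open>By continuity a nonzero value persists on an interval of positive length, which is not a
  null set.\<close>

lemma nontrivial_on_U:
  assumes w: "Lp_fun p M w" and t: "t \<in> {0..T}" "U w t \<noteq> 0"
  shows "nontrivial_on T (U w)"
proof -
  obtain c d \<eta> where cd: "0 \<le> c" "c < d" "d \<le> T" and \<eta>: "\<eta> > 0" "\<And>t. t \<in> {c..d} \<Longrightarrow> \<bar>U w t\<bar> \<ge> \<eta>"
    using continuous_nonzero_interval[OF U_continuous_on[OF w] t] by blast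
  show ?thesis unfolding nontrivial_on_def
  proof
    assume "AE t in lborel. t \<in> {0..T} \<longrightarrow> U w t = 0"
    then have "AE t in lborel. t \<notin> {c..d}"
      by eventually_elim (use cd \<eta> in force)
    then have "{c..d} \<in> null_sets lborel" by (simp add: AE_iff_null_sets)
    then show False using cd by (simp add: null_sets_def)
  qed
qed

lemma ground_state_exists: "\<exists>u w. ground_state T \<alpha> a b p f u w"
proof -
  obtain w where w: "NN w" "\<And>v. NN v \<Longrightarrow> level w \<le> level v" using minimiser_exists by blast
  have wW: "W w" using w(1) by (simp add: NN_def)
  obtain t where t: "t \<in> {0..T}" "U w t \<noteq> 0" using w(1) unfolding NN_def by blast
  have Um: "U w \<in> borel_measurable M" by (rule borel_measurable_MT[OF U_borel_measurable[OF W_Lp[OF wW]]])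
  have "critical_point T \<alpha> a b p f (U w) w"
    unfolding critical_point_def
  proof (intro conjI allI impI in_E_U wW)
    fix v w' assume "in_E T \<alpha> p v w'"
    note v = in_E_imp[OF this]
    have "dI T a b p f (U w) w v w' = dJ w w'"
      by (rule dI_eq[OF Um _ wW v(2,3,1)]) simp
    then show "dI T a b p f (U w) w v w' = 0" using minimiser_dJ_eq_0[OF w v(1)] by simp
  qed
  moreover have "energy T a b p f (U w) w \<le> energy T a b p f v w'" if "nehari T \<alpha> a b p f v w'" for v w'
    using nehari_imp_NN[OF that] w(2) energy_eq[OF Um _ wW] by simp
  moreover have "nontrivial_on T (U w)" by (rule nontrivial_on_U[OF W_Lp[OF wW] t])
  ultimately show ?thesis unfolding ground_state_def by blast
qed

end

theorem theorem1p1: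
  fixes T a b p \<alpha> :: real and f :: "real \<Rightarrow> real \<Rightarrow> real"
  assumes T: "T > 0" and a: "a > 0" and b: "b > 0" and p: "p > 1"
    and \<alpha>: "1 / p < \<alpha>" "\<alpha> \<le> 1"
    and f_C1: "\<exists>ft fx. continuous_on ({0..T} \<times> UNIV) ft \<and> continuous_on ({0..T} \<times> UNIV) fx \<and>
        (\<forall>z \<in> {0..T} \<times> UNIV. ((\<lambda>(t, x). f t x) has_derivative
            (\<lambda>(h, k). ft z * h + fx z * k)) (at z within {0..T} \<times> UNIV))"
    and f_i: "\<forall>t \<in> {0..T}. strict_mono_on (- {0}) (\<lambda>x. f t x / \<bar>x\<bar> powr (p^2 - 1))"
    and f_ii: "\<forall>\<epsilon>>0. \<exists>\<delta>>0. \<forall>t \<in> {0..T}. \<forall>x. 0 < \<bar>x\<bar> \<and> \<bar>x\<bar> < \<delta> \<longrightarrow>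
        \<bar>f t x\<bar> \<le> \<epsilon> * \<bar>x\<bar> powr (p - 1)"
    and f_iii: "\<exists>\<mu> R. \<mu> > p^2 \<and> R > 0 \<and> (\<forall>t \<in> {0..T}. \<forall>x. \<bar>x\<bar> \<ge> R \<longrightarrow>
        0 < \<mu> * Fprim f t x \<and> \<mu> * Fprim f t x \<le> x * f t x)"
  shows "\<exists>u w. ground_state T \<alpha> a b p f u w"
proof -
  obtain ft fx where D: "\<And>z. z \<in> {0..T} \<times> UNIV \<Longrightarrow> ((\<lambda>(t, x). f t x) has_derivative
      (\<lambda>(h, k). ft z * h + fx z * k)) (at z within {0..T} \<times> UNIV)"
    using f_C1 by blast
  interpret kirchhoff T p \<alpha> a b f
  proof
    show "continuous_on ({0..T} \<times> UNIV) (\<lambda>(t, x). f t x)"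
      by (rule has_derivative_continuous_on[OF D])
    show "strict_mono_on (- {0}) (\<lambda>x. f t x / \<bar>x\<bar> powr (p^2 - 1))" if "t \<in> {0..T}" for t
      using f_i that by blast
    show "\<exists>d>0. \<forall>t\<in>{0..T}. \<forall>x. 0 < \<bar>x\<bar> \<and> \<bar>x\<bar> < d \<longrightarrow> \<bar>f t x\<bar> \<le> e * \<bar>x\<bar> powr (p - 1)"
      if "e > 0" for e
      by (rule f_ii[rule_format, OF that, unfolded Ball_def[symmetric]])
  qed (fact T p \<alpha> a b f_iii)+
  show ?thesis by (rule ground_state_exists)
qed

end
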